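(* Let $\varphi\colon T\rightarrow S$ be a morphism of non-zero Tambara functors on $G$. (1) If $\mathfrak{q}\subsetneq S$ is a prime ideal, then $\varphi^{-1}(\mathfrak{q})\subseteq T$ is a prime ideal. This gives a continuous map $$\varphi^a\colon\mathrm{Spec}(S)\rightarrow\mathrm{Spec}(T);\quad\mathfrak{q}\mapsto\varphi^{-1}(\mathfrak{q}).$$ (2) Assume $\varphi$ is surjective. If $\mathfrak{p}\subsetneq T$ is a prime ideal containing $\mathrm{Ker}\,\varphi$, then $\varphi(\mathfrak{p})\subseteq S$ is a prime ideal. This gives a continuous map $$\varphi_\sharp\colon V(\mathrm{Ker}\,\varphi)\rightarrow\mathrm{Spec}(S);\quad\mathfrak{p}\mapsto\varphi(\mathfrak{p}).$$
   Context: $G$ is a fixed finite group; ${}_G\mathrm{set}$ is the category of finite $G$-sets and $G$-equivariant maps. Rings and monoids are commutative with unit. Semi-Mackey functor $M=(M^*,M_* )$ on $G$: a contravariant functor $M^*$ and a covariant functor $M_*$ from ${}_G\mathrm{set}$ to sets with $M^*(X)=M_*(X)=:M(X)$ such that (a) $M^*$ sends finite coproducts to products; (b) for every pull-back square with $f\colon X\to Y$, $\eta\colon Y'\to Y$, $\xi\colon X'\to X$, $f'\colon X'\to Y'$ one has $M^*(\eta)M_*(f)=M_*(f')M^*(\xi)$. Each $M(X)$ is then a commutative monoid (operation $M_*(\nabla)$, $\nabla\colon X\amalg X\to X$ the folding map). It is a Mackey functor if all $M(X)$ are abelian groups. Exponential diagram of $X\overset{p}{\leftarrow}A$ and $f\colon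 X\to Y$: up to isomorphism, $\Pi=\{(y,\sigma)\mid y\in Y,\ \sigma\colon f^{-1}(y)\to A \text{ a map of sets},\ p\circ\sigma=\mathrm{id}\}$ with $G$-action by conjugating $\sigma$, $\pi\colon\Pi\to Y$, $\pi(y,\sigma)=y$, $Z=X\times_Y\Pi$, $\rho\colon Z\to\Pi$ the projection, $\lambda\colon Z\to A$, $\lambda(x,(y,\sigma))=\sigma(x)$. Tambara functor $T=(T^*,T_+,T_\bullet)$ on $G$: $T^*$ contravariant, $T_+,T_\bullet$ covariant functors ${}_G\mathrm{set}\to\mathrm{Set}$ such that $(T^*,T_+)$ is a Mackey functor, $(T^*,T_\bullet)$ is a semi-Mackey functor, and $T_\bullet(f)T_+(p)=T_+(\pi)T_\bullet(\rho)T^*(\lambda)$ for every exponential diagram. Each $T(X)$ is a ring. For $f\colon X\to Y$ write $f^*=T^*(f)$ (a ring homomorphism), $f_+=T_+(f)$ (additive), $f_\bullet=T_\bullet(f)$ (multiplicative). A morphism $\varphi\colon T\to S$ is a family of ring homomorphisms $\varphi_X\colon T(X)\to S(X)$ commuting with all $f^*,f_+,f_\bullet$; it is surjective if every $\varphi_X$ is surjective. An ideal $\mathscr{I}$ of $T$ is a family of ideals $\mathscr{I}(X)\subseteq T(X)$ such that for every $f\colon X\to Y$: $f^*(\mathscr{I}(Y))\subseteq\mathscr{I}(X)$, $f_+(\mathscr{I}(X))\subseteq\mathscr{I}(Y)$, $f_\bullet(\mathscr{I}(X))\subseteq f_\bullet(0)+\mathscr{I}(Y)$. $\mathrm{Ker}\,\varphi=\{\mathrm{Ker}\,\varphi_X\}_X$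 is an ideal of $T$. For an ideal $\mathscr{J}\subseteq S$, $\varphi^{-1}(\mathscr{J})(X)=\varphi_X^{-1}(\mathscr{J}(X))$; for $\varphi$ surjective and an ideal $\mathscr{I}\supseteq\mathrm{Ker}\,\varphi$ of $T$, $\varphi(\mathscr{I})(X)=\varphi_X(\mathscr{I}(X))$; these are ideals. For $a\in T(A)$, $\langle a\rangle$ is the smallest ideal of $T$ containing $a$. The product of ideals is the ideal given by $(\mathscr{I}\mathscr{J})(X)=\{p_+(ab)\mid p\colon A\to X,\ a\in\mathscr{I}(A),\ b\in\mathscr{J}(A)\}$. An ideal $\mathfrak{p}\subsetneq T$ is prime if for all transitive $X,Y$ and all $a\in T(X)$, $b\in T(Y)$, $\langle a\rangle\langle b\rangle\subseteq\mathfrak{p}$ implies $a\in\mathfrak{p}(X)$ or $b\in\mathfrak{p}(Y)$. $\mathrm{Spec}(T)$ is the set of prime ideals of $T$, topologized by taking as closed sets the $V(\mathscr{I})=\{\mathfrak{p}\in\mathrm{Spec}(T)\mid\mathscr{I}\subseteq\mathfrak{p}\}$ for ideals $\mathscr{I}\subseteq T$; $V(\mathrm{Ker}\,\varphi)$ carries the subspace topology. *)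

theory Defs
  imports
    "HOL-Algebra.Group_Action"
    "HOL-Algebra.Ideal"
    "HOL-Algebra.RingHom"
    "HOL-Analysis.Abstract_Topology"
    "HOL-Library.Infinite_Typeclass"
begin

section \<open>Finite G-sets\<close>

text \<open>
  Functors on finite G-sets are considered on those finite G-sets whose points lie in a fixed
  but arbitrary infinite type \<open>'u\<close>. Up to isomorphism this is every finite G-set, so this full
  subcategory is equivalent to the category of all finite G-sets; coproducts, pull-backs and
  exponential diagrams are characterised up to isomorphism and exist inside it.
  Actions and maps are taken to be extensional, so that equality in HOL is equality of G-sets
  and of maps.
\<close>

record ('g, 'x) gset =
  pts :: "'x set"
  act :: "'g \<Rightarrow> 'x \<Rightarrow> 'x"

definition fin_gset :: "('g, 'm) monoid_scheme \<Rightarrow> ('g, 'x) gset \<Rightarrow> bool" where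
  "fin_gset G X \<longleftrightarrow>
     finite (pts X) \<and> group_action G (pts X) (act X) \<and> act X \<in> extensional (carrier G)"

definition gmap ::
  "('g, 'm) monoid_scheme \<Rightarrow> ('g, 'x) gset \<Rightarrow> ('g, 'y) gset \<Rightarrow> ('x \<Rightarrow> 'y) \<Rightarrow> bool" where
  "gmap G X Y f \<longleftrightarrow>
     fin_gset G X \<and> fin_gset G Y \<and> f \<in> pts X \<rightarrow>\<^sub>E pts Y \<and>
     (\<forall>g\<in>carrier G. \<forall>x\<in>pts X. f (act X g x) = act Y g (f x))"

definition giso ::
  "('g, 'm) monoid_scheme \<Rightarrow> ('g, 'x) gset \<Rightarrow> ('g, 'y) gset \<Rightarrow> ('x \<Rightarrow> 'y) \<Rightarrow> bool" where
  "giso G X Y f \<longleftrightarrow> gmap G X Y f \<and> bij_betw f (pts X) (pts Y)"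

definition transitive_gset :: "('g, 'm) monoid_scheme \<Rightarrow> ('g, 'x) gset \<Rightarrow> bool" where
  "transitive_gset G X \<longleftrightarrow>
     fin_gset G X \<and> pts X \<noteq> {} \<and> transitive_action G (pts X) (act X)"

text \<open>
  \<open>Z\<close> with the maps \<open>\<iota> k : F k \<rightarrow> Z\<close> (\<open>k < n\<close>) is a coproduct: the induced map from the
  disjoint union is bijective.
\<close>
definition is_coproduct ::
  "('g, 'm) monoid_scheme \<Rightarrow> nat \<Rightarrow> (nat \<Rightarrow> ('g, 'x) gset) \<Rightarrow> ('g, 'x) gset \<Rightarrow>
   (nat \<Rightarrow> 'x \<Rightarrow> 'x) \<Rightarrow> bool" where
  "is_coproduct G n F Z \<iota> \<longleftrightarrow>
     fin_gset G Z \<and> (\<forall>k<n. gmap G (F k) Z (\<iota> k)) \<and>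
     bij_betw (\<lambda>(k, x). \<iota> k x) (SIGMA k:{..<n}. pts (F k)) (pts Z)"

definition fibre_product ::
  "('g, 'm) monoid_scheme \<Rightarrow> ('g, 'x) gset \<Rightarrow> ('x \<Rightarrow> 'z) \<Rightarrow> ('g, 'y) gset \<Rightarrow> ('y \<Rightarrow> 'z) \<Rightarrow>
   ('g, 'x \<times> 'y) gset" where
  "fibre_product G X f P h =
     (let E = {(x, t). x \<in> pts X \<and> t \<in> pts P \<and> f x = h t} in
      \<lparr>pts = E, act = (\<lambda>g\<in>carrier G. \<lambda>z\<in>E. (act X g (fst z), act P g (snd z)))\<rparr>)"

text \<open>The square with \<open>f : X \<rightarrow> Y\<close>, \<open>\<eta> : Y' \<rightarrow> Y\<close>, \<open>\<xi> : X' \<rightarrow> X\<close>, \<open>f' : X' \<rightarrow> Y'\<close>.\<close>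
definition is_pullback ::
  "('g, 'm) monoid_scheme \<Rightarrow>
   ('g, 'x) gset \<Rightarrow> ('g, 'x) gset \<Rightarrow> ('g, 'x) gset \<Rightarrow> ('g, 'x) gset \<Rightarrow>
   ('x \<Rightarrow> 'x) \<Rightarrow> ('x \<Rightarrow> 'x) \<Rightarrow> ('x \<Rightarrow> 'x) \<Rightarrow> ('x \<Rightarrow> 'x) \<Rightarrow> bool" where
  "is_pullback G X' X Y' Y \<xi> f' f \<eta> \<longleftrightarrow>
     gmap G X Y f \<and> gmap G Y' Y \<eta> \<and> gmap G X' X \<xi> \<and> gmap G X' Y' f' \<and>
     giso G X' (fibre_product G X f Y' \<eta>) (\<lambda>x\<in>pts X'. (\<xi> x, f' x))"

text \<open>
  The G-set \<open>\<Pi>\<close> of pairs \<open>(y, \<sigma>)\<close> where \<open>\<sigma>\<close> is a section of \<open>p : A \<rightarrow> X\<close> over the fibre of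
  \<open>f : X \<rightarrow> Y\<close> at \<open>y\<close>; the group acts by conjugating \<open>\<sigma>\<close>.
\<close>
definition section_gset ::
  "('g, 'm) monoid_scheme \<Rightarrow> ('g, 'x) gset \<Rightarrow> ('g, 'x) gset \<Rightarrow> ('g, 'x) gset \<Rightarrow>
   ('x \<Rightarrow> 'x) \<Rightarrow> ('x \<Rightarrow> 'x) \<Rightarrow> ('g, 'x \<times> ('x \<Rightarrow> 'x)) gset" where
  "section_gset G A X Y p f =
     (let fib = (\<lambda>y. {x \<in> pts X. f x = y});
          E = {(y, \<sigma>). y \<in> pts Y \<and> \<sigma> \<in> fib y \<rightarrow>\<^sub>E pts A \<and> (\<forall>x\<in>fib y. p (\<sigma> x) = x)}
      in \<lparr>pts = E,
          act = (\<lambda>g\<in>carrier G. \<lambda>t\<in>E.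
                   (act Y g (fst t),
                    \<lambda>x\<in>fib (act Y g (fst t)). act A g (snd t (act X (inv\<^bsub>G\<^esub> g) x))))\<rparr>)"

text \<open>
  The maps \<open>p : A \<rightarrow> X\<close>, \<open>f : X \<rightarrow> Y\<close>, \<open>\<pi> : P \<rightarrow> Y\<close>, \<open>\<rho> : Z \<rightarrow> P\<close>, \<open>l : Z \<rightarrow> A\<close> form an
  exponential diagram if \<open>P\<close> and \<open>Z\<close> can be identified, via \<open>e\<close> and \<open>d\<close>, with \<open>\<Pi>\<close> and
  \<open>X \<times>\<^sub>Y \<Pi>\<close> such that \<open>\<pi> (y, \<sigma>) = y\<close>, \<open>\<rho> (x, t) = t\<close> and \<open>l (x, (y, \<sigma>)) = \<sigma> x\<close>.
\<close>
definition is_exponential ::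
  "('g, 'm) monoid_scheme \<Rightarrow>
   ('g, 'x) gset \<Rightarrow> ('g, 'x) gset \<Rightarrow> ('g, 'x) gset \<Rightarrow> ('g, 'x) gset \<Rightarrow> ('g, 'x) gset \<Rightarrow>
   ('x \<Rightarrow> 'x) \<Rightarrow> ('x \<Rightarrow> 'x) \<Rightarrow> ('x \<Rightarrow> 'x) \<Rightarrow> ('x \<Rightarrow> 'x) \<Rightarrow> ('x \<Rightarrow> 'x) \<Rightarrow> bool" where
  "is_exponential G A X Y P Z p f \<pi> \<rho> l \<longleftrightarrow>
     gmap G A X p \<and> gmap G X Y f \<and> gmap G P Y \<pi> \<and> gmap G Z P \<rho> \<and> gmap G Z A l \<and>
     (\<exists>e d. giso G P (section_gset G A X Y p f) e \<and>
            giso G Z (fibre_product G X f (section_gset G A X Y p f) fst) d \<and>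
            (\<forall>t\<in>pts P. \<pi> t = fst (e t)) \<and>
            (\<forall>z\<in>pts Z. e (\<rho> z) = snd (d z)) \<and>
            (\<forall>z\<in>pts Z. l z = snd (snd (d z)) (fst (d z))))"


section \<open>Semi-Mackey and Mackey functors\<close>

text \<open>
  For \<open>f : X \<rightarrow> Y\<close> the contravariant and covariant maps are \<open>up X Y f : M Y \<rightarrow> M X\<close> and
  \<open>dn X Y f : M X \<rightarrow> M Y\<close>.
\<close>
locale semi_mackey_functor =
  fixes G :: "('g, 'm) monoid_scheme" (structure)
    and M :: "('g, 'u::infinite) gset \<Rightarrow> 't set"
    and up :: "('g, 'u) gset \<Rightarrow> ('g, 'u) gset \<Rightarrow> ('u \<Rightarrow> 'u) \<Rightarrow> 't \<Rightarrow> 't"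
    and dn :: "('g, 'u) gset \<Rightarrow> ('g, 'u) gset \<Rightarrow> ('u \<Rightarrow> 'u) \<Rightarrow> 't \<Rightarrow> 't"
  assumes up_closed: "\<And>X Y f. gmap G X Y f \<Longrightarrow> up X Y f \<in> M Y \<rightarrow> M X"
    and up_id: "\<And>X c. \<lbrakk>fin_gset G X; c \<in> M X\<rbrakk> \<Longrightarrow> up X X (\<lambda>x\<in>pts X. x) c = c"
    and up_comp: "\<And>X Y Z f h c. \<lbrakk>gmap G X Y f; gmap G Y Z h; c \<in> M Z\<rbrakk> \<Longrightarrow>
           up X Z (compose (pts X) h f) c = up X Y f (up Y Z h c)"
    and dn_closed: "\<And>X Y f. gmap G X Y f \<Longrightarrow> dn X Y f \<in> M X \<rightarrow> M Y"
    and dn_id: "\<And>X c. \<lbrakk>fin_gset G X; c \<in> M X\<rbrakk> \<Longrightarrow> dn X X (\<lambda>x\<in>pts X. x) c = c"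
    and dn_comp: "\<And>X Y Z f h c. \<lbrakk>gmap G X Y f; gmap G Y Z h; c \<in> M X\<rbrakk> \<Longrightarrow>
           dn X Z (compose (pts X) h f) c = dn Y Z h (dn X Y f c)"
    and up_coproduct: "\<And>n F Z \<iota>. is_coproduct G n F Z \<iota> \<Longrightarrow>
           bij_betw (\<lambda>c. \<lambda>k\<in>{..<n}. up (F k) Z (\<iota> k) c) (M Z) (\<Pi>\<^sub>E k\<in>{..<n}. M (F k))"
    and base_change: "\<And>X' X Y' Y \<xi> f' f \<eta> c.
           \<lbrakk>is_pullback G X' X Y' Y \<xi> f' f \<eta>; c \<in> M X\<rbrakk> \<Longrightarrow>
           up Y' Y \<eta> (dn X Y f c) = dn X' Y' f' (up X' X \<xi> c)"

text \<open>
  The operation on \<open>M X\<close> is the covariant map of the folding map \<open>\<nabla>\<close>, precomposed with the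
  identification of \<open>M X \<times> M X\<close> with the value at the coproduct \<open>Z\<close> of two copies of \<open>X\<close>. The
  result does not depend on the choice of \<open>Z\<close> and \<open>\<iota>\<close>; the definite description avoids
  singling out one coproduct in \<open>'u\<close>.
\<close>
definition fold_op ::
  "('g, 'm) monoid_scheme \<Rightarrow> (('g, 'u::infinite) gset \<Rightarrow> 't set) \<Rightarrow>
   (('g, 'u) gset \<Rightarrow> ('g, 'u) gset \<Rightarrow> ('u \<Rightarrow> 'u) \<Rightarrow> 't \<Rightarrow> 't) \<Rightarrow>
   (('g, 'u) gset \<Rightarrow> ('g, 'u) gset \<Rightarrow> ('u \<Rightarrow> 'u) \<Rightarrow> 't \<Rightarrow> 't) \<Rightarrow>
   ('g, 'u) gset \<Rightarrow> 't \<Rightarrow> 't \<Rightarrow> 't" where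
  "fold_op G M up dn X a b =
     (THE s. \<exists>Z \<iota> h c.
        is_coproduct G 2 (\<lambda>_. X) Z \<iota> \<and>
        gmap G Z X h \<and> (\<forall>k<2. \<forall>x\<in>pts X. h (\<iota> k x) = x) \<and>
        c \<in> M Z \<and> up X Z (\<iota> 0) c = a \<and> up X Z (\<iota> 1) c = b \<and>
        s = dn Z X h c)"

definition fold_monoid ::
  "('g, 'm) monoid_scheme \<Rightarrow> (('g, 'u::infinite) gset \<Rightarrow> 't set) \<Rightarrow>
   (('g, 'u) gset \<Rightarrow> ('g, 'u) gset \<Rightarrow> ('u \<Rightarrow> 'u) \<Rightarrow> 't \<Rightarrow> 't) \<Rightarrow>
   (('g, 'u) gset \<Rightarrow> ('g, 'u) gset \<Rightarrow> ('u \<Rightarrow> 'u) \<Rightarrow> 't \<Rightarrow> 't) \<Rightarrow>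
   ('g, 'u) gset \<Rightarrow> 't monoid" where
  "fold_monoid G M up dn X =
     \<lparr>carrier = M X,
      mult = fold_op G M up dn X,
      one = (THE e. e \<in> M X \<and> (\<forall>a\<in>M X. fold_op G M up dn X e a = a))\<rparr>"

locale mackey_functor = semi_mackey_functor +
  assumes abelian_groups: "\<And>X. fin_gset G X \<Longrightarrow> comm_group (fold_monoid G M up dn X)"


section \<open>Tambara functors\<close>

text \<open>
  \<open>Tres X Y f\<close>, \<open>Ttr X Y f\<close> and \<open>Tnm X Y f\<close> are the restriction, the additive transfer and the
  multiplicative transfer along \<open>f : X \<rightarrow> Y\<close>.
\<close>
record ('g, 'u, 't) tambara =
  Tval :: "('g, 'u) gset \<Rightarrow> 't set"
  Tres :: "('g, 'u) gset \<Rightarrow> ('g, 'u) gset \<Rightarrow> ('u \<Rightarrow> 'u) \<Rightarrow> 't \<Rightarrow> 't"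
  Ttr :: "('g, 'u) gset \<Rightarrow> ('g, 'u) gset \<Rightarrow> ('u \<Rightarrow> 'u) \<Rightarrow> 't \<Rightarrow> 't"
  Tnm :: "('g, 'u) gset \<Rightarrow> ('g, 'u) gset \<Rightarrow> ('u \<Rightarrow> 'u) \<Rightarrow> 't \<Rightarrow> 't"

definition tambara_functor ::
  "('g, 'm) monoid_scheme \<Rightarrow> ('g, 'u::infinite, 't) tambara \<Rightarrow> bool" where
  "tambara_functor G T \<longleftrightarrow>
     mackey_functor G (Tval T) (Tres T) (Ttr T) \<and>
     semi_mackey_functor G (Tval T) (Tres T) (Tnm T) \<and>
     (\<forall>A X Y P Z p f \<pi> \<rho> l. is_exponential G A X Y P Z p f \<pi> \<rho> l \<longrightarrow>
        (\<forall>a\<in>Tval T A. Tnm T X Y f (Ttr T A X p a) = Ttr T P Y \<pi> (Tnm T Z P \<rho> (Tres T Z A l a))))"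

definition Tring ::
  "('g, 'm) monoid_scheme \<Rightarrow> ('g, 'u::infinite, 't) tambara \<Rightarrow> ('g, 'u) gset \<Rightarrow> 't ring" where
  "Tring G T X =
     \<lparr>carrier = Tval T X,
      mult = mult (fold_monoid G (Tval T) (Tres T) (Tnm T) X),
      one = one (fold_monoid G (Tval T) (Tres T) (Tnm T) X),
      zero = one (fold_monoid G (Tval T) (Tres T) (Ttr T) X),
      add = mult (fold_monoid G (Tval T) (Tres T) (Ttr T) X)\<rparr>"

definition nonzero_tambara ::
  "('g, 'm) monoid_scheme \<Rightarrow> ('g, 'u::infinite, 't) tambara \<Rightarrow> bool" where
  "nonzero_tambara G T \<longleftrightarrow> (\<exists>X. fin_gset G X \<and> Tval T X \<noteq> {\<zero>\<^bsub>Tring G T X\<^esub>})"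

definition tambara_morphism ::
  "('g, 'm) monoid_scheme \<Rightarrow> ('g, 'u::infinite, 't) tambara \<Rightarrow> ('g, 'u, 's) tambara \<Rightarrow>
   (('g, 'u) gset \<Rightarrow> 't \<Rightarrow> 's) \<Rightarrow> bool" where
  "tambara_morphism G T S \<phi> \<longleftrightarrow>
     (\<forall>X. fin_gset G X \<longrightarrow> \<phi> X \<in> ring_hom (Tring G T X) (Tring G S X)) \<and>
     (\<forall>X Y f. gmap G X Y f \<longrightarrow>
        (\<forall>c\<in>Tval T Y. \<phi> X (Tres T X Y f c) = Tres S X Y f (\<phi> Y c)) \<and>
        (\<forall>c\<in>Tval T X. \<phi> Y (Ttr T X Y f c) = Ttr S X Y f (\<phi> X c)) \<and>
        (\<forall>c\<in>Tval T X. \<phi> Y (Tnm T X Y f c) = Tnm S X Y f (\<phi> X c)))"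

definition surjective_morphism ::
  "('g, 'm) monoid_scheme \<Rightarrow> ('g, 'u::infinite, 't) tambara \<Rightarrow> ('g, 'u, 's) tambara \<Rightarrow>
   (('g, 'u) gset \<Rightarrow> 't \<Rightarrow> 's) \<Rightarrow> bool" where
  "surjective_morphism G T S \<phi> \<longleftrightarrow> (\<forall>X. fin_gset G X \<longrightarrow> \<phi> X ` Tval T X = Tval S X)"


section \<open>Ideals\<close>

text \<open>
  Families of subsets are indexed by the finite G-sets only; they are made extensional, so that
  equality of families is equality on all finite G-sets.
\<close>
definition Tideal ::
  "('g, 'm) monoid_scheme \<Rightarrow> ('g, 'u::infinite, 't) tambara \<Rightarrow> (('g, 'u) gset \<Rightarrow> 't set) \<Rightarrow>
   bool" where
  "Tideal G T I \<longleftrightarrow>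
     I \<in> extensional {X. fin_gset G X} \<and>
     (\<forall>X. fin_gset G X \<longrightarrow> ideal (I X) (Tring G T X)) \<and>
     (\<forall>X Y f. gmap G X Y f \<longrightarrow>
        Tres T X Y f ` I Y \<subseteq> I X \<and>
        Ttr T X Y f ` I X \<subseteq> I Y \<and>
        Tnm T X Y f ` I X \<subseteq> Tnm T X Y f \<zero>\<^bsub>Tring G T X\<^esub> <+\<^bsub>Tring G T Y\<^esub> I Y)"

definition subfamily ::
  "('g, 'm) monoid_scheme \<Rightarrow> (('g, 'u) gset \<Rightarrow> 't set) \<Rightarrow> (('g, 'u) gset \<Rightarrow> 't set) \<Rightarrow> bool" where
  "subfamily G I J \<longleftrightarrow> (\<forall>X. fin_gset G X \<longrightarrow> I X \<subseteq> J X)"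

definition Tker ::
  "('g, 'm) monoid_scheme \<Rightarrow> ('g, 'u::infinite, 't) tambara \<Rightarrow> ('g, 'u, 's) tambara \<Rightarrow>
   (('g, 'u) gset \<Rightarrow> 't \<Rightarrow> 's) \<Rightarrow> ('g, 'u) gset \<Rightarrow> 't set" where
  "Tker G T S \<phi> = (\<lambda>X\<in>{X. fin_gset G X}. a_kernel (Tring G T X) (Tring G S X) (\<phi> X))"

definition Tpreimage ::
  "('g, 'm) monoid_scheme \<Rightarrow> ('g, 'u, 't) tambara \<Rightarrow> (('g, 'u) gset \<Rightarrow> 't \<Rightarrow> 's) \<Rightarrow>
   (('g, 'u) gset \<Rightarrow> 's set) \<Rightarrow> ('g, 'u) gset \<Rightarrow> 't set" where
  "Tpreimage G T \<phi> J = (\<lambda>X\<in>{X. fin_gset G X}. {c \<in> Tval T X. \<phi> X c \<in> J X})"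

definition Timage ::
  "('g, 'm) monoid_scheme \<Rightarrow> (('g, 'u) gset \<Rightarrow> 't \<Rightarrow> 's) \<Rightarrow>
   (('g, 'u) gset \<Rightarrow> 't set) \<Rightarrow> ('g, 'u) gset \<Rightarrow> 's set" where
  "Timage G \<phi> I = (\<lambda>X\<in>{X. fin_gset G X}. \<phi> X ` I X)"

definition principal ::
  "('g, 'm) monoid_scheme \<Rightarrow> ('g, 'u::infinite, 't) tambara \<Rightarrow> ('g, 'u) gset \<Rightarrow> 't \<Rightarrow>
   ('g, 'u) gset \<Rightarrow> 't set" where
  "principal G T A a =
     (\<lambda>X\<in>{X. fin_gset G X}. \<Inter> {I X | I. Tideal G T I \<and> a \<in> I A})"

definition Tprod ::
  "('g, 'm) monoid_scheme \<Rightarrow> ('g, 'u::infinite, 't) tambara \<Rightarrow> (('g, 'u) gset \<Rightarrow> 't set) \<Rightarrow>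
   (('g, 'u) gset \<Rightarrow> 't set) \<Rightarrow> ('g, 'u) gset \<Rightarrow> 't set" where
  "Tprod G T I J =
     (\<lambda>X\<in>{X. fin_gset G X}.
        {Ttr T A X p (a \<otimes>\<^bsub>Tring G T A\<^esub> b) | A p a b. gmap G A X p \<and> a \<in> I A \<and> b \<in> J A})"

definition Tprime ::
  "('g, 'm) monoid_scheme \<Rightarrow> ('g, 'u::infinite, 't) tambara \<Rightarrow> (('g, 'u) gset \<Rightarrow> 't set) \<Rightarrow>
   bool" where
  "Tprime G T P \<longleftrightarrow>
     Tideal G T P \<and>
     (\<exists>X. fin_gset G X \<and> P X \<noteq> Tval T X) \<and>
     (\<forall>X Y. transitive_gset G X \<longrightarrow> transitive_gset G Y \<longrightarrow>
        (\<forall>a\<in>Tval T X. \<forall>b\<in>Tval T Y.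
           subfamily G (Tprod G T (principal G T X a) (principal G T Y b)) P \<longrightarrow>
           a \<in> P X \<or> b \<in> P Y))"


section \<open>The prime spectrum\<close>

definition Spec ::
  "('g, 'm) monoid_scheme \<Rightarrow> ('g, 'u::infinite, 't) tambara \<Rightarrow> (('g, 'u) gset \<Rightarrow> 't set) set" where
  "Spec G T = {P. Tprime G T P}"

definition Vset ::
  "('g, 'm) monoid_scheme \<Rightarrow> ('g, 'u::infinite, 't) tambara \<Rightarrow> (('g, 'u) gset \<Rightarrow> 't set) \<Rightarrow>
   (('g, 'u) gset \<Rightarrow> 't set) set" where
  "Vset G T I = {P \<in> Spec G T. subfamily G I P}"

definition spec_topology ::
  "('g, 'm) monoid_scheme \<Rightarrow> ('g, 'u::infinite, 't) tambara \<Rightarrow>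
   (('g, 'u) gset \<Rightarrow> 't set) topology" where
  "spec_topology G T = topology (\<lambda>U. \<exists>I. Tideal G T I \<and> U = Spec G T - Vset G T I)"

end

theory Submission
  imports Defs
begin

text \<open>
  The preimage of a prime ideal \<open>\<qq>\<close> is shown to be prime through extended ideals: for an ideal \<open>I\<close> of
  \<open>T\<close>, the elements \<open>u\<^sub>+(c \<cdot> \<phi>(a))\<close> with \<open>u : C \<rightarrow> X\<close>, \<open>c \<in> S(C)\<close>, \<open>a \<in> I(C)\<close> form an ideal of \<open>S\<close>.
  Closure under norms is the distributive law \<open>f\<^sub>\<bullet> u\<^sub>+ = \<pi>\<^sub>+ \<rho>\<^sub>\<bullet> \<lambda>\<^sup>*\<close> together with
  \<open>\<rho>\<^sub>\<bullet>(\<lambda>\<^sup>*a) \<in> \<rho>\<^sub>\<bullet>(0) + I\<close>. Hence \<open>\<langle>\<phi>(a)\<rangle>\<close> lies in the extension of \<open>\<langle>a\<rangle>\<close>, and by Frobenius reciprocity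
  \<open>\<phi>(\<langle>a\<rangle>\<langle>b\<rangle>) \<subseteq> \<qq>\<close> implies \<open>\<langle>\<phi>(a)\<rangle>\<langle>\<phi>(b)\<rangle> \<subseteq> \<qq>\<close>. For surjective \<open>\<phi>\<close> one has
  \<open>\<phi>(\<langle>a\<rangle>) \<subseteq> \<langle>\<phi>(a)\<rangle>\<close>, which settles images. The sets \<open>V(I)\<close> are the closed sets of a topology because
  \<open>V(I) \<union> V(J) = V(I \<inter> J)\<close>; this uses that every value of an ideal is determined by its values on
  orbits.
\<close>

section \<open>Finite G-sets\<close>

text \<open>Two obstacles shape the proof. First, the values of a Tambara functor come without ring
  operations: sum and product are definite descriptions over coproducts inside \<open>'u\<close>, so
  the ring axioms have to be derived from functoriality, base change and the exponential law before
  ideals can be handled. Additivity of the structure maps rests on one formula for transfers along a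
  map out of a coproduct. Distributivity rests on Frobenius reciprocity, itself an instance of the
  exponential law.

  Second, the image of an ideal under a non-surjective \<phi> is in general not an ideal, while
  primality of \<qq> is tested on generated ideals, which are known only as intersections. The
  extended ideal supplies explicit elements to compute with. It also yields continuity: the inverse
  image of V(I) is V of the extension of I, whereas in the surjective case the inverse image of V(J)
  is cut out by the ideal inverse image of J.

  A norm need not send 0 to 0, so an ideal is closed under norms only up to a constant; several
  arguments turn on cancelling that constant.\<close>

lemma fin_gset_group: "fin_gset G X \<Longrightarrow> group G"
  by (auto simp: fin_gset_def group_action_def group_hom_def)

lemma fin_gset_finite: "fin_gset G X \<Longrightarrow> finite (pts X)"
  by (simp add: fin_gset_def)

lemma act_closed: "fin_gset G X \<Longrightarrow> g \<in> carrier G \<Longrightarrow> x \<in> pts X \<Longrightarrow> act X g x \<in> pts X"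
  by (auto simp: fin_gset_def intro: group_action.element_image)

lemma act_one: "fin_gset G X \<Longrightarrow> x \<in> pts X \<Longrightarrow> act X \<one>\<^bsub>G\<^esub> x = x"
  unfolding fin_gset_def by (metis group_action.id_eq_one restrict_apply')

lemma act_mult:
  "fin_gset G X \<Longrightarrow> g \<in> carrier G \<Longrightarrow> h \<in> carrier G \<Longrightarrow> x \<in> pts X \<Longrightarrow>
   act X (g \<otimes>\<^bsub>G\<^esub> h) x = act X g (act X h x)"
  by (auto simp: fin_gset_def group_action.composition_rule)

lemma act_inv:
  fixes G (structure)
  assumes "fin_gset G X" "g \<in> carrier G" "x \<in> pts X"
  shows "act X (inv g) (act X g x) = x" "act X g (act X (inv g) x) = x"
proof -
  interpret group G using assms(1) by (rule fin_gset_group)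
  show "act X (inv g) (act X g x) = x"
    using act_mult[of G X "inv g" g x] act_one[OF assms(1,3)] assms by simp
  show "act X g (act X (inv g) x) = x"
    using act_mult[of G X g "inv g" x] act_one[OF assms(1,3)] assms by simp
qed

text \<open>Actions are homomorphisms into the group of extensional bijections of the point set. The
  pointwise laws suffice because \<open>act X (inv g)\<close> inverts
  \<open>act X g\<close>.\<close>

lemma fin_gsetI:
  fixes G (structure)
  assumes "group G" "finite (pts X)" "act X \<in> extensional (carrier G)"
    and ext: "\<And>g. g \<in> carrier G \<Longrightarrow> act X g \<in> extensional (pts X)"
    and cl: "\<And>g x. \<lbrakk>g \<in> carrier G; x \<in> pts X\<rbrakk> \<Longrightarrow> act X g x \<in> pts X"
    and one: "\<And>x. x \<in> pts X \<Longrightarrow> act X \<one> x = x"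
    and mult: "\<And>g h x. \<lbrakk>g \<in> carrier G; h \<in> carrier G; x \<in> pts X\<rbrakk> \<Longrightarrow>
      act X (g \<otimes> h) x = act X g (act X h x)"
  shows "fin_gset G X"
proof -
  interpret group G by fact
  have bij: "act X g \<in> Bij (pts X)" if g: "g \<in> carrier G" for g
  proof -
    have "act X (inv g) (act X g x) = x \<and> act X g (act X (inv g) x) = x" if "x \<in> pts X" for x
      using mult[of "inv g" g x] mult[of g "inv g" x] one[of x] g that by simp
    then have "bij_betw (act X g) (pts X) (pts X)"
      by (intro bij_betwI[where g = "act X (inv g)"]) (auto simp: cl g)
    then show ?thesis by (simp add: Bij_def ext g)
  qed
  have "act X (g \<otimes> h) = compose (pts X) (act X g) (act X h)"
    if "g \<in> carrier G" "h \<in> carrier G" for g h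
    by (rule extensionalityI[of _ "pts X"]) (auto simp: ext that mult compose_eq)
  then have "act X \<in> hom G (BijGroup (pts X))"
    by (auto simp: hom_def BijGroup_def bij)
  then show ?thesis
    using assms by (simp add: fin_gset_def group_action_def group_hom_def group_hom_axioms_def
        group_BijGroup)
qed

lemma gmap_source: "gmap G X Y f \<Longrightarrow> fin_gset G X"
  and gmap_target: "gmap G X Y f \<Longrightarrow> fin_gset G Y"
  and gmap_closed: "gmap G X Y f \<Longrightarrow> x \<in> pts X \<Longrightarrow> f x \<in> pts Y"
  and gmap_act: "gmap G X Y f \<Longrightarrow> g \<in> carrier G \<Longrightarrow> x \<in> pts X \<Longrightarrow> f (act X g x) = act Y g (f x)"
  and gmap_extensional: "gmap G X Y f \<Longrightarrow> f \<in> extensional (pts X)"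
  by (auto simp: gmap_def PiE_def)

lemma gmap_restrictI:
  assumes "fin_gset G X" "fin_gset G Y" "\<And>x. x \<in> pts X \<Longrightarrow> f x \<in> pts Y"
    and "\<And>g x. \<lbrakk>g \<in> carrier G; x \<in> pts X\<rbrakk> \<Longrightarrow> f (act X g x) = act Y g (f x)"
  shows "gmap G X Y (restrict f (pts X))"
  using assms by (auto simp: gmap_def act_closed)

lemma gmap_eqI:
  assumes "gmap G X Y f" "gmap G X Y' f'" "\<And>x. x \<in> pts X \<Longrightarrow> f x = f' x"
  shows "f = f'"
  using assms by (intro extensionalityI[of f "pts X" f']) (auto dest: gmap_extensional)

lemma gmap_id: "fin_gset G X \<Longrightarrow> gmap G X X (\<lambda>x\<in>pts X. x)"
  by (rule gmap_restrictI) auto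

lemma gmap_compose: "gmap G X Y f \<Longrightarrow> gmap G Y Z h \<Longrightarrow> gmap G X Z (compose (pts X) h f)"
  unfolding compose_def by (rule gmap_restrictI) (auto dest: gmap_source gmap_target simp: gmap_closed gmap_act)

lemma gmap_compose_id:
  "gmap G X Y f \<Longrightarrow> compose (pts X) f (\<lambda>x\<in>pts X. x) = f"
  "gmap G X Y f \<Longrightarrow> compose (pts X) (\<lambda>y\<in>pts Y. y) f = f"
  using gmap_extensional[of G X Y f]
  by (auto simp: compose_def fun_eq_iff extensional_def gmap_closed)

lemma gmap_inverse:
  assumes "gmap G X Y f" "bij_betw f (pts X) (pts Y)"
  shows "gmap G Y X (\<lambda>y\<in>pts Y. inv_into (pts X) f y)"
proof (rule gmap_restrictI)
  note fin = gmap_source[OF assms(1)] gmap_target[OF assms(1)]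
  show "fin_gset G X" "fin_gset G Y" by fact+
  show c: "inv_into (pts X) f y \<in> pts X" if "y \<in> pts Y" for y
    using that assms(2) by (metis bij_betw_def inv_into_into)
  fix g y assume g: "g \<in> carrier G" and y: "y \<in> pts Y"
  have "f (act X g (inv_into (pts X) f y)) = act Y g y"
    using assms g y c by (simp add: gmap_act bij_betw_inv_into_right)
  then show "inv_into (pts X) f (act Y g y) = act X g (inv_into (pts X) f y)"
    using assms g y c fin by (metis act_closed bij_betw_inv_into_left)
qed

lemma giso_fin_gset: "giso G X Y e \<Longrightarrow> fin_gset G X \<and> fin_gset G Y"
  by (auto simp: giso_def gmap_def)

text \<open>Fibre products, section sets and disjoint unions live in product, function and sum
  types, whereas the functors only see points in \<open>'u\<close>. An infinite type contains a
  finite set of every size, so each such G-set has a copy there.\<close>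

lemma ex_giso:
  assumes "fin_gset G (X :: ('g, 'x) gset)"
  obtains Y :: "('g, 'u::infinite) gset" and e where "giso G Y X e"
proof -
  obtain U :: "'u set" where U: "finite U" "card U = card (pts X)"
    using infinite_UNIV infinite_arbitrarily_large by blast
  then obtain e where e: "bij_betw e U (pts X)"
    using fin_gset_finite[OF assms] finite_same_card_bij by blast
  define Y where
    "Y = \<lparr>pts = U, act = \<lambda>g\<in>carrier G. \<lambda>u\<in>U. inv_into U e (act X g (e u))\<rparr>"
  have e1: "e u \<in> pts X" if "u \<in> U" for u using e that by (auto simp: bij_betw_def)
  have e2: "inv_into U e x \<in> U" "e (inv_into U e x) = x" if "x \<in> pts X" for x
    using e that by (auto simp: bij_betw_def inv_into_into f_inv_into_f)
  have e3: "inv_into U e (e u) = u" if "u \<in> U" for u using e that by (auto simp: bij_betw_def)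
  interpret group G using assms by (rule fin_gset_group)
  have Y: "fin_gset G Y"
    by (rule fin_gsetI)
      (auto simp: Y_def U e1 e2 e3 act_closed[OF assms] act_one[OF assms] act_mult[OF assms]
        group_axioms)
  have "gmap G Y X (restrict e (pts Y))"
    by (rule gmap_restrictI[OF Y assms]) (auto simp: Y_def e1 e2 act_closed[OF assms])
  moreover have "bij_betw (restrict e (pts Y)) (pts Y) (pts X)"
    using e by (auto simp: Y_def bij_betw_def inj_on_def)
  ultimately show ?thesis using that[of Y "restrict e (pts Y)"] by (simp add: giso_def)
qed

section \<open>The empty G-set and invariant subsets\<close>

definition empty_gset :: "('g, 'm) monoid_scheme \<Rightarrow> ('g, 'x) gset" where
  "empty_gset G = \<lparr>pts = {}, act = (\<lambda>g\<in>carrier G. \<lambda>x\<in>{}. x)\<rparr>"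

lemma fin_gset_empty: "group G \<Longrightarrow> fin_gset G (empty_gset G)"
  by (rule fin_gsetI) (auto simp: empty_gset_def group.is_monoid monoid.m_closed)

text \<open>An extensional function on the empty set is constantly \<open>undefined\<close>, so this
  is the only map out of the initial G-set.\<close>

lemma gmap_from_empty: "fin_gset G X \<Longrightarrow> gmap G (empty_gset G) X (\<lambda>_. undefined)"
  using fin_gset_empty[OF fin_gset_group, of G X] by (auto simp: gmap_def empty_gset_def)

definition sub_gset ::
  "('g, 'm) monoid_scheme \<Rightarrow> ('g, 'x) gset \<Rightarrow> 'x set \<Rightarrow> ('g, 'x) gset" where
  "sub_gset G X B = \<lparr>pts = B, act = (\<lambda>g\<in>carrier G. \<lambda>x\<in>B. act X g x)\<rparr>"

lemma
  assumes "fin_gset G X" "B \<subseteq> pts X" "\<And>g x. \<lbrakk>g \<in> carrier G; x \<in> B\<rbrakk> \<Longrightarrow> act X g x \<in> B"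
  shows fin_sub_gset: "fin_gset G (sub_gset G X B)"
    and gmap_sub_gset: "gmap G (sub_gset G X B) X (\<lambda>x\<in>B. x)"
proof -
  interpret group G using assms(1) by (rule fin_gset_group)
  have B: "x \<in> B \<Longrightarrow> x \<in> pts X" for x using assms by auto
  show *: "fin_gset G (sub_gset G X B)"
    by (rule fin_gsetI)
      (auto simp: sub_gset_def B assms(3) act_one[OF assms(1)] act_mult[OF assms(1)] group_axioms
        intro: finite_subset[OF assms(2)] fin_gset_finite[OF assms(1)])
  show "gmap G (sub_gset G X B) X (\<lambda>x\<in>B. x)"
    using gmap_restrictI[OF * assms(1), of "\<lambda>x. x"] assms(2,3) by (auto simp: sub_gset_def)
qed


section \<open>Coproducts\<close>

text \<open>Bijectivity of the map from the disjoint union is spelled out as injective legs with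
  disjoint images that cover \<open>Z\<close>. Unlike in \<open>is_coproduct\<close>, the summands
  may have different point types.\<close>

definition bicoproduct ::
  "('g, 'm) monoid_scheme \<Rightarrow> ('g, 'x) gset \<Rightarrow> ('g, 'y) gset \<Rightarrow> ('g, 'z) gset \<Rightarrow>
   ('x \<Rightarrow> 'z) \<Rightarrow> ('y \<Rightarrow> 'z) \<Rightarrow> bool" where
  "bicoproduct G A B Z i j \<longleftrightarrow> gmap G A Z i \<and> gmap G B Z j \<and>
     inj_on i (pts A) \<and> inj_on j (pts B) \<and> i ` pts A \<inter> j ` pts B = {} \<and>
     pts Z = i ` pts A \<union> j ` pts B"

lemma less_2_iff: "k < (2::nat) \<longleftrightarrow> k = 0 \<or> k = 1"
  by auto

lemma is_coproduct_2_iff: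
  "is_coproduct G 2 F Z \<iota> \<longleftrightarrow> bicoproduct G (F 0) (F 1) Z (\<iota> 0) (\<iota> 1)"
proof -
  have "bij_betw (\<lambda>(k, x). \<iota> k x) (SIGMA k:{..<2}. pts (F k)) (pts Z) \<longleftrightarrow>
      inj_on (\<iota> 0) (pts (F 0)) \<and> inj_on (\<iota> 1) (pts (F 1)) \<and>
      \<iota> 0 ` pts (F 0) \<inter> \<iota> 1 ` pts (F 1) = {} \<and> pts Z = \<iota> 0 ` pts (F 0) \<union> \<iota> 1 ` pts (F 1)"
    (is "bij_betw ?h ?D _ \<longleftrightarrow> _")
  proof -
    have D: "?D = {0} \<times> pts (F 0) \<union> {1} \<times> pts (F 1)"
      by (auto simp: less_2_iff)
    \<comment> \<open>\<open>inj_on_Un\<close> speaks of set differences of the two slices; the tags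
      0 and 1 keep the slices disjoint, so the differences are the slices themselves.\<close>
    have "{0::nat} \<times> pts (F 0) - {1} \<times> pts (F 1) = {0} \<times> pts (F 0)"
      "{1::nat} \<times> pts (F 1) - {0} \<times> pts (F 0) = {1} \<times> pts (F 1)"
      by auto
    then have "inj_on ?h ?D \<longleftrightarrow> inj_on ?h ({0} \<times> pts (F 0)) \<and> inj_on ?h ({1} \<times> pts (F 1)) \<and>
        ?h ` ({0} \<times> pts (F 0)) \<inter> ?h ` ({1} \<times> pts (F 1)) = {}"
      unfolding D inj_on_Un by metis
    moreover have "inj_on ?h ({k} \<times> B) \<longleftrightarrow> inj_on (\<iota> k) B" for k B
      by (simp add: inj_on_def)
    moreover have im: "?h ` ({k} \<times> B) = \<iota> k ` B" for k B
      by force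
    moreover have "?h ` ?D = \<iota> 0 ` pts (F 0) \<union> \<iota> 1 ` pts (F 1)"
      unfolding D image_Un im ..
    ultimately show ?thesis unfolding bij_betw_def by metis
  qed
  then show ?thesis
    by (auto simp: is_coproduct_def bicoproduct_def less_2_iff gmap_target)
qed

lemma bicoproduct_gmap:
  "bicoproduct G A B Z i j \<Longrightarrow> gmap G A Z i" "bicoproduct G A B Z i j \<Longrightarrow> gmap G B Z j"
  by (simp_all add: bicoproduct_def)

lemma bicoproduct_commute: "bicoproduct G A B Z i j \<Longrightarrow> bicoproduct G B A Z j i"
  by (auto simp: bicoproduct_def)

lemma bicoproduct_cases:
  assumes "bicoproduct G A B Z i j" "z \<in> pts Z"
  obtains x where "x \<in> pts A" "z = i x" | y where "y \<in> pts B" "z = j y"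
  using assms by (auto simp: bicoproduct_def)

lemma bicoproduct_eq_iff:
  assumes "bicoproduct G A B Z i j"
  shows "\<lbrakk>x \<in> pts A; x' \<in> pts A\<rbrakk> \<Longrightarrow> i x = i x' \<longleftrightarrow> x = x'"
    and "\<lbrakk>y \<in> pts B; y' \<in> pts B\<rbrakk> \<Longrightarrow> j y = j y' \<longleftrightarrow> y = y'"
    and "\<lbrakk>x \<in> pts A; y \<in> pts B\<rbrakk> \<Longrightarrow> i x \<noteq> j y"
    and "\<lbrakk>x \<in> pts A; y \<in> pts B\<rbrakk> \<Longrightarrow> j y \<noteq> i x"
  using assms by (auto simp: bicoproduct_def inj_on_def)

lemma bicoproduct_map_eqI:
  assumes "bicoproduct G A B Z i j" "gmap G Z X h" "gmap G Z X h'"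
    and "\<And>x. x \<in> pts A \<Longrightarrow> h (i x) = h' (i x)" "\<And>y. y \<in> pts B \<Longrightarrow> h (j y) = h' (j y)"
  shows "h = h'"
  using assms(2,3)
proof (rule gmap_eqI)
  show "h z = h' z" if "z \<in> pts Z" for z
    using assms(1) that by (rule bicoproduct_cases) (simp_all add: assms(4,5))
qed

text \<open>Existence half of the universal property. The result is delivered both as composites,
  which match \<open>up_comp\<close> and \<open>dn_comp\<close>, and pointwise for element
  chases.\<close>

lemma bicoproduct_copair:
  assumes "bicoproduct G A B Z i j" "gmap G A X u" "gmap G B X v"
  obtains h where "gmap G Z X h" "compose (pts A) h i = u" "compose (pts B) h j = v"
    "\<And>x. x \<in> pts A \<Longrightarrow> h (i x) = u x" "\<And>y. y \<in> pts B \<Longrightarrow> h (j y) = v y"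
proof -
  note Z = bicoproduct_cases[OF assms(1)] and eq = bicoproduct_eq_iff[OF assms(1)]
  note gm = bicoproduct_gmap[OF assms(1)]
  define h where "h = (\<lambda>z. if z \<in> i ` pts A then u (inv_into (pts A) i z) else v (inv_into (pts B) j z))"
  have h1: "h (i x) = u x" if "x \<in> pts A" for x
    using that assms(1) by (auto simp: h_def bicoproduct_def)
  have h2: "h (j y) = v y" if "y \<in> pts B" for y
    using that assms(1) by (auto simp: h_def bicoproduct_def)
  have "gmap G Z X (restrict h (pts Z))"
  proof (rule gmap_restrictI)
    show "fin_gset G Z" "fin_gset G X" using gm assms by (auto dest: gmap_target)
    show "h z \<in> pts X" if "z \<in> pts Z" for z
      using that assms(2,3) by (auto elim!: Z simp: h1 h2 gmap_closed)
    show "h (act Z g z) = act X g (h z)" if "g \<in> carrier G" "z \<in> pts Z" for g z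
    proof -
      consider x where "x \<in> pts A" "z = i x" | y where "y \<in> pts B" "z = j y"
        using \<open>z \<in> pts Z\<close> by (elim Z) blast+
      then show ?thesis
      proof cases
        case (1 x)
        then show ?thesis using gm assms(2) that(1)
          by (metis act_closed gmap_act gmap_source h1)
      next
        case (2 x)
        then show ?thesis using gm assms(3) that(1)
          by (metis act_closed gmap_act gmap_source h2)
      qed
    qed
  qed
  moreover have "restrict h (pts Z) (i x) = u x" if "x \<in> pts A" for x
    using that gm by (simp add: h1 gmap_closed)
  moreover have "restrict h (pts Z) (j x) = v x" if "x \<in> pts B" for x
    using that gm by (simp add: h2 gmap_closed)
  ultimately show ?thesis
    using that[of "restrict h (pts Z)"] gmap_extensional[OF assms(2)] gmap_extensional[OF assms(3)]
    by (auto simp: compose_def fun_eq_iff extensional_def)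
qed

lemma ex_bicoproduct:
  assumes "fin_gset G (A :: ('g, 'x) gset)" "fin_gset G (B :: ('g, 'y) gset)"
  obtains Z :: "('g, 'u::infinite) gset" and i j where "bicoproduct G A B Z i j"
proof -
  define W where "W = \<lparr>pts = pts A <+> pts B,
    act = (\<lambda>g\<in>carrier G. \<lambda>z\<in>pts A <+> pts B. map_sum (act A g) (act B g) z)\<rparr>"
  interpret group G using assms(1) by (rule fin_gset_group)
  have W: "fin_gset G W"
    by (rule fin_gsetI)
      (auto simp: W_def fin_gset_finite[OF assms(1)] fin_gset_finite[OF assms(2)]
        act_closed[OF assms(1)] act_closed[OF assms(2)] act_one[OF assms(1)] act_one[OF assms(2)]
        act_mult[OF assms(1)] act_mult[OF assms(2)] group_axioms)
  obtain Z :: "('g, 'u) gset" and e where e: "giso G Z W e" using ex_giso[OF W] .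
  define e' where "e' = inv_into (pts Z) e"
  have e'_gmap: "gmap G W Z (\<lambda>y\<in>pts W. e' y)"
    using e gmap_inverse by (auto simp: giso_def e'_def)
  have bij: "bij_betw e' (pts W) (pts Z)"
    using e by (auto simp: giso_def e'_def bij_betw_inv_into)
  define i where "i = (\<lambda>x\<in>pts A. e' (Inl x))"
  define j where "j = (\<lambda>x\<in>pts B. e' (Inr x))"
  have Z: "fin_gset G Z" using e giso_fin_gset by blast
  have e'_cl: "e' w \<in> pts Z" if "w \<in> pts A <+> pts B" for w
    using gmap_closed[OF e'_gmap, of w] that by (simp add: W_def)
  have e'_act: "e' (map_sum (act A g) (act B g) w) = act Z g (e' w)"
    if "g \<in> carrier G" "w \<in> pts A <+> pts B" for g w
    using gmap_act[OF e'_gmap, of g w] act_closed[OF W, of g w] that by (simp add: W_def)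
  then have e'_act_Inl: "e' (Inl (act A g x)) = act Z g (e' (Inl x))"
    if "g \<in> carrier G" "x \<in> pts A" for g x
    using that by (metis InlI map_sum.simps(1))
  have e'_act_Inr: "e' (Inr (act B g x)) = act Z g (e' (Inr x))"
    if "g \<in> carrier G" "x \<in> pts B" for g x
    using e'_act that by (metis InrI map_sum.simps(2))
  have i: "gmap G A Z i" unfolding i_def
    by (intro gmap_restrictI assms Z) (auto simp: e'_cl InlI InrI e'_act_Inl e'_act_Inr act_closed[OF assms(1)] act_closed[OF assms(2)])
  have j: "gmap G B Z j" unfolding j_def
    by (intro gmap_restrictI assms Z) (auto simp: e'_cl InlI InrI e'_act_Inl e'_act_Inr act_closed[OF assms(1)] act_closed[OF assms(2)])
  have "bicoproduct G A B Z i j"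
    unfolding bicoproduct_def
  proof (intro conjI i j)
    have inj: "inj_on e' (pts A <+> pts B)" and im: "pts Z = e' ` (pts A <+> pts B)"
      using bij by (auto simp: bij_betw_def W_def)
    show "inj_on i (pts A)" "inj_on j (pts B)" "i ` pts A \<inter> j ` pts B = {}"
      using inj by (auto simp: i_def j_def inj_on_def Plus_def)
    show "pts Z = i ` pts A \<union> j ` pts B"
      unfolding im by (auto simp: i_def j_def Plus_def image_Un image_image)
  qed
  then show ?thesis using that by blast
qed

text \<open>This trivial decomposition is what lets the value at the empty G-set supply the neutral
  elements.\<close>

lemma bicoproduct_empty:
  assumes "fin_gset G X"
  shows "bicoproduct G (empty_gset G) X X (\<lambda>_. undefined) (\<lambda>x\<in>pts X. x)"
  using gmap_from_empty[OF assms] gmap_id[OF assms]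
  by (auto simp: bicoproduct_def empty_gset_def inj_on_def)


section \<open>Pull-backs\<close>

text \<open>The conditions on \<open>h\<close> are pointwise because \<open>h\<close> is also
  instantiated with \<open>fst\<close> on a set of sections, which is not extensional.\<close>

lemma fin_fibre_product:
  assumes "gmap G X Y f" "fin_gset G P" "\<And>t. t \<in> pts P \<Longrightarrow> h t \<in> pts Y"
    "\<And>g t. \<lbrakk>g \<in> carrier G; t \<in> pts P\<rbrakk> \<Longrightarrow> h (act P g t) = act Y g (h t)"
  shows "fin_gset G (fibre_product G X f P h)"
proof -
  have X: "fin_gset G X" using assms(1) by (rule gmap_source)
  interpret group G using X by (rule fin_gset_group)
  have "finite {(x, t). x \<in> pts X \<and> t \<in> pts P \<and> f x = h t}"
    by (rule finite_subset[of _ "pts X \<times> pts P"]) (auto intro!: finite_cartesian_product simp: fin_gset_finite[OF X] fin_gset_finite[OF assms(2)])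
  then show ?thesis
    by (intro fin_gsetI)
      (auto simp: fibre_product_def Let_def group_axioms act_closed[OF X] act_one[OF X]
        act_mult[OF X] act_closed[OF assms(2)] act_one[OF assms(2)] act_mult[OF assms(2)]
        assms(4) gmap_act[OF assms(1)])
qed

lemma pts_fibre_product:
  "pts (fibre_product G X f P h) = {(x, t). x \<in> pts X \<and> t \<in> pts P \<and> f x = h t}"
  by (simp add: fibre_product_def Let_def)

lemma act_fibre_product:
  "g \<in> carrier G \<Longrightarrow> z \<in> pts (fibre_product G X f P h) \<Longrightarrow>
   act (fibre_product G X f P h) g z = (act X g (fst z), act P g (snd z))"
  by (simp add: fibre_product_def Let_def)

lemma is_pullbackI:
  assumes "gmap G X Y f" "gmap G Y' Y \<eta>" "gmap G X' X \<xi>" "gmap G X' Y' f'"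
    and comm: "\<And>x. x \<in> pts X' \<Longrightarrow> f (\<xi> x) = \<eta> (f' x)"
    and surj: "\<And>x y. \<lbrakk>x \<in> pts X; y \<in> pts Y'; f x = \<eta> y\<rbrakk> \<Longrightarrow> \<exists>z\<in>pts X'. \<xi> z = x \<and> f' z = y"
    and inj: "\<And>z z'. \<lbrakk>z \<in> pts X'; z' \<in> pts X'; \<xi> z = \<xi> z'; f' z = f' z'\<rbrakk> \<Longrightarrow> z = z'"
  shows "is_pullback G X' X Y' Y \<xi> f' f \<eta>"
proof -
  let ?F = "fibre_product G X f Y' \<eta>"
  have Y': "fin_gset G Y'" and X': "fin_gset G X'" using assms by (auto dest: gmap_source)
  have F: "fin_gset G ?F"
    using assms(1) Y' by (rule fin_fibre_product) (auto simp: gmap_closed[OF assms(2)] gmap_act[OF assms(2)])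
  have cl: "(\<xi> x, f' x) \<in> pts ?F" if "x \<in> pts X'" for x
    using that assms(3,4) by (auto simp: pts_fibre_product comm gmap_closed)
  have "gmap G X' ?F (\<lambda>x\<in>pts X'. (\<xi> x, f' x))"
    using X' F by (rule gmap_restrictI)
      (auto simp: cl act_fibre_product gmap_act[OF assms(3)] gmap_act[OF assms(4)])
  moreover have "bij_betw (\<lambda>x\<in>pts X'. (\<xi> x, f' x)) (pts X') (pts ?F)"
    unfolding bij_betw_def
  proof
    show "inj_on (\<lambda>x\<in>pts X'. (\<xi> x, f' x)) (pts X')" by (auto intro!: inj_onI inj)
    show "(\<lambda>x\<in>pts X'. (\<xi> x, f' x)) ` pts X' = pts ?F"
    proof
      show "pts ?F \<subseteq> (\<lambda>x\<in>pts X'. (\<xi> x, f' x)) ` pts X'"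
        by (auto simp: pts_fibre_product image_iff) (metis surj restrict_apply')
    qed (use cl in auto)
  qed
  ultimately show ?thesis
    using assms by (simp add: is_pullback_def giso_def)
qed

lemma ex_pullback:
  assumes "gmap G X Y f" "gmap G Y' Y \<eta>"
  obtains X' :: "('g, 'u::infinite) gset" and \<xi> f' where "is_pullback G X' X Y' Y \<xi> f' f \<eta>"
proof -
  let ?F = "fibre_product G X f Y' \<eta>"
  have Y': "fin_gset G Y'" using assms by (auto dest: gmap_source)
  have F: "fin_gset G ?F"
    using assms(1) Y' by (rule fin_fibre_product) (auto simp: gmap_closed[OF assms(2)] gmap_act[OF assms(2)])
  obtain X' :: "('g, 'u) gset" and e where e: "giso G X' ?F e" using ex_giso[OF F] .
  then have eg: "gmap G X' ?F e" and X': "fin_gset G X'" and bij: "bij_betw e (pts X') (pts ?F)"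
    by (auto simp: giso_def gmap_def)
  have cl: "e x \<in> pts ?F" if "x \<in> pts X'" for x using eg that by (rule gmap_closed)
  have a: "e (act X' g x) = (act X g (fst (e x)), act Y' g (snd (e x)))"
    if "g \<in> carrier G" "x \<in> pts X'" for g x
    using gmap_act[OF eg that] act_fibre_product[OF that(1) cl[OF that(2)]] by simp
  have "is_pullback G X' X Y' Y (\<lambda>x\<in>pts X'. fst (e x)) (\<lambda>x\<in>pts X'. snd (e x)) f \<eta>"
  proof (rule is_pullbackI[OF assms])
    show "gmap G X' X (\<lambda>x\<in>pts X'. fst (e x))"
      using X' gmap_source[OF assms(1)] by (rule gmap_restrictI) (use cl in \<open>auto simp: pts_fibre_product a split_beta\<close>)
    show "gmap G X' Y' (\<lambda>x\<in>pts X'. snd (e x))"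
      using X' Y' by (rule gmap_restrictI) (use cl in \<open>auto simp: pts_fibre_product a split_beta\<close>)
    show "f ((\<lambda>x\<in>pts X'. fst (e x)) x) = \<eta> ((\<lambda>x\<in>pts X'. snd (e x)) x)" if "x \<in> pts X'" for x
      using cl[OF that] that by (auto simp: pts_fibre_product split_beta)
    show "\<exists>z\<in>pts X'. (\<lambda>x\<in>pts X'. fst (e x)) z = x \<and> (\<lambda>x\<in>pts X'. snd (e x)) z = y"
      if "x \<in> pts X" "y \<in> pts Y'" "f x = \<eta> y" for x y
    proof -
      have "(x, y) \<in> e ` pts X'" using that bij by (simp add: bij_betw_def pts_fibre_product)
      then obtain z where "z \<in> pts X'" "e z = (x, y)" by force
      then show ?thesis by (intro bexI[of _ z]) auto
    qed
    show "z = z'" if "z \<in> pts X'" "z' \<in> pts X'"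
        "(\<lambda>x\<in>pts X'. fst (e x)) z = (\<lambda>x\<in>pts X'. fst (e x)) z'"
        "(\<lambda>x\<in>pts X'. snd (e x)) z = (\<lambda>x\<in>pts X'. snd (e x)) z'" for z z'
      using that bij by (simp add: bij_betw_def inj_on_def prod_eq_iff)
  qed
  then show ?thesis using that by blast
qed

lemma is_pullback_gmap:
  assumes "is_pullback G X' X Y' Y \<xi> f' f \<eta>"
  shows "gmap G X Y f" "gmap G Y' Y \<eta>" "gmap G X' X \<xi>" "gmap G X' Y' f'"
  using assms by (auto simp: is_pullback_def)

text \<open>Coproducts of G-sets are disjoint and stable under pull-back: pulling the leg
  \<open>k\<close> back along the sum \<open>q\<close> of \<open>u\<close> and \<open>v\<close>
  returns the leg \<open>i\<close>. Base change along this square reads off the components of a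
  transfer along \<open>q\<close>.\<close>

lemma is_pullback_bicoproduct:
  assumes Z: "bicoproduct G A B Z i j" and W: "bicoproduct G X Y W k l"
    and u: "gmap G A X u" and v: "gmap G B Y v" and q: "gmap G Z W q"
    and qi: "\<And>x. x \<in> pts A \<Longrightarrow> q (i x) = k (u x)" and qj: "\<And>x. x \<in> pts B \<Longrightarrow> q (j x) = l (v x)"
  shows "is_pullback G A Z X W i u q k"
  using q bicoproduct_gmap(1)[OF W] bicoproduct_gmap(1)[OF Z] u
proof (rule is_pullbackI)
  show "\<exists>x\<in>pts A. i x = z \<and> u x = y" if "z \<in> pts Z" "y \<in> pts X" "q z = k y" for z y
    using Z that(1)
  proof (rule bicoproduct_cases)
    fix x assume "x \<in> pts A" "z = i x"
    then show ?thesis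
      using that bicoproduct_eq_iff(1)[OF W] gmap_closed[OF u] by (intro bexI[of _ x]) (auto simp: qi)
  next
    fix x assume "x \<in> pts B" "z = j x"
    then show ?thesis
      using that bicoproduct_eq_iff(4)[OF W that(2), of "v x"] gmap_closed[OF v] by (auto simp: qj)
  qed
  show "z = z'" if "z \<in> pts A" "z' \<in> pts A" "i z = i z'" for z z'
    using that bicoproduct_eq_iff(1)[OF Z] by simp
qed (fact qi)


section \<open>Semi-Mackey functors\<close>

context semi_mackey_functor
begin

abbreviation "fop \<equiv> fold_op G M up dn"

lemma up_mem: "gmap G X Y f \<Longrightarrow> c \<in> M Y \<Longrightarrow> up X Y f c \<in> M X"
  and dn_mem: "gmap G X Y f \<Longrightarrow> c \<in> M X \<Longrightarrow> dn X Y f c \<in> M Y"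
  by (blast dest: up_closed dn_closed)+

text \<open>The coproduct axiom for two summands, in the form that builds an element over
  \<open>Z\<close> from prescribed components.\<close>

lemma up_bicoproduct_ex1:
  assumes "bicoproduct G A B Z i j" "a \<in> M A" "b \<in> M B"
  shows "\<exists>!c. c \<in> M Z \<and> up A Z i c = a \<and> up B Z j c = b"
proof -
  define F where "F = (\<lambda>k::nat. if k = 0 then A else B)"
  define \<iota> where "\<iota> = (\<lambda>k::nat. if k = 0 then i else j)"
  have "is_coproduct G 2 F Z \<iota>"
    using assms(1) by (simp add: is_coproduct_2_iff F_def \<iota>_def)
  then have bij: "bij_betw (\<lambda>c. \<lambda>k\<in>{..<2}. up (F k) Z (\<iota> k) c) (M Z) (\<Pi>\<^sub>E k\<in>{..<2}. M (F k))"
    by (rule up_coproduct)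
  define v where "v = (\<lambda>k\<in>{..<2::nat}. if k = 0 then a else b)"
  have "v \<in> (\<Pi>\<^sub>E k\<in>{..<2}. M (F k))"
    using assms by (auto simp: v_def F_def)
  moreover have "(\<lambda>k\<in>{..<2}. up (F k) Z (\<iota> k) c) = v \<longleftrightarrow> up A Z i c = a \<and> up B Z j c = b" for c
    by (auto simp: v_def F_def \<iota>_def fun_eq_iff less_2_iff)
  ultimately obtain c where c: "c \<in> M Z" "up A Z i c = a" "up B Z j c = b"
    using bij_betw_imp_surj_on[OF bij] by (metis (no_types, lifting) imageE)
  moreover have "c' = c" if "c' \<in> M Z" "up A Z i c' = a" "up B Z j c' = b" for c'
    by (rule inj_onD[OF bij_betw_imp_inj_on[OF bij], of c' c]) (use that c in \<open>auto simp: F_def \<iota>_def fun_eq_iff\<close>)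
  ultimately show ?thesis by blast
qed

lemma up_bicoproduct_eqI:
  assumes "bicoproduct G A B Z i j" "c \<in> M Z" "c' \<in> M Z"
    "up A Z i c = up A Z i c'" "up B Z j c = up B Z j c'"
  shows "c = c'"
  using up_bicoproduct_ex1[OF assms(1), of "up A Z i c" "up B Z j c"]
    up_mem[OF bicoproduct_gmap(1)[OF assms(1)] assms(2)]
    up_mem[OF bicoproduct_gmap(2)[OF assms(1)] assms(2)] assms(2-) by metis

text \<open>For bijective \<open>t\<close> the square with sides \<open>t\<close>, \<open>t\<close>
  and two identities is a pull-back, so base change applies to it.\<close>

lemma dn_up_bij:
  assumes "gmap G Z Z' t" "bij_betw t (pts Z) (pts Z')" "c \<in> M Z'"
  shows "dn Z Z' t (up Z Z' t c) = c"
proof -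
  have Z': "fin_gset G Z'" using assms(1) by (rule gmap_target)
  note id = gmap_id[OF Z']
  have "is_pullback G Z Z' Z' Z' t t (\<lambda>x\<in>pts Z'. x) (\<lambda>x\<in>pts Z'. x)"
    using id id assms(1) assms(1)
  proof (rule is_pullbackI)
    show "\<exists>z\<in>pts Z. t z = x \<and> t z = y"
      if "x \<in> pts Z'" "y \<in> pts Z'" "(\<lambda>x\<in>pts Z'. x) x = (\<lambda>x\<in>pts Z'. x) y" for x y
      using that bij_betw_imp_surj_on[OF assms(2)] by (metis imageE restrict_apply')
    show "z = z'" if "z \<in> pts Z" "z' \<in> pts Z" "t z = t z'" for z z'
      using that assms(2) by (auto simp: bij_betw_def inj_on_def)
  qed simp
  from base_change[OF this assms(3)] show ?thesis
    using assms(3) Z' by (simp add: up_id dn_id)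
qed

text \<open>Two coproducts of \<open>X\<close> with itself are related by a bijection
  \<open>t\<close> compatible with the legs and hence with the folding maps. The element
  \<open>c'\<close> restricts along \<open>t\<close> to an element with the components of
  \<open>c\<close>, and transferring back undoes the restriction. So any coproduct computes the
  operation, and the definite description is legitimate.\<close>

lemma fold_op_eqI:
  assumes Z: "bicoproduct G X X Z i j" and h: "gmap G Z X h"
    and hi: "\<And>x. x \<in> pts X \<Longrightarrow> h (i x) = x" and hj: "\<And>x. x \<in> pts X \<Longrightarrow> h (j x) = x"
    and c: "c \<in> M Z" and a: "up X Z i c = a" and b: "up X Z j c = b"
  shows "fop X a b = dn Z X h c"
  unfolding fold_op_def
proof (rule the_equality)
  define \<iota> where "\<iota> = (\<lambda>k::nat. if k = 0 then i else j)"
  have "is_coproduct G 2 (\<lambda>_. X) Z \<iota>"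
    using Z by (simp add: is_coproduct_2_iff \<iota>_def)
  then show "\<exists>Z' \<iota> h' c'. is_coproduct G 2 (\<lambda>_. X) Z' \<iota> \<and> gmap G Z' X h' \<and>
      (\<forall>k<2. \<forall>x\<in>pts X. h' (\<iota> k x) = x) \<and> c' \<in> M Z' \<and> up X Z' (\<iota> 0) c' = a \<and>
      up X Z' (\<iota> 1) c' = b \<and> dn Z X h c = dn Z' X h' c'"
    using assms by (intro exI[of _ Z] exI[of _ \<iota>] exI[of _ h] exI[of _ c])
      (auto simp: \<iota>_def less_2_iff)
  fix s
  assume "\<exists>Z \<iota> h c. is_coproduct G 2 (\<lambda>_. X) Z \<iota> \<and> gmap G Z X h \<and>
      (\<forall>k<2. \<forall>x\<in>pts X. h (\<iota> k x) = x) \<and> c \<in> M Z \<and> up X Z (\<iota> 0) c = a \<and> up X Z (\<iota> 1) c = b \<and>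
      s = dn Z X h c"
  then obtain Z' i' j' h' c' where Z': "bicoproduct G X X Z' i' j'" and h': "gmap G Z' X h'"
    and h'i: "\<And>x. x \<in> pts X \<Longrightarrow> h' (i' x) = x" and h'j: "\<And>x. x \<in> pts X \<Longrightarrow> h' (j' x) = x"
    and c': "c' \<in> M Z'" "up X Z' i' c' = a" "up X Z' j' c' = b" and s: "s = dn Z' X h' c'"
    by (auto simp: is_coproduct_2_iff less_2_iff)
  note gm = bicoproduct_gmap[OF Z] and gm' = bicoproduct_gmap[OF Z']
  obtain t where t: "gmap G Z Z' t" "compose (pts X) t i = i'" "compose (pts X) t j = j'"
    "\<And>x. x \<in> pts X \<Longrightarrow> t (i x) = i' x" "\<And>x. x \<in> pts X \<Longrightarrow> t (j x) = j' x"
    using bicoproduct_copair[OF Z gm'] by metis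
  have "t ` pts Z = pts Z'"
    using Z Z' t(4,5) by (auto simp: bicoproduct_def image_Un image_image cong: image_cong)
  moreover have "inj_on t (pts Z)"
    using bicoproduct_eq_iff[OF Z'] t(4,5)
    by (intro inj_onI) (auto elim!: bicoproduct_cases[OF Z])
  ultimately have bij: "bij_betw t (pts Z) (pts Z')" by (simp add: bij_betw_def)
  have ht: "compose (pts Z) h' t = h"
    by (rule bicoproduct_map_eqI[OF Z gmap_compose[OF t(1) h'] h])
      (use gm in \<open>auto simp: compose_eq t gmap_closed h'i h'j hi hj\<close>)
  have "up Z Z' t c' = c"
    by (rule up_bicoproduct_eqI[OF Z]) (use t gm gm' c c' a b up_comp[OF gm(1) t(1)] up_comp[OF gm(2) t(1)] in
      \<open>auto simp: up_mem\<close>)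
  then have "c' = dn Z Z' t c"
    using dn_up_bij[OF t(1) bij c'(1)] by simp
  then show "s = dn Z X h c"
    using dn_comp[OF t(1) h' c] by (simp add: s ht)
qed

lemma ex_fold_diagram:
  assumes "fin_gset G X" "a \<in> M X" "b \<in> M X"
  obtains Z i j h c where "bicoproduct G X X Z i j" "gmap G Z X h"
    "compose (pts X) h i = (\<lambda>x\<in>pts X. x)" "compose (pts X) h j = (\<lambda>x\<in>pts X. x)"
    "\<And>x. x \<in> pts X \<Longrightarrow> h (i x) = x" "\<And>x. x \<in> pts X \<Longrightarrow> h (j x) = x"
    "c \<in> M Z" "up X Z i c = a" "up X Z j c = b" "fop X a b = dn Z X h c"
proof -
  obtain Z :: "('g, 'u) gset" and i j where Z: "bicoproduct G X X Z i j"
    using ex_bicoproduct[OF assms(1) assms(1)] .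
  obtain h where h: "gmap G Z X h" "compose (pts X) h i = (\<lambda>x\<in>pts X. x)" "compose (pts X) h j = (\<lambda>x\<in>pts X. x)"
    "\<And>x. x \<in> pts X \<Longrightarrow> h (i x) = (\<lambda>x\<in>pts X. x) x" "\<And>x. x \<in> pts X \<Longrightarrow> h (j x) = (\<lambda>x\<in>pts X. x) x"
    using bicoproduct_copair[OF Z gmap_id gmap_id] assms(1) by metis
  obtain c where c: "c \<in> M Z" "up X Z i c = a" "up X Z j c = b"
    using up_bicoproduct_ex1[OF Z assms(2,3)] by blast
  have "fop X a b = dn Z X h c"
    by (rule fold_op_eqI[OF Z h(1)]) (use h c in auto)
  with Z h c show ?thesis by (intro that[of Z i j h c]) auto
qed

lemma fold_op_closed:
  assumes "fin_gset G X" "a \<in> M X" "b \<in> M X"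
  shows "fop X a b \<in> M X"
  using assms by (rule ex_fold_diagram) (simp add: dn_mem)

text \<open>The map \<open>h\<close> factors through a coproduct \<open>W\<close> of two copies of
  \<open>X\<close>: first the sum \<open>q\<close> of its two restrictions, then the folding map
  \<open>n\<close>. Base change at the two summands shows that the transfer along \<open>q\<close>
  has the expected components. Associativity, units and additivity of transfers are instances of
  this formula.\<close>

lemma dn_bicoproduct:
  assumes Z: "bicoproduct G A B Z i j" and h: "gmap G Z X h" and c: "c \<in> M Z"
  shows "dn Z X h c = fop X (dn A X (compose (pts A) h i) (up A Z i c))
    (dn B X (compose (pts B) h j) (up B Z j c))"
proof -
  have X: "fin_gset G X" using h by (rule gmap_target)
  note gm = bicoproduct_gmap[OF Z]
  obtain W :: "('g, 'u) gset" and k l where W: "bicoproduct G X X W k l"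
    using ex_bicoproduct[OF X X] .
  note gmW = bicoproduct_gmap[OF W]
  obtain n where n: "gmap G W X n" "\<And>x. x \<in> pts X \<Longrightarrow> n (k x) = (\<lambda>x\<in>pts X. x) x"
    "\<And>x. x \<in> pts X \<Longrightarrow> n (l x) = (\<lambda>x\<in>pts X. x) x"
    using bicoproduct_copair[OF W gmap_id gmap_id] X by metis
  note hi = gmap_compose[OF gm(1) h] and hj = gmap_compose[OF gm(2) h]
  obtain q where q: "gmap G Z W q"
    "\<And>x. x \<in> pts A \<Longrightarrow> q (i x) = compose (pts A) k (compose (pts A) h i) x"
    "\<And>x. x \<in> pts B \<Longrightarrow> q (j x) = compose (pts B) l (compose (pts B) h j) x"
    using bicoproduct_copair[OF Z gmap_compose[OF hi gmW(1)] gmap_compose[OF hj gmW(2)]] by metis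
  note qi = q(2)[unfolded compose_def] and qj = q(3)[unfolded compose_def]
  have cl: "x \<in> pts A \<Longrightarrow> h (i x) \<in> pts X" "y \<in> pts B \<Longrightarrow> h (j y) \<in> pts X" for x y
    using gm h by (auto simp: gmap_closed)
  have p1: "is_pullback G A Z X W i (compose (pts A) h i) q k"
    using Z W hi hj q(1) by (rule is_pullback_bicoproduct) (simp_all add: qi qj compose_def)
  have p2: "is_pullback G B Z X W j (compose (pts B) h j) q l"
    using bicoproduct_commute[OF Z] bicoproduct_commute[OF W] hj hi q(1)
    by (rule is_pullback_bicoproduct) (simp_all add: qi qj compose_def)
  have nq: "compose (pts Z) n q = h"
    by (rule bicoproduct_map_eqI[OF Z gmap_compose[OF q(1) n(1)] h])
      (use gm cl in \<open>auto simp: compose_eq gmap_closed qi qj n\<close>)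
  have "fop X (dn A X (compose (pts A) h i) (up A Z i c)) (dn B X (compose (pts B) h j) (up B Z j c))
      = dn W X n (dn Z W q c)"
    by (rule fold_op_eqI[OF W n(1)])
      (use n q c in \<open>auto simp: dn_mem base_change[OF p1 c] base_change[OF p2 c]\<close>)
  also have "\<dots> = dn Z X h c"
    using dn_comp[OF q(1) n(1) c] by (simp add: nq)
  finally show ?thesis ..
qed

lemma fold_op_commute:
  assumes "fin_gset G X" "a \<in> M X" "b \<in> M X"
  shows "fop X a b = fop X b a"
proof (rule ex_fold_diagram[OF assms])
  fix Z i j h c
  assume *: "bicoproduct G X X Z i j" "gmap G Z X h"
    "\<And>x. x \<in> pts X \<Longrightarrow> h (i x) = x" "\<And>x. x \<in> pts X \<Longrightarrow> h (j x) = x"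
    "c \<in> M Z" "up X Z i c = a" "up X Z j c = b" "fop X a b = dn Z X h c"
  have "fop X b a = dn Z X h c"
    by (rule fold_op_eqI[OF bicoproduct_commute[OF *(1)]]) (use * in auto)
  with * show ?thesis by simp
qed

text \<open>Both bracketings are the transfer along the folding map of three copies of
  \<open>X\<close>. The set \<open>Z\<close> is split once as two copies followed by one, through
  \<open>k\<close> and \<open>l\<close>, and once as one copy followed by two, through
  \<open>compose (pts X) k i\<close> and \<open>q\<close>.\<close>

lemma fold_op_assoc:
  assumes X: "fin_gset G X" and a: "a \<in> M X" and b: "b \<in> M X" and c: "c \<in> M X"
  shows "fop X (fop X a b) c = fop X a (fop X b c)"
proof -
  obtain W i j h w where W: "bicoproduct G X X W i j" "gmap G W X h"
    "compose (pts X) h i = (\<lambda>x\<in>pts X. x)" "compose (pts X) h j = (\<lambda>x\<in>pts X. x)"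
    "\<And>x. x \<in> pts X \<Longrightarrow> h (i x) = x" "\<And>x. x \<in> pts X \<Longrightarrow> h (j x) = x"
    "w \<in> M W" "up X W i w = a" "up X W j w = b" "fop X a b = dn W X h w"
    using ex_fold_diagram[OF X a b] by metis
  note gW = bicoproduct_gmap[OF W(1)]
  obtain Z :: "('g, 'u) gset" and k l where Z: "bicoproduct G W X Z k l"
    using ex_bicoproduct[OF gmap_target[OF gW(1)] X] .
  note gZ = bicoproduct_gmap[OF Z]
  obtain n where n: "gmap G Z X n" "compose (pts W) n k = h" "compose (pts X) n l = (\<lambda>x\<in>pts X. x)"
    "\<And>x. x \<in> pts W \<Longrightarrow> n (k x) = h x" "\<And>x. x \<in> pts X \<Longrightarrow> n (l x) = (\<lambda>x\<in>pts X. x) x"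
    using bicoproduct_copair[OF Z W(2) gmap_id[OF X]] by metis
  obtain z where z: "z \<in> M Z" "up W Z k z = w" "up X Z l z = c"
    using up_bicoproduct_ex1[OF Z W(7) c] by blast
  have 1: "dn Z X n z = fop X (fop X a b) c"
    using dn_bicoproduct[OF Z n(1) z(1)] by (simp add: n z W(10) dn_id X c)
  obtain q where q: "gmap G W Z q" "compose (pts X) q i = compose (pts X) k j" "compose (pts X) q j = l"
    "\<And>x. x \<in> pts X \<Longrightarrow> q (i x) = compose (pts X) k j x" "\<And>x. x \<in> pts X \<Longrightarrow> q (j x) = l x"
    using bicoproduct_copair[OF W(1) gmap_compose[OF gW(2) gZ(1)] gZ(2)] by metis
  note ki = gmap_compose[OF gW(1) gZ(1)]
  note eqW = bicoproduct_eq_iff[OF W(1)] and eqZ = bicoproduct_eq_iff[OF Z]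
  have Z': "bicoproduct G X W Z (compose (pts X) k i) q"
    unfolding bicoproduct_def
  proof (intro conjI ki q(1))
    have cl: "i x \<in> pts W" "j x \<in> pts W" if "x \<in> pts X" for x using gW that by (auto simp: gmap_closed)
    show "inj_on (compose (pts X) k i) (pts X)"
      by (intro inj_onI) (auto simp: compose_eq cl eqZ eqW)
    show "inj_on q (pts W)"
      by (intro inj_onI) (auto elim!: bicoproduct_cases[OF W(1)] simp: q compose_eq cl eqZ eqW)
    show "compose (pts X) k i ` pts X \<inter> q ` pts W = {}"
      by (auto elim!: bicoproduct_cases[OF W(1)] simp: q compose_eq cl eqZ eqW)
    have "q ` pts W = k ` j ` pts X \<union> l ` pts X"
      using W(1) by (auto simp: bicoproduct_def image_Un image_image q compose_eq cong: image_cong)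
    moreover have "compose (pts X) k i ` pts X = k ` i ` pts X"
      by (auto simp: image_image compose_eq cong: image_cong)
    ultimately show "pts Z = compose (pts X) k i ` pts X \<union> q ` pts W"
      using W(1) Z by (auto simp: bicoproduct_def)
  qed
  have nki: "compose (pts X) n (compose (pts X) k i) = (\<lambda>x\<in>pts X. x)"
    using gW by (auto simp: fun_eq_iff compose_def gmap_closed n W)
  have nq: "compose (pts W) n q = h"
    by (rule bicoproduct_map_eqI[OF W(1) gmap_compose[OF q(1) n(1)] W(2)])
      (use gW in \<open>auto simp: compose_eq gmap_closed q n W\<close>)
  have "up X Z (compose (pts X) k i) z = a"
    using up_comp[OF gW(1) gZ(1) z(1)] by (simp add: z W)
  moreover have "fop X b c = dn W X h (up W Z q z)"
  proof (rule fold_op_eqI[OF W(1,2,5,6)])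
    show "up W Z q z \<in> M W" using q(1) z(1) by (rule up_mem)
    show "up X W i (up W Z q z) = b"
      using up_comp[OF gW(1) q(1) z(1)] up_comp[OF gW(2) gZ(1) z(1)] by (simp add: q z W)
    show "up X W j (up W Z q z) = c"
      using up_comp[OF gW(2) q(1) z(1)] by (simp add: q z)
  qed
  ultimately have "dn Z X n z = fop X a (fop X b c)"
    using dn_bicoproduct[OF Z' n(1) z(1)] by (simp add: nki nq dn_id X a)
  with 1 show ?thesis by simp
qed

text \<open>This is the coproduct axiom with no summands at all: the product over an empty index set
  is a singleton.\<close>

lemma ex1_empty:
  assumes E: "fin_gset G E" "pts E = {}"
  shows "\<exists>!c. c \<in> M E"
proof -
  have "bij_betw (\<lambda>c. \<lambda>k\<in>{..<0::nat}. up E E (undefined k) c) (M E) (\<Pi>\<^sub>E k\<in>{..<0::nat}. M E)"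
    by (rule up_coproduct[of 0 "\<lambda>_. E" E undefined]) (simp add: is_coproduct_def E bij_betw_def)
  then have bij: "bij_betw (\<lambda>c. \<lambda>_. undefined) (M E) {\<lambda>_::nat. undefined :: 't}"
    by (simp add: restrict_def)
  then show ?thesis
    using bij_betw_imp_surj_on[OF bij] bij_betw_imp_inj_on[OF bij] unfolding inj_on_def by blast
qed

text \<open>The neutral element is the transfer of the unique element over the empty G-set;
  neutrality is \<open>dn_bicoproduct\<close> for the decomposition of \<open>X\<close> with an
  empty summand.\<close>

lemma fold_op_unit:
  assumes X: "fin_gset G X"
  obtains e where "e \<in> M X" "\<And>a. a \<in> M X \<Longrightarrow> fop X e a = a"
proof -
  let ?E = "empty_gset G :: ('g, 'u) gset"
  have "\<exists>!c. c \<in> M ?E"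
    by (rule ex1_empty[OF fin_gset_empty[OF fin_gset_group[OF X]]]) (simp add: empty_gset_def)
  then obtain o' where o': "M ?E = {o'}" by blast
  let ?u = "(\<lambda>_. undefined) :: 'u \<Rightarrow> 'u"
  have u: "gmap G ?E X ?u" using X by (rule gmap_from_empty)
  have uc: "compose (pts ?E) (\<lambda>x\<in>pts X. x) ?u = ?u"
    by (simp add: compose_def empty_gset_def fun_eq_iff)
  have "fop X (dn ?E X ?u o') a = a" if a: "a \<in> M X" for a
  proof -
    have "up ?E X ?u a = o'" using up_mem[OF u a] o' by simp
    then show ?thesis
      using dn_bicoproduct[OF bicoproduct_empty[OF X] gmap_id[OF X] a] X a
      by (simp add: uc gmap_compose_id[OF gmap_id[OF X]] up_id dn_id)
  qed
  moreover have "dn ?E X ?u o' \<in> M X" using u o' by (simp add: dn_mem)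
  ultimately show ?thesis using that by blast
qed

lemma fold_monoid_sel:
  "carrier (fold_monoid G M up dn X) = M X" "mult (fold_monoid G M up dn X) = fop X"
  by (simp_all add: fold_monoid_def)

lemma comm_monoid_fold:
  assumes X: "fin_gset G X"
  shows "comm_monoid (fold_monoid G M up dn X)"
proof -
  obtain e where e: "e \<in> M X" "\<And>a. a \<in> M X \<Longrightarrow> fop X e a = a"
    using fold_op_unit[OF X] by blast
  \<comment> \<open>The unit is described by left neutrality alone; uniqueness comes from
    commutativity.\<close>
  have "one (fold_monoid G M up dn X) = e"
    unfolding fold_monoid_def monoid.simps
    by (rule the_equality) (use e in auto, metis fold_op_commute[OF X] e)
  then show ?thesis
    by (intro comm_monoidI) (auto simp: fold_monoid_sel fold_op_closed fold_op_assoc X e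
        intro: fold_op_commute)
qed

text \<open>The composite of \<open>f\<close> with the folding map restricts to \<open>f\<close> on
  each copy of \<open>X\<close>, so \<open>dn_bicoproduct\<close> splits its transfer.\<close>

lemma dn_fold_op:
  assumes f: "gmap G X Y f" and a: "a \<in> M X" and b: "b \<in> M X"
  shows "dn X Y f (fop X a b) = fop Y (dn X Y f a) (dn X Y f b)"
proof (rule ex_fold_diagram[OF gmap_source[OF f] a b])
  fix Z i j h c
  assume Z: "bicoproduct G X X Z i j" and h: "gmap G Z X h"
    "\<And>x. x \<in> pts X \<Longrightarrow> h (i x) = x" "\<And>x. x \<in> pts X \<Longrightarrow> h (j x) = x"
    and c: "c \<in> M Z" "up X Z i c = a" "up X Z j c = b" and eq: "fop X a b = dn Z X h c"
  note g = bicoproduct_gmap[OF Z]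
  have "compose (pts X) (compose (pts Z) f h) i = f" "compose (pts X) (compose (pts Z) f h) j = f"
    using gmap_extensional[OF f] g
    by (auto simp: fun_eq_iff compose_def gmap_closed h extensional_def)
  with dn_bicoproduct[OF Z gmap_compose[OF h(1) f] c(1)] show ?thesis
    using dn_comp[OF h(1) f c(1)] by (simp add: eq c)
qed

text \<open>Folding maps are stable under base change: the folding map of \<open>X\<close> is the
  pull-back of the folding map of \<open>Y\<close> along \<open>f\<close>.\<close>

lemma up_fold_op:
  assumes f: "gmap G X Y f" and a: "a \<in> M Y" and b: "b \<in> M Y"
  shows "up X Y f (fop Y a b) = fop X (up X Y f a) (up X Y f b)"
proof (rule ex_fold_diagram[OF gmap_target[OF f] a b])
  fix W k l h c
  assume W: "bicoproduct G Y Y W k l" and h: "gmap G W Y h"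
    "\<And>x. x \<in> pts Y \<Longrightarrow> h (k x) = x" "\<And>x. x \<in> pts Y \<Longrightarrow> h (l x) = x"
    and c: "c \<in> M W" "up Y W k c = a" "up Y W l c = b" and eq: "fop Y a b = dn W Y h c"
  note gW = bicoproduct_gmap[OF W] and X = gmap_source[OF f]
  obtain V :: "('g, 'u) gset" and i j where V: "bicoproduct G X X V i j"
    using ex_bicoproduct[OF X X] .
  note gV = bicoproduct_gmap[OF V]
  obtain n where n: "gmap G V X n" "\<And>x. x \<in> pts X \<Longrightarrow> n (i x) = (\<lambda>x\<in>pts X. x) x"
    "\<And>x. x \<in> pts X \<Longrightarrow> n (j x) = (\<lambda>x\<in>pts X. x) x"
    using bicoproduct_copair[OF V gmap_id gmap_id] X by metis
  obtain q where q: "gmap G V W q" "compose (pts X) q i = compose (pts X) k f"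
    "compose (pts X) q j = compose (pts X) l f"
    "\<And>x. x \<in> pts X \<Longrightarrow> q (i x) = compose (pts X) k f x"
    "\<And>x. x \<in> pts X \<Longrightarrow> q (j x) = compose (pts X) l f x"
    using bicoproduct_copair[OF V gmap_compose[OF f gW(1)] gmap_compose[OF f gW(2)]] by metis
  note Vc = bicoproduct_cases[OF V] and Wc = bicoproduct_cases[OF W]
  note Veq = bicoproduct_eq_iff[OF V] and Weq = bicoproduct_eq_iff[OF W]
  note fc = gmap_closed[OF f]
  have "is_pullback G V W X Y q n h f"
    using h(1) f q(1) n(1)
  proof (rule is_pullbackI)
    show "h (q v) = f (n v)" if "v \<in> pts V" for v
      using that by (rule Vc) (auto simp: q n compose_eq h fc)
    show "\<exists>v\<in>pts V. q v = w \<and> n v = x" if "w \<in> pts W" "x \<in> pts X" "h w = f x" for w x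
      using that(1)
    proof (rule Wc)
      fix y assume "y \<in> pts Y" "w = k y"
      then show ?thesis using that gmap_closed[OF gV(1)]
        by (intro bexI[of _ "i x"]) (auto simp: q n h compose_eq)
    next
      fix y assume "y \<in> pts Y" "w = l y"
      then show ?thesis using that gmap_closed[OF gV(2)]
        by (intro bexI[of _ "j x"]) (auto simp: q n h compose_eq)
    qed
    show "v = v'" if "v \<in> pts V" "v' \<in> pts V" "q v = q v'" "n v = n v'" for v v'
      using that by (auto elim!: Vc simp: q n compose_eq Weq fc)
  qed
  from base_change[OF this c(1)] have "up X Y f (fop Y a b) = dn V X n (up V W q c)"
    by (simp add: eq)
  also have "\<dots> = fop X (up X Y f a) (up X Y f b)"
  proof (rule fold_op_eqI[OF V n(1), symmetric])
    show "up V W q c \<in> M V" using q(1) c(1) by (rule up_mem)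
    show "up X V i (up V W q c) = up X Y f a"
      using up_comp[OF gV(1) q(1) c(1)] up_comp[OF f gW(1) c(1)] by (simp add: q c)
    show "up X V j (up V W q c) = up X Y f b"
      using up_comp[OF gV(2) q(1) c(1)] up_comp[OF f gW(2) c(1)] by (simp add: q c)
  qed (simp_all add: n)
  finally show ?thesis .
qed

end


section \<open>Exponential diagrams\<close>

lemma pts_section_gset:
  "pts (section_gset G A X Y p f) =
     {(y, \<sigma>). y \<in> pts Y \<and> \<sigma> \<in> {x \<in> pts X. f x = y} \<rightarrow>\<^sub>E pts A \<and>
       (\<forall>x\<in>{x \<in> pts X. f x = y}. p (\<sigma> x) = x)}"
  by (simp add: section_gset_def Let_def)

lemma act_section_gset:
  assumes "g \<in> carrier G" "t \<in> pts (section_gset G A X Y p f)"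
  shows "act (section_gset G A X Y p f) g t =
    (act Y g (fst t), \<lambda>x\<in>{x \<in> pts X. f x = act Y g (fst t)}. act A g (snd t (act X (inv\<^bsub>G\<^esub> g) x)))"
  using assms by (simp add: section_gset_def Let_def)

lemma fin_section_gset:
  fixes G (structure)
  assumes p: "gmap G A X p" and f: "gmap G X Y f"
  shows "fin_gset G (section_gset G A X Y p f)" (is "fin_gset G ?S")
proof -
  have A: "fin_gset G A" and X: "fin_gset G X" and Y: "fin_gset G Y"
    using assms by (auto dest: gmap_source gmap_target)
  interpret group G using A by (rule fin_gset_group)
  let ?fib = "\<lambda>y. {x \<in> pts X. f x = y}"
  \<comment> \<open>This makes conjugation well defined: the inverse of \<open>g\<close> carries the
    fibre over \<open>act Y g y\<close> back to the fibre over \<open>y\<close>, where the section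
    lives.\<close>
  have shift: "act X (inv g) x \<in> pts X \<and> f (act X (inv g) x) = y"
    if "g \<in> carrier G" "x \<in> pts X" "y \<in> pts Y" "f x = act Y g y" for g x y
    using that by (simp add: gmap_act[OF f] act_closed[OF X] act_inv(1)[OF Y])
  show ?thesis
  proof (rule fin_gsetI)
    have "pts ?S \<subseteq> (SIGMA y:pts Y. ?fib y \<rightarrow>\<^sub>E pts A)"
      by (auto simp: pts_section_gset)
    then show "finite (pts ?S)"
      by (rule finite_subset)
        (auto intro!: finite_SigmaI finite_PiE simp: fin_gset_finite[OF A] fin_gset_finite[OF X]
          fin_gset_finite[OF Y])
    show "act ?S \<in> extensional (carrier G)" "\<And>g. g \<in> carrier G \<Longrightarrow> act ?S g \<in> extensional (pts ?S)"
      by (simp_all add: section_gset_def Let_def)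
    fix t assume t: "t \<in> pts ?S"
    obtain y \<sigma> where ys: "t = (y, \<sigma>)" "y \<in> pts Y" "\<sigma> \<in> ?fib y \<rightarrow>\<^sub>E pts A"
      "\<And>x. x \<in> pts X \<Longrightarrow> f x = y \<Longrightarrow> p (\<sigma> x) = x"
      using t by (auto simp: pts_section_gset)
    have \<sigma>: "\<sigma> x \<in> pts A" if "x \<in> pts X" "f x = y" for x
      using ys(3) that by auto
    show "act ?S \<one> t = t"
    proof -
      have "(\<lambda>x\<in>?fib y. act A \<one> (\<sigma> (act X (inv \<one>) x))) = \<sigma>"
        using ys(3) by (auto simp: fun_eq_iff PiE_def extensional_def act_one[OF X] act_one[OF A] \<sigma>)
      then show ?thesis
        unfolding act_section_gset[OF one_closed t] unfolding ys(1) by (simp add: act_one[OF Y] ys)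
    qed
    fix g assume g: "g \<in> carrier G"
    have act_t: "act ?S g t = (act Y g y, \<lambda>x\<in>?fib (act Y g y). act A g (\<sigma> (act X (inv g) x)))"
      unfolding act_section_gset[OF g t] by (simp add: ys(1))
    show cl: "act ?S g t \<in> pts ?S"
      unfolding act_t
      using shift[OF g _ ys(2)]
      by (auto simp: pts_section_gset act_closed[OF Y] act_closed[OF A] g ys \<sigma> gmap_act[OF p] act_inv(2)[OF X])
    fix h assume h: "h \<in> carrier G"
    show "act ?S (h \<otimes> g) t = act ?S h (act ?S g t)"
      unfolding act_section_gset[OF h cl] act_section_gset[OF m_closed[OF h g] t]
      unfolding act_t unfolding ys(1)
      using shift[OF g _ ys(2)] shift[OF h _ act_closed[OF Y g ys(2)]]
      by (auto simp: act_mult[OF Y] act_mult[OF A] act_mult[OF X] g h ys \<sigma> inv_mult_group fun_eq_iff)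
  qed (rule group_axioms)
qed

lemma fin_section_fibre_product:
  assumes "gmap G A X p" "gmap G X Y f"
  shows "fin_gset G (fibre_product G X f (section_gset G A X Y p f) fst)"
  using assms(2) fin_section_gset[OF assms]
  by (rule fin_fibre_product) (auto simp: act_section_gset, auto simp: pts_section_gset)

text \<open>Both corners are built concretely from sections and then copied into \<open>'u\<close>.
  Since \<open>P\<close> is only a copy, \<rho> has to return through the inverse of the
  identification \<open>e\<close>.\<close>

lemma ex_exponential:
  fixes A :: "('g, 'u::infinite) gset"
  assumes p: "gmap G A X p" and f: "gmap G X Y f"
  obtains P Z \<pi> \<rho> l where "is_exponential G A X Y P Z p f \<pi> \<rho> l"
proof -
  let ?S = "section_gset G A X Y p f"
  let ?F = "fibre_product G X f ?S fst"
  have A: "fin_gset G A" and X: "fin_gset G X" and Y: "fin_gset G Y"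
    using assms by (auto dest: gmap_source gmap_target)
  note S = fin_section_gset[OF p f] and F = fin_section_fibre_product[OF p f]
  obtain P :: "('g, 'u) gset" and e where e: "giso G P ?S e" using ex_giso[OF S] .
  obtain Z :: "('g, 'u) gset" and d where d: "giso G Z ?F d" using ex_giso[OF F] .
  have P: "fin_gset G P" and Z: "fin_gset G Z" using e d giso_fin_gset by auto
  have eg: "gmap G P ?S e" and dg: "gmap G Z ?F d" using e d by (auto simp: giso_def)
  have bij: "bij_betw e (pts P) (pts ?S)" using e by (auto simp: giso_def)
  note e' = gmap_inverse[OF eg bij]
  have d_mem: "fst (d z) \<in> pts X" "snd (d z) \<in> pts ?S" "f (fst (d z)) = fst (snd (d z))"
    if "z \<in> pts Z" for z
    using gmap_closed[OF dg that] by (auto simp: pts_fibre_product)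
  have d_act: "d (act Z g z) = (act X g (fst (d z)), act ?S g (snd (d z)))"
    if "g \<in> carrier G" "z \<in> pts Z" for g z
    using gmap_act[OF dg that] gmap_closed[OF dg that(2)] that by (simp add: act_fibre_product)
  define \<pi> where "\<pi> = (\<lambda>t\<in>pts P. fst (e t))"
  define \<rho> where "\<rho> = (\<lambda>z\<in>pts Z. inv_into (pts P) e (snd (d z)))"
  define l where "l = (\<lambda>z\<in>pts Z. snd (snd (d z)) (fst (d z)))"
  have "gmap G P Y \<pi>"
    unfolding \<pi>_def
  proof (rule gmap_restrictI[OF P Y])
    show "fst (e t) \<in> pts Y" if "t \<in> pts P" for t
      using gmap_closed[OF eg that] by (auto simp: pts_section_gset)
    show "fst (e (act P g t)) = act Y g (fst (e t))" if "g \<in> carrier G" "t \<in> pts P" for g t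
      using gmap_act[OF eg that] gmap_closed[OF eg that(2)] that by (simp add: act_section_gset)
  qed
  moreover have "gmap G Z P \<rho>"
    unfolding \<rho>_def
  proof (rule gmap_restrictI[OF Z P])
    show "inv_into (pts P) e (snd (d z)) \<in> pts P" if "z \<in> pts Z" for z
      using gmap_closed[OF e' d_mem(2)[OF that]] d_mem(2)[OF that] by simp
    show "inv_into (pts P) e (snd (d (act Z g z))) = act P g (inv_into (pts P) e (snd (d z)))"
      if "g \<in> carrier G" "z \<in> pts Z" for g z
      using gmap_act[OF e' that(1) d_mem(2)[OF that(2)]] d_mem(2)[OF that(2)]
        act_closed[OF S that(1) d_mem(2)[OF that(2)]] by (simp add: d_act that)
  qed
  moreover have "gmap G Z A l"
    unfolding l_def
  proof (rule gmap_restrictI[OF Z A])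
    fix z assume z: "z \<in> pts Z"
    show *: "snd (snd (d z)) (fst (d z)) \<in> pts A"
      using d_mem[OF z] by (auto simp: pts_section_gset)
    fix g assume g: "g \<in> carrier G"
    show "snd (snd (d (act Z g z))) (fst (d (act Z g z))) = act A g (snd (snd (d z)) (fst (d z)))"
      using d_mem[OF z] by (simp add: d_act g z act_section_gset gmap_act[OF f] act_closed[OF X] act_inv(1)[OF X])
  qed
  moreover have "e (\<rho> z) = snd (d z)" if "z \<in> pts Z" for z
    using that d_mem(2)[OF that] bij by (simp add: \<rho>_def bij_betw_inv_into_right)
  ultimately have "is_exponential G A X Y P Z p f \<pi> \<rho> l"
    unfolding is_exponential_def using p f e d
    by (intro conjI exI[of _ e] exI[of _ d]) (auto simp: \<pi>_def l_def)
  then show ?thesis using that by blast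
qed

text \<open>
  For the folding map \<open>n : X \<amalg> X \<rightarrow> X\<close> and \<open>p = u \<amalg> id\<close>, a section over the fibre of \<open>x\<close> is a point of
  \<open>u\<^sup>-\<^sup>1(x)\<close>; the exponential diagram then expresses Frobenius reciprocity.
\<close>
lemma is_exponential_fold:
  fixes G (structure)
  assumes u: "gmap G C X u"
    and A: "bicoproduct G C X A i j" and W: "bicoproduct G X X W k l" and Z: "bicoproduct G C C Z a b"
    and p: "gmap G A W p" "\<And>c. c \<in> pts C \<Longrightarrow> p (i c) = k (u c)" "\<And>x. x \<in> pts X \<Longrightarrow> p (j x) = l x"
    and n: "gmap G W X n" "\<And>x. x \<in> pts X \<Longrightarrow> n (k x) = x" "\<And>x. x \<in> pts X \<Longrightarrow> n (l x) = x"
    and r: "gmap G Z C r" "\<And>c. c \<in> pts C \<Longrightarrow> r (a c) = c" "\<And>c. c \<in> pts C \<Longrightarrow> r (b c) = c"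
    and s: "gmap G Z A s" "\<And>c. c \<in> pts C \<Longrightarrow> s (a c) = i c" "\<And>c. c \<in> pts C \<Longrightarrow> s (b c) = j (u c)"
  shows "is_exponential G A W X C Z p n u r s"
proof -
  let ?S = "section_gset G A W X p n"
  let ?F = "fibre_product G W n ?S fst"
  note S = fin_section_gset[OF p(1) n(1)] and F = fin_section_fibre_product[OF p(1) n(1)]
  note gA = bicoproduct_gmap[OF A] and gW = bicoproduct_gmap[OF W] and gZ = bicoproduct_gmap[OF Z]
  note Wc = bicoproduct_cases[OF W] and Zc = bicoproduct_cases[OF Z] and Ac = bicoproduct_cases[OF A]
  note eqA = bicoproduct_eq_iff[OF A] and eqW = bicoproduct_eq_iff[OF W]
  have fin: "fin_gset G C" "fin_gset G X" "fin_gset G A" "fin_gset G W" "fin_gset G Z"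
    using u gA gW gZ by (auto dest: gmap_source gmap_target)
  interpret group G using fin(1) by (rule fin_gset_group)
  note cl = gmap_closed[OF u] gmap_closed[OF gA(1)] gmap_closed[OF gA(2)]
    gmap_closed[OF gW(1)] gmap_closed[OF gW(2)] gmap_closed[OF gZ(1)] gmap_closed[OF gZ(2)]
    gmap_closed[OF p(1)] gmap_closed[OF r(1)]
  have fib: "{w \<in> pts W. n w = x} = {k x, l x}" if "x \<in> pts X" for x
    using that by (auto elim!: Wc simp: n cl)
  \<comment> \<open>The section belonging to the point \<open>c\<close>: over the two-point fibre of
    \<open>u c\<close> it picks \<open>c\<close> itself on the first copy and the only available
    point on the second.\<close>
  define \<tau> where "\<tau> = (\<lambda>c. \<lambda>w\<in>{k (u c), l (u c)}. if w = k (u c) then i c else j (u c))"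
  have \<tau>: "\<tau> c (k (u c)) = i c" "\<tau> c (l (u c)) = j (u c)" if "c \<in> pts C" for c
    using that by (auto simp: \<tau>_def eqW cl)
  have S_eqI: "(x, \<sigma>) = (u c, \<tau> c)"
    if "\<sigma> \<in> extensional {k x, l x}" "x = u c" "c \<in> pts C" "\<sigma> (k x) = i c" "\<sigma> (l x) = j x" for x \<sigma> c
    using that \<tau>[of c] by (auto intro!: extensionalityI[of \<sigma> "{k x, l x}"] simp: \<tau>_def)
  define e where "e = (\<lambda>c\<in>pts C. (u c, \<tau> c))"
  have e_mem: "(u c, \<tau> c) \<in> pts ?S" if "c \<in> pts C" for c
    unfolding pts_section_gset mem_Collect_eq case_prod_conv fib[OF cl(1)[OF that]]
    using that \<tau>[OF that] by (auto simp: cl p \<tau>_def)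
  have eg: "gmap G C ?S e"
    unfolding e_def
  proof (rule gmap_restrictI[OF fin(1) S e_mem])
    fix g c assume g: "g \<in> carrier G" and c: "c \<in> pts C"
    have k: "act W (inv g) (k (act X g (u c))) = k (u c)" "act W (inv g) (l (act X g (u c))) = l (u c)"
      using g c by (simp_all add: gmap_act[OF gW(1)] gmap_act[OF gW(2)] cl act_inv(1)[OF fin(4)])
    show "(u (act C g c), \<tau> (act C g c)) = act ?S g (u c, \<tau> c)"
      unfolding act_section_gset[OF g e_mem[OF c]] fst_conv snd_conv
        fib[OF act_closed[OF fin(2) g cl(1)[OF c]]]
      by (rule S_eqI[symmetric])
        (use g c in \<open>auto simp: k \<tau> gmap_act[OF u] gmap_act[OF gA(1)] gmap_act[OF gA(2)] act_closed[OF fin(1)] cl\<close>)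
  qed
  have e_inj: "c = c'" if "c \<in> pts C" "c' \<in> pts C" "e c = e c'" for c c'
    using that \<tau>(1)[of c] \<tau>(1)[of c'] eqA(1)[of c c'] by (auto simp: e_def)
  have e_surj: "\<exists>c\<in>pts C. t = e c" if t: "t \<in> pts ?S" for t
  proof -
    obtain x \<sigma> where t': "t = (x, \<sigma>)" "x \<in> pts X" "\<sigma> \<in> {w \<in> pts W. n w = x} \<rightarrow>\<^sub>E pts A"
      "\<forall>w\<in>{w \<in> pts W. n w = x}. p (\<sigma> w) = w"
      using t unfolding pts_section_gset by blast
    have x: "t = (x, \<sigma>)" "x \<in> pts X" "\<sigma> \<in> {k x, l x} \<rightarrow>\<^sub>E pts A"
      "p (\<sigma> (k x)) = k x" "p (\<sigma> (l x)) = l x"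
      using t'(3,4) unfolding fib[OF t'(2)] by (simp_all add: t'(1,2))
    have "\<sigma> (k x) \<in> pts A" "\<sigma> (l x) \<in> pts A" using x(3) by auto
    from this(1) obtain c where c: "c \<in> pts C" "\<sigma> (k x) = i c" "u c = x"
      using x(2,4) by (elim Ac) (auto simp: p eqW cl)
    \<comment> \<open>No choice is left on the second copy, because \<open>p\<close> is the identity
      there up to the legs.\<close>
    have "\<sigma> (l x) = j x"
      using \<open>\<sigma> (l x) \<in> pts A\<close> x(2,5) by (elim Ac) (auto simp: p eqW cl)
    moreover have "\<sigma> \<in> extensional {k x, l x}" using x(3) by (simp add: PiE_def)
    ultimately have "(x, \<sigma>) = (u c, \<tau> c)" using c by (intro S_eqI) simp_all
    then have "t = e c"
      using x(1) c(1) by (simp add: e_def)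
    with c show ?thesis by blast
  qed
  have e: "giso G C ?S e"
    unfolding giso_def bij_betw_def
  proof (intro conjI eg inj_onI e_inj)
    show "e ` pts C = pts ?S" using e_surj gmap_closed[OF eg] by blast
  qed
  \<comment> \<open>The folding map has two points over every point of \<open>X\<close>, so the
    fibre product with the sections consists of two copies of \<open>C\<close>. The entry
    \<open>p (s z)\<close> records which copy \<open>z\<close> lies in, and \<open>r z\<close> gives
    the section.\<close>
  define d where "d = (\<lambda>z\<in>pts Z. (p (s z), e (r z)))"
  have ps: "p (s (a c)) = k (u c)" "p (s (b c)) = l (u c)" if "c \<in> pts C" for c
    using that by (simp_all add: p s cl)
  have d_mem: "(p (s z), e (r z)) \<in> pts ?F" if "z \<in> pts Z" for z
    using that gmap_closed[OF s(1) that]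
    by (auto simp: pts_fibre_product cl gmap_closed[OF eg])
      (auto elim!: Zc simp: ps e_def n r cl)
  have dg: "gmap G Z ?F d"
    unfolding d_def
    by (rule gmap_restrictI[OF fin(5) F d_mem])
      (auto simp: act_fibre_product d_mem gmap_act[OF s(1)] gmap_act[OF p(1)] gmap_act[OF r(1)]
        gmap_act[OF eg] cl gmap_closed[OF s(1)])
  have d_inj: "z = z'" if z: "z \<in> pts Z" "z' \<in> pts Z" and eq: "d z = d z'" for z z'
  proof -
    have "p (s z) = p (s z')" "r z = r z'"
      using z eq e_inj[of "r z" "r z'"] by (auto simp: d_def cl)
    then show ?thesis
      using z by (auto elim!: Zc simp: ps r eqW cl)
  qed
  have d_surj: "\<exists>z\<in>pts Z. t = d z" if t: "t \<in> pts ?F" for t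
  proof -
    obtain w t' where t': "t = (w, t')" "w \<in> pts W" "t' \<in> pts ?S" "n w = fst t'"
      using t by (auto simp: pts_fibre_product)
    obtain c where "c \<in> pts C" "t' = e c" using e_surj[OF t'(3)] by blast
    with t' have w: "t = (w, e c)" "w \<in> pts W" "c \<in> pts C" "n w = u c"
      by (simp_all add: e_def)
    from w(2) show ?thesis
    proof (rule Wc)
      fix x assume "x \<in> pts X" "w = k x"
      then show ?thesis using w by (intro bexI[of _ "a c"]) (auto simp: d_def ps r n cl)
    next
      fix x assume "x \<in> pts X" "w = l x"
      then show ?thesis using w by (intro bexI[of _ "b c"]) (auto simp: d_def ps r n cl)
    qed
  qed
  have d: "giso G Z ?F d"
    unfolding giso_def bij_betw_def
  proof (intro conjI dg inj_onI d_inj)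
    show "d ` pts Z = pts ?F" using d_surj gmap_closed[OF dg] by blast
  qed
  have "s z = snd (snd (d z)) (fst (d z))" if "z \<in> pts Z" for z
    using that by (auto elim!: Zc simp: d_def p r e_def \<tau> s cl)
  then show ?thesis
    unfolding is_exponential_def using u p(1) n(1) r(1) s(1) e d
    by (intro conjI exI[of _ e] exI[of _ d]) (auto simp: e_def d_def)
qed


section \<open>Tambara functors\<close>

locale tambara =
  fixes G :: "('g, 'm) monoid_scheme" (structure)
    and T :: "('g, 'u::infinite, 't) tambara"
  assumes tambara: "tambara_functor G T"

sublocale tambara \<subseteq> add: mackey_functor G "Tval T" "Tres T" "Ttr T"
  using tambara by (simp add: tambara_functor_def)

sublocale tambara \<subseteq> mul: semi_mackey_functor G "Tval T" "Tres T" "Tnm T"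
  using tambara by (simp add: tambara_functor_def)

context tambara
begin

section \<open>Frobenius reciprocity and the ring axioms\<close>

abbreviation "R \<equiv> Tring G T"

lemma R_simps:
  "carrier (R X) = Tval T X" "a \<otimes>\<^bsub>R X\<^esub> b = mul.fop X a b" "a \<oplus>\<^bsub>R X\<^esub> b = add.fop X a b"
  by (simp_all add: Tring_def fold_monoid_def)

lemma Tnm_Ttr:
  "is_exponential G A X Y P Z p f \<pi> \<rho> l \<Longrightarrow> a \<in> Tval T A \<Longrightarrow>
   Tnm T X Y f (Ttr T A X p a) = Ttr T P Y \<pi> (Tnm T Z P \<rho> (Tres T Z A l a))"
  using tambara unfolding tambara_functor_def by metis

text \<open>Let \<open>a\<close>, over the coproduct \<open>A\<close> of \<open>C\<close> and
  \<open>X\<close>, have components \<open>c\<close> and \<open>d\<close>. The norm of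
  \<open>Ttr T A W p a\<close> along the folding map \<open>f\<close> is computed in two ways. Base
  change on the summands gives the transfer of \<open>c\<close> times \<open>d\<close>; the
  exponential law gives the transfer of \<open>c\<close> times the restriction of
  \<open>d\<close>.\<close>

lemma frobenius:
  assumes u: "gmap G C X u" and c: "c \<in> Tval T C" and d: "d \<in> Tval T X"
  shows "Ttr T C X u (c \<otimes>\<^bsub>R C\<^esub> Tres T C X u d) = Ttr T C X u c \<otimes>\<^bsub>R X\<^esub> d"
proof -
  have fin: "fin_gset G C" "fin_gset G X" using u by (auto dest: gmap_source gmap_target)
  obtain A :: "('g, 'u) gset" and i j where A: "bicoproduct G C X A i j"
    using ex_bicoproduct[OF fin] .
  obtain W :: "('g, 'u) gset" and k l where W: "bicoproduct G X X W k l"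
    using ex_bicoproduct[OF fin(2) fin(2)] .
  obtain Z :: "('g, 'u) gset" and m n where Z: "bicoproduct G C C Z m n"
    using ex_bicoproduct[OF fin(1) fin(1)] .
  note gA = bicoproduct_gmap[OF A] and gW = bicoproduct_gmap[OF W] and gZ = bicoproduct_gmap[OF Z]
  note idX = gmap_id[OF fin(2)] and idC = gmap_id[OF fin(1)]
  obtain p where p: "gmap G A W p" "\<And>x. x \<in> pts C \<Longrightarrow> p (i x) = compose (pts C) k u x"
    "\<And>x. x \<in> pts X \<Longrightarrow> p (j x) = l x"
    using bicoproduct_copair[OF A gmap_compose[OF u gW(1)] gW(2)] by metis
  obtain f where f: "gmap G W X f" "\<And>x. x \<in> pts X \<Longrightarrow> f (k x) = (\<lambda>x\<in>pts X. x) x"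
    "\<And>x. x \<in> pts X \<Longrightarrow> f (l x) = (\<lambda>x\<in>pts X. x) x"
    using bicoproduct_copair[OF W idX idX] by metis
  obtain r where r: "gmap G Z C r" "\<And>x. x \<in> pts C \<Longrightarrow> r (m x) = (\<lambda>x\<in>pts C. x) x"
    "\<And>x. x \<in> pts C \<Longrightarrow> r (n x) = (\<lambda>x\<in>pts C. x) x"
    using bicoproduct_copair[OF Z idC idC] by metis
  obtain s where s: "gmap G Z A s" "compose (pts C) s m = i" "compose (pts C) s n = compose (pts C) j u"
    "\<And>x. x \<in> pts C \<Longrightarrow> s (m x) = i x" "\<And>x. x \<in> pts C \<Longrightarrow> s (n x) = compose (pts C) j u x"
    using bicoproduct_copair[OF Z gA(1) gmap_compose[OF u gA(2)]] by metis
  have ex: "is_exponential G A W X C Z p f u r s"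
    by (rule is_exponential_fold[OF u A W Z]) (use p f r s in \<open>auto simp: compose_eq\<close>)
  obtain a where a: "a \<in> Tval T A" "Tres T C A i a = c" "Tres T X A j a = d"
    using mul.up_bicoproduct_ex1[OF A c d] by blast
  have p1: "is_pullback G C A X W i u p k"
    using A W u idX p(1) by (rule is_pullback_bicoproduct) (simp_all add: p compose_eq)
  have p2: "is_pullback G X A X W j (\<lambda>x\<in>pts X. x) p l"
    using bicoproduct_commute[OF A] bicoproduct_commute[OF W] idX u p(1)
    by (rule is_pullback_bicoproduct) (simp_all add: p compose_eq)
  have "Ttr T C X u c \<otimes>\<^bsub>R X\<^esub> d = Tnm T W X f (Ttr T A W p a)"
    unfolding R_simps
    by (rule mul.fold_op_eqI[OF W f(1)])
      (use f a p(1) in \<open>auto simp: add.dn_mem add.base_change[OF p1] add.base_change[OF p2] add.dn_id[OF fin(2) d]\<close>)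
  also have "\<dots> = Ttr T C X u (Tnm T Z C r (Tres T Z A s a))"
    using ex a(1) by (rule Tnm_Ttr)
  also have "Tnm T Z C r (Tres T Z A s a) = c \<otimes>\<^bsub>R C\<^esub> Tres T C X u d"
    unfolding R_simps
  proof (rule mul.fold_op_eqI[OF Z r(1), symmetric])
    show "Tres T Z A s a \<in> Tval T Z" using s(1) a(1) by (rule mul.up_mem)
    show "Tres T C Z m (Tres T Z A s a) = c"
      using mul.up_comp[OF gZ(1) s(1) a(1)] by (simp add: s a)
    show "Tres T C Z n (Tres T Z A s a) = Tres T C X u d"
      using mul.up_comp[OF gZ(2) s(1) a(1)] mul.up_comp[OF u gA(2) a(1)] by (simp add: s a)
  qed (simp_all add: r)
  finally show ?thesis ..
qed

text \<open>Distributivity is Frobenius reciprocity for the folding map \<open>h\<close>. The sum of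
  \<open>a\<close> and \<open>b\<close> is the transfer of an element \<open>z\<close> with these
  components, and \<open>z\<close> times the restriction of \<open>c\<close> has as components the
  products of \<open>a\<close> and \<open>b\<close> with \<open>c\<close>.\<close>

lemma cring_R:
  assumes X: "fin_gset G X"
  shows "cring (R X)"
proof (rule cringI)
  have am: "add_monoid (R X) = fold_monoid G (Tval T) (Tres T) (Ttr T) X"
    by (simp add: Tring_def fold_monoid_def)
  show "abelian_group (R X)"
    by (rule comm_group_abelian_groupI) (unfold am, rule add.abelian_groups[OF X])
  interpret F: comm_monoid "fold_monoid G (Tval T) (Tres T) (Tnm T) X"
    using X by (rule mul.comm_monoid_fold)
  have R_sel: "carrier (R X) = carrier (fold_monoid G (Tval T) (Tres T) (Tnm T) X)"
    "mult (R X) = mult (fold_monoid G (Tval T) (Tres T) (Tnm T) X)"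
    "one (R X) = one (fold_monoid G (Tval T) (Tres T) (Tnm T) X)"
    by (simp_all add: Tring_def fold_monoid_def)
  show "comm_monoid (R X)"
    by (rule comm_monoidI, unfold R_sel) (simp_all add: F.m_ac)
  fix a b c assume a: "a \<in> carrier (R X)" and b: "b \<in> carrier (R X)" and c: "c \<in> carrier (R X)"
  note abc = a[unfolded R_simps] b[unfolded R_simps] c[unfolded R_simps]
  show "(a \<oplus>\<^bsub>R X\<^esub> b) \<otimes>\<^bsub>R X\<^esub> c = a \<otimes>\<^bsub>R X\<^esub> c \<oplus>\<^bsub>R X\<^esub> b \<otimes>\<^bsub>R X\<^esub> c"
  proof (rule add.ex_fold_diagram[OF X abc(1,2)])
    fix Z i j h z
    assume Z: "bicoproduct G X X Z i j" and h: "gmap G Z X h"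
      "compose (pts X) h i = (\<lambda>x\<in>pts X. x)" "compose (pts X) h j = (\<lambda>x\<in>pts X. x)"
      "\<And>x. x \<in> pts X \<Longrightarrow> h (i x) = x" "\<And>x. x \<in> pts X \<Longrightarrow> h (j x) = x"
      and z: "z \<in> Tval T Z" "Tres T X Z i z = a" "Tres T X Z j z = b" "add.fop X a b = Ttr T Z X h z"
    note gZ = bicoproduct_gmap[OF Z] and Zf = gmap_source[OF h(1)]
    have hc: "Tres T Z X h c \<in> Tval T Z" using h(1) abc(3) by (rule mul.up_mem)
    have "(a \<oplus>\<^bsub>R X\<^esub> b) \<otimes>\<^bsub>R X\<^esub> c = Ttr T Z X h (z \<otimes>\<^bsub>R Z\<^esub> Tres T Z X h c)"
      using frobenius[OF h(1) z(1) abc(3)] by (simp add: R_simps z)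
    also have "\<dots> = a \<otimes>\<^bsub>R X\<^esub> c \<oplus>\<^bsub>R X\<^esub> b \<otimes>\<^bsub>R X\<^esub> c"
      unfolding R_simps
    proof (rule add.fold_op_eqI[OF Z h(1,4,5), symmetric])
      show "mul.fop Z z (Tres T Z X h c) \<in> Tval T Z"
        using Zf z(1) hc by (rule mul.fold_op_closed)
      show "Tres T X Z i (mul.fop Z z (Tres T Z X h c)) = mul.fop X a c"
        using mul.up_comp[OF gZ(1) h(1) abc(3)]
        by (simp add: mul.up_fold_op[OF gZ(1) z(1) hc] h z mul.up_id X abc)
      show "Tres T X Z j (mul.fop Z z (Tres T Z X h c)) = mul.fop X b c"
        using mul.up_comp[OF gZ(2) h(1) abc(3)]
        by (simp add: mul.up_fold_op[OF gZ(2) z(1) hc] h z mul.up_id X abc)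
    qed
    finally show ?thesis .
  qed
qed

section \<open>Restrictions, transfers and norms against the ring operations\<close>

lemma
  assumes f: "gmap G X Y f"
  shows res_closed: "c \<in> Tval T Y \<Longrightarrow> Tres T X Y f c \<in> Tval T X"
    and tr_closed: "a \<in> Tval T X \<Longrightarrow> Ttr T X Y f a \<in> Tval T Y"
    and nm_closed: "a \<in> Tval T X \<Longrightarrow> Tnm T X Y f a \<in> Tval T Y"
  using add.up_mem[OF f] add.dn_mem[OF f] mul.dn_mem[OF f] by auto

lemma res_mult:
  "gmap G X Y f \<Longrightarrow> c \<in> Tval T Y \<Longrightarrow> d \<in> Tval T Y \<Longrightarrow>
    Tres T X Y f (c \<otimes>\<^bsub>R Y\<^esub> d) = Tres T X Y f c \<otimes>\<^bsub>R X\<^esub> Tres T X Y f d"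
  unfolding R_simps by (rule mul.up_fold_op)

lemma res_add:
  "gmap G X Y f \<Longrightarrow> c \<in> Tval T Y \<Longrightarrow> d \<in> Tval T Y \<Longrightarrow>
    Tres T X Y f (c \<oplus>\<^bsub>R Y\<^esub> d) = Tres T X Y f c \<oplus>\<^bsub>R X\<^esub> Tres T X Y f d"
  unfolding R_simps by (rule add.up_fold_op)

lemma tr_add:
  "gmap G X Y f \<Longrightarrow> c \<in> Tval T X \<Longrightarrow> d \<in> Tval T X \<Longrightarrow>
    Ttr T X Y f (c \<oplus>\<^bsub>R X\<^esub> d) = Ttr T X Y f c \<oplus>\<^bsub>R Y\<^esub> Ttr T X Y f d"
  unfolding R_simps by (rule add.dn_fold_op)

lemma nm_mult:
  "gmap G X Y f \<Longrightarrow> c \<in> Tval T X \<Longrightarrow> d \<in> Tval T X \<Longrightarrow>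
    Tnm T X Y f (c \<otimes>\<^bsub>R X\<^esub> d) = Tnm T X Y f c \<otimes>\<^bsub>R Y\<^esub> Tnm T X Y f d"
  unfolding R_simps by (rule mul.dn_fold_op)

text \<open>Restriction and transfer are only known to respect sums; that they preserve zero is
  obtained from this, zero being the one additive idempotent of a group.\<close>

lemma zero_unique:
  assumes "fin_gset G X" "a \<in> Tval T X" "a \<oplus>\<^bsub>R X\<^esub> a = a"
  shows "a = \<zero>\<^bsub>R X\<^esub>"
proof -
  interpret cring "R X" using assms(1) by (rule cring_R)
  show ?thesis
    using assms(2,3) add.l_cancel_one[of a a] by (simp add: R_simps(1))
qed

lemma zero_closed: "fin_gset G X \<Longrightarrow> \<zero>\<^bsub>R X\<^esub> \<in> Tval T X"
  using cring.cring_simprules(2)[OF cring_R, of X] by (simp add: R_simps)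

lemma zero_add: "fin_gset G X \<Longrightarrow> \<zero>\<^bsub>R X\<^esub> \<oplus>\<^bsub>R X\<^esub> \<zero>\<^bsub>R X\<^esub> = \<zero>\<^bsub>R X\<^esub>"
  using cring.cring_simprules(8)[OF cring_R, of X] zero_closed[of X] by (simp add: R_simps(1))

lemma
  assumes f: "gmap G X Y f"
  shows res_zero: "Tres T X Y f \<zero>\<^bsub>R Y\<^esub> = \<zero>\<^bsub>R X\<^esub>"
    and tr_zero: "Ttr T X Y f \<zero>\<^bsub>R X\<^esub> = \<zero>\<^bsub>R Y\<^esub>"
proof -
  note X = gmap_source[OF f] and Y = gmap_target[OF f]
  show "Tres T X Y f \<zero>\<^bsub>R Y\<^esub> = \<zero>\<^bsub>R X\<^esub>"
    using res_add[OF f zero_closed[OF Y] zero_closed[OF Y]]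
    by (intro zero_unique[OF X]) (simp_all add: res_closed[OF f] zero_closed[OF Y] zero_add[OF Y])
  show "Ttr T X Y f \<zero>\<^bsub>R X\<^esub> = \<zero>\<^bsub>R Y\<^esub>"
    using tr_add[OF f zero_closed[OF X] zero_closed[OF X]]
    by (intro zero_unique[OF Y]) (simp_all add: tr_closed[OF f] zero_closed[OF X] zero_add[OF X])
qed

end


lemma fin_gset_transitive: "transitive_gset G X \<Longrightarrow> fin_gset G X"
  by (simp add: transitive_gset_def)

text \<open>The orbit of any point is split off. Its complement is invariant and strictly smaller,
  which drives an induction on the number of points.\<close>

lemma orbit_decomposition:
  fixes G (structure) and X :: "('g, 'x) gset"
  assumes X: "fin_gset G X" and "pts X \<noteq> {}"
  obtains A C i j where "bicoproduct G A C X i j" "transitive_gset G (A :: ('g, 'x) gset)"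
    "card (pts (C :: ('g, 'x) gset)) < card (pts X)"
proof -
  interpret group G using X by (rule fin_gset_group)
  obtain x where x: "x \<in> pts X" using assms(2) by blast
  define B where "B = (\<lambda>g. act X g x) ` carrier G"
  have B: "B \<subseteq> pts X" using x by (auto simp: B_def act_closed[OF X])
  have xB: "x \<in> B" using x act_one[OF X x] by (force simp: B_def)
  have B_act: "act X g y \<in> B" if "g \<in> carrier G" "y \<in> B" for g y
  proof -
    obtain h where "h \<in> carrier G" "y = act X h x" using \<open>y \<in> B\<close> by (auto simp: B_def)
    then have "act X g y = act X (g \<otimes> h) x" "g \<otimes> h \<in> carrier G"
      using \<open>g \<in> carrier G\<close> x by (simp_all add: act_mult[OF X])
    then show ?thesis unfolding B_def by blast
  qed
  have C_act: "act X g y \<in> pts X - B" if "g \<in> carrier G" "y \<in> pts X - B" for g y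
    using that B_act[of "inv g" "act X g y"] by (auto simp: act_closed[OF X] act_inv(1)[OF X])
  have C: "pts X - B \<subseteq> pts X" by auto
  let ?A = "sub_gset G X B" and ?C = "sub_gset G X (pts X - B)"
  have "bicoproduct G ?A ?C X (\<lambda>x\<in>B. x) (\<lambda>x\<in>pts X - B. x)"
    unfolding bicoproduct_def using gmap_sub_gset[OF X B B_act] gmap_sub_gset[OF X C C_act] B
    by (auto simp: sub_gset_def inj_on_def)
  moreover have "transitive_gset G ?A"
  proof -
    have "\<exists>g\<in>carrier G. act ?A g y = z" if "y \<in> B" "z \<in> B" for y z
    proof -
      obtain g h where gh: "g \<in> carrier G" "y = act X g x" "h \<in> carrier G" "z = act X h x"
        using \<open>y \<in> B\<close> \<open>z \<in> B\<close> by (auto simp: B_def)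
      then have "act X (h \<otimes> inv g) y = z"
        using x by (simp add: act_mult[OF X] act_closed[OF X] act_inv(1)[OF X])
      then show ?thesis
        using gh \<open>y \<in> B\<close> by (intro bexI[of _ "h \<otimes> inv g"]) (auto simp: sub_gset_def)
    qed
    then show ?thesis
      using fin_sub_gset[OF X B B_act] xB
      by (auto simp: transitive_gset_def transitive_action_def transitive_action_axioms_def
          fin_gset_def sub_gset_def)
  qed
  moreover have "card (pts ?C) < card (pts X)"
    unfolding sub_gset_def gset.simps
    by (rule psubset_card_mono[OF fin_gset_finite[OF X]]) (use x xB in auto)
  ultimately show ?thesis by (rule that)
qed


section \<open>Ideals\<close>

text \<open>Negatives need no separate closure condition, since they are multiples by the negative
  of one.\<close>

lemma ideal_cringI:
  fixes R (structure)
  assumes "cring R" "I \<subseteq> carrier R" "\<zero> \<in> I" "\<And>a b. a \<in> I \<Longrightarrow> b \<in> I \<Longrightarrow> a \<oplus> b \<in> I"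
    and mult: "\<And>a x. a \<in> I \<Longrightarrow> x \<in> carrier R \<Longrightarrow> x \<otimes> a \<in> I"
  shows "ideal I R"
proof -
  interpret cring R by fact
  have I: "a \<in> carrier R" if "a \<in> I" for a using that assms(2) by auto
  have "\<ominus> a \<in> I" if "a \<in> I" for a
    using mult[OF that, of "\<ominus> \<one>"] I[OF that] by (simp add: l_minus)
  then have "subgroup I (add_monoid R)"
    using assms by (intro add.subgroupI) (auto simp: a_inv_def)
  then show ?thesis
    using mult I by (intro idealI) (auto simp: ring_axioms m_comm)
qed

lemma mem_a_l_coset_iff: "x \<in> a <+\<^bsub>R\<^esub> I \<longleftrightarrow> (\<exists>i\<in>I. x = a \<oplus>\<^bsub>R\<^esub> i)"
  by (auto simp: a_l_coset_def')

context tambara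
begin

lemma TidealI:
  assumes "I \<in> extensional {X. fin_gset G X}"
    and "\<And>X a. fin_gset G X \<Longrightarrow> a \<in> I X \<Longrightarrow> a \<in> Tval T X"
    and "\<And>X. fin_gset G X \<Longrightarrow> \<zero>\<^bsub>R X\<^esub> \<in> I X"
    and "\<And>X a b. fin_gset G X \<Longrightarrow> a \<in> I X \<Longrightarrow> b \<in> I X \<Longrightarrow> a \<oplus>\<^bsub>R X\<^esub> b \<in> I X"
    and "\<And>X a c. fin_gset G X \<Longrightarrow> a \<in> I X \<Longrightarrow> c \<in> Tval T X \<Longrightarrow> c \<otimes>\<^bsub>R X\<^esub> a \<in> I X"
    and "\<And>X Y f a. gmap G X Y f \<Longrightarrow> a \<in> I Y \<Longrightarrow> Tres T X Y f a \<in> I X"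
    and "\<And>X Y f a. gmap G X Y f \<Longrightarrow> a \<in> I X \<Longrightarrow> Ttr T X Y f a \<in> I Y"
    and "\<And>X Y f a. gmap G X Y f \<Longrightarrow> a \<in> I X \<Longrightarrow>
      \<exists>i\<in>I Y. Tnm T X Y f a = Tnm T X Y f \<zero>\<^bsub>R X\<^esub> \<oplus>\<^bsub>R Y\<^esub> i"
  shows "Tideal G T I"
  unfolding Tideal_def
proof (intro conjI allI impI)
  show "ideal (I X) (R X)" if "fin_gset G X" for X
    using cring_R[OF that] by (rule ideal_cringI) (use assms that in \<open>auto simp: R_simps(1)\<close>)
qed (use assms in \<open>auto simp: mem_a_l_coset_iff\<close>)

lemma
  assumes I: "Tideal G T I"
  shows Tideal_ideal: "fin_gset G X \<Longrightarrow> ideal (I X) (R X)"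
    and Tideal_res: "gmap G X Y f \<Longrightarrow> a \<in> I Y \<Longrightarrow> Tres T X Y f a \<in> I X"
    and Tideal_tr: "gmap G X Y f \<Longrightarrow> b \<in> I X \<Longrightarrow> Ttr T X Y f b \<in> I Y"
    and Tideal_nm: "gmap G X Y f \<Longrightarrow> b \<in> I X \<Longrightarrow>
      \<exists>i\<in>I Y. Tnm T X Y f b = Tnm T X Y f \<zero>\<^bsub>R X\<^esub> \<oplus>\<^bsub>R Y\<^esub> i"
  using I unfolding Tideal_def mem_a_l_coset_iff[symmetric] by blast+

lemma
  assumes I: "Tideal G T I" and X: "fin_gset G X"
  shows Tideal_mem: "a \<in> I X \<Longrightarrow> a \<in> Tval T X"
    and Tideal_zero: "\<zero>\<^bsub>R X\<^esub> \<in> I X"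
    and Tideal_add: "a \<in> I X \<Longrightarrow> b \<in> I X \<Longrightarrow> a \<oplus>\<^bsub>R X\<^esub> b \<in> I X"
    and Tideal_mult: "a \<in> I X \<Longrightarrow> c \<in> Tval T X \<Longrightarrow> c \<otimes>\<^bsub>R X\<^esub> a \<in> I X"
    and Tideal_one: "\<one>\<^bsub>R X\<^esub> \<in> I X \<Longrightarrow> I X = Tval T X"
proof -
  interpret ideal "I X" "R X" using I X by (rule Tideal_ideal)
  show "a \<in> I X \<Longrightarrow> a \<in> Tval T X" using Icarr by (simp add: R_simps)
  show "\<zero>\<^bsub>R X\<^esub> \<in> I X" by simp
  show "a \<in> I X \<Longrightarrow> b \<in> I X \<Longrightarrow> a \<oplus>\<^bsub>R X\<^esub> b \<in> I X" by simp
  show "a \<in> I X \<Longrightarrow> c \<in> Tval T X \<Longrightarrow> c \<otimes>\<^bsub>R X\<^esub> a \<in> I X"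
    using I_l_closed by (simp add: R_simps(1))
  show "\<one>\<^bsub>R X\<^esub> \<in> I X \<Longrightarrow> I X = Tval T X"
    using one_imp_carrier by (simp add: R_simps(1))
qed

lemma cancel_left:
  assumes "fin_gset G X" "a \<in> Tval T X" "b \<in> Tval T X" "c \<in> Tval T X" "a \<oplus>\<^bsub>R X\<^esub> b = a \<oplus>\<^bsub>R X\<^esub> c"
  shows "b = c"
proof -
  interpret cring "R X" using assms(1) by (rule cring_R)
  have "a \<in> carrier (R X)" "b \<in> carrier (R X)" "c \<in> carrier (R X)"
    using assms by (simp_all add: R_simps)
  then show ?thesis using assms(5) by (metis r_neg1)
qed

lemma one_closed: "fin_gset G X \<Longrightarrow> \<one>\<^bsub>R X\<^esub> \<in> Tval T X"
  using cring.cring_simprules(6)[OF cring_R, of X] by (simp add: R_simps(1))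

lemma one_mult: "fin_gset G X \<Longrightarrow> a \<in> Tval T X \<Longrightarrow> \<one>\<^bsub>R X\<^esub> \<otimes>\<^bsub>R X\<^esub> a = a"
  using cring.cring_simprules(12)[OF cring_R, of X a] by (simp add: R_simps(1))

lemma mult_closed: "fin_gset G X \<Longrightarrow> a \<in> Tval T X \<Longrightarrow> b \<in> Tval T X \<Longrightarrow> a \<otimes>\<^bsub>R X\<^esub> b \<in> Tval T X"
  using cring.cring_simprules(5)[OF cring_R, of X a b] by (simp add: R_simps(1))

lemma add_closed: "fin_gset G X \<Longrightarrow> a \<in> Tval T X \<Longrightarrow> b \<in> Tval T X \<Longrightarrow> a \<oplus>\<^bsub>R X\<^esub> b \<in> Tval T X"
  using cring.cring_simprules(1)[OF cring_R, of X a b] by (simp add: R_simps(1))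

lemma diff_closed: "fin_gset G X \<Longrightarrow> a \<in> Tval T X \<Longrightarrow> b \<in> Tval T X \<Longrightarrow> a \<ominus>\<^bsub>R X\<^esub> b \<in> Tval T X"
  using cring.cring_simprules(4)[OF cring_R, of X a b] by (simp add: R_simps(1))

lemma add_diff:
  assumes "fin_gset G X" "a \<in> Tval T X" "b \<in> Tval T X"
  shows "a \<oplus>\<^bsub>R X\<^esub> (b \<ominus>\<^bsub>R X\<^esub> a) = b"
proof -
  interpret cring "R X" using assms(1) by (rule cring_R)
  have ab: "a \<in> carrier (R X)" "b \<in> carrier (R X)" using assms by (simp_all add: R_simps)
  then have "a \<oplus>\<^bsub>R X\<^esub> (b \<oplus>\<^bsub>R X\<^esub> \<ominus>\<^bsub>R X\<^esub> a) = b \<oplus>\<^bsub>R X\<^esub> (a \<oplus>\<^bsub>R X\<^esub> \<ominus>\<^bsub>R X\<^esub> a)"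
    by (intro a_lcomm) simp_all
  then show ?thesis using ab by (simp add: a_minus_def r_neg)
qed

section \<open>Intersections of ideals and generated ideals\<close>

lemma Tideal_whole: "Tideal G T (\<lambda>X\<in>{X. fin_gset G X}. Tval T X)"
proof (rule TidealI)
  fix X Y :: "('g, 'u) gset" and f a
  assume f: "gmap G X Y f" and a: "a \<in> (\<lambda>X\<in>{X. fin_gset G X}. Tval T X) X"
  have fin: "fin_gset G X" "fin_gset G Y" using f by (auto dest: gmap_source gmap_target)
  then show "\<exists>i\<in>(\<lambda>X\<in>{X. fin_gset G X}. Tval T X) Y.
      Tnm T X Y f a = Tnm T X Y f \<zero>\<^bsub>R X\<^esub> \<oplus>\<^bsub>R Y\<^esub> i"
    \<comment> \<open>The correction demanded by the norm condition is the difference of the two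
      norms.\<close>
    using a f add_diff[of Y "Tnm T X Y f \<zero>\<^bsub>R X\<^esub>" "Tnm T X Y f a"]
    by (intro bexI[of _ "Tnm T X Y f a \<ominus>\<^bsub>R Y\<^esub> Tnm T X Y f \<zero>\<^bsub>R X\<^esub>"])
      (auto simp: nm_closed zero_closed diff_closed)
next
  fix X Y :: "('g, 'u) gset" and f a
  assume f: "gmap G X Y f"
  note fin = gmap_source[OF f] gmap_target[OF f]
  show "a \<in> (\<lambda>X\<in>{X. fin_gset G X}. Tval T X) Y \<Longrightarrow>
      Tres T X Y f a \<in> (\<lambda>X\<in>{X. fin_gset G X}. Tval T X) X"
    by (simp add: fin res_closed[OF f])
  show "a \<in> (\<lambda>X\<in>{X. fin_gset G X}. Tval T X) X \<Longrightarrow>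
      Ttr T X Y f a \<in> (\<lambda>X\<in>{X. fin_gset G X}. Tval T X) Y"
    by (simp add: fin tr_closed[OF f])
qed (simp_all add: zero_closed add_closed mult_closed)

text \<open>The norm condition provides each member of \<open>J\<close> with its own correction
  term. All of them equal the difference of the norm of \<open>a\<close> and the norm of zero, so by
  cancellation one term serves every member. The other closure conditions pass to intersections
  directly.\<close>

lemma Tideal_INT:
  assumes ne: "J \<noteq> {}" and J: "\<And>I. I \<in> J \<Longrightarrow> Tideal G T I"
  shows "Tideal G T (\<lambda>X\<in>{X. fin_gset G X}. \<Inter>I\<in>J. I X)"
proof (rule TidealI)
  fix X Y :: "('g, 'u) gset" and f a
  assume f: "gmap G X Y f" and "a \<in> (\<lambda>X\<in>{X. fin_gset G X}. \<Inter>I\<in>J. I X) X"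
  moreover have fin: "fin_gset G X" "fin_gset G Y" using f by (auto dest: gmap_source gmap_target)
  ultimately have a: "a \<in> I X" if "I \<in> J" for I using that by auto
  obtain I0 where I0: "I0 \<in> J" using ne by blast
  obtain i where i: "i \<in> I0 Y" "Tnm T X Y f a = Tnm T X Y f \<zero>\<^bsub>R X\<^esub> \<oplus>\<^bsub>R Y\<^esub> i"
    using Tideal_nm[OF J[OF I0] f a[OF I0]] by blast
  have "i \<in> I Y" if I: "I \<in> J" for I
  proof -
    obtain k where k: "k \<in> I Y" "Tnm T X Y f a = Tnm T X Y f \<zero>\<^bsub>R X\<^esub> \<oplus>\<^bsub>R Y\<^esub> k"
      using Tideal_nm[OF J[OF I] f a[OF I]] by blast
    have "i = k"
      using i k Tideal_mem[OF J[OF I] fin(2)] Tideal_mem[OF J[OF I0] fin(2)]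
      by (intro cancel_left[OF fin(2) nm_closed[OF f zero_closed[OF fin(1)]], of i k]) simp_all
    with k show ?thesis by simp
  qed
  then show "\<exists>i\<in>(\<lambda>X\<in>{X. fin_gset G X}. \<Inter>I\<in>J. I X) Y.
      Tnm T X Y f a = Tnm T X Y f \<zero>\<^bsub>R X\<^esub> \<oplus>\<^bsub>R Y\<^esub> i"
    using i fin by auto
next
  obtain I0 where I0: "I0 \<in> J" using ne by blast
  show "a \<in> Tval T X" if "fin_gset G X" "a \<in> (\<lambda>X\<in>{X. fin_gset G X}. \<Inter>I\<in>J. I X) X" for X a
    using Tideal_mem[OF J[OF I0]] that I0 by auto
next
  fix X Y :: "('g, 'u) gset" and f a
  assume f: "gmap G X Y f"
  note fin = gmap_source[OF f] gmap_target[OF f]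
  show "a \<in> (\<lambda>X\<in>{X. fin_gset G X}. \<Inter>I\<in>J. I X) Y \<Longrightarrow>
      Tres T X Y f a \<in> (\<lambda>X\<in>{X. fin_gset G X}. \<Inter>I\<in>J. I X) X"
    by (simp add: fin Tideal_res[OF J f])
  show "a \<in> (\<lambda>X\<in>{X. fin_gset G X}. \<Inter>I\<in>J. I X) X \<Longrightarrow>
      Ttr T X Y f a \<in> (\<lambda>X\<in>{X. fin_gset G X}. \<Inter>I\<in>J. I X) Y"
    by (simp add: fin Tideal_tr[OF J f])
qed (simp_all add: Tideal_zero[OF J] Tideal_add[OF J] Tideal_mult[OF J])

lemma principal_eq:
  "principal G T A a = (\<lambda>X\<in>{X. fin_gset G X}. \<Inter>I\<in>{I. Tideal G T I \<and> a \<in> I A}. I X)"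
  by (auto simp: principal_def fun_eq_iff)

text \<open>The whole functor is an ideal containing \<open>a\<close>, so the intersection runs over
  a nonempty family.\<close>

lemma Tideal_principal:
  assumes "fin_gset G A" "a \<in> Tval T A"
  shows "Tideal G T (principal G T A a)"
  unfolding principal_eq using assms Tideal_whole by (intro Tideal_INT) auto

lemma principal_self: "fin_gset G A \<Longrightarrow> a \<in> principal G T A a A"
  by (simp add: principal_eq)

lemma principal_least:
  "Tideal G T I \<Longrightarrow> a \<in> I A \<Longrightarrow> fin_gset G X \<Longrightarrow> x \<in> principal G T A a X \<Longrightarrow> x \<in> I X"
  by (auto simp: principal_eq)

section \<open>Reduction to orbits\<close>

lemma Tval_eq_zero:
  assumes "fin_gset G X" "pts X = {}" "a \<in> Tval T X"
  shows "a = \<zero>\<^bsub>R X\<^esub>"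
  using mul.ex1_empty[OF assms(1,2)] assms(3) zero_closed[OF assms(1)] by auto

text \<open>This is \<open>add.dn_bicoproduct\<close> for the identity map of \<open>X\<close>: an
  element is the sum of the transfers of its components.\<close>

lemma bicoproduct_decomposition:
  assumes "bicoproduct G A B X i j" "a \<in> Tval T X"
  shows "a = Ttr T A X i (Tres T A X i a) \<oplus>\<^bsub>R X\<^esub> Ttr T B X j (Tres T B X j a)"
proof -
  note g = bicoproduct_gmap[OF assms(1)]
  note X = gmap_target[OF g(1)]
  show ?thesis
    using add.dn_bicoproduct[OF assms(1) gmap_id[OF X] assms(2)]
    by (simp add: gmap_compose_id[OF g(1)] gmap_compose_id[OF g(2)] add.dn_id X assms(2) R_simps(3))
qed

text \<open>Primality tests only elements over transitive G-sets, whereas containment of ideals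
  concerns all of them. The gap closes by splitting off one orbit at a time: restrictions stay in
  \<open>I\<close>, lie in \<open>P\<close> on the pieces, and transfers and sums lead back into
  \<open>P\<close> over \<open>X\<close>. The induction starts at the empty G-set, where the only
  element is zero.\<close>

lemma subfamily_transitiveI:
  assumes I: "Tideal G T I" and P: "Tideal G T P"
    and sub: "\<And>X. transitive_gset G X \<Longrightarrow> I X \<subseteq> P X"
  shows "subfamily G I P"
  unfolding subfamily_def
proof (intro allI impI)
  fix X :: "('g, 'u) gset"
  assume "fin_gset G X"
  then show "I X \<subseteq> P X"
  proof (induction "card (pts X)" arbitrary: X rule: less_induct)
    case less
    note X = less.prems
    show ?case
    proof (cases "pts X = {}")
      case True
      then show ?thesis
        using Tval_eq_zero[OF X True] Tideal_mem[OF I X] Tideal_zero[OF P X] by auto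
    next
      case False
      obtain A B :: "('g, 'u) gset" and i j where AB: "bicoproduct G A B X i j" "transitive_gset G A"
        "card (pts B) < card (pts X)"
        by (rule orbit_decomposition[OF X False]) (rule that)
      note g = bicoproduct_gmap[OF AB(1)]
      have B: "I B \<subseteq> P B" using less.hyps[OF AB(3)] gmap_source[OF g(2)] .
      show ?thesis
      proof
        fix a assume a: "a \<in> I X"
        have "Ttr T A X i (Tres T A X i a) \<in> P X" "Ttr T B X j (Tres T B X j a) \<in> P X"
          using Tideal_tr[OF P g(1)] Tideal_tr[OF P g(2)] Tideal_res[OF I g(1) a]
            Tideal_res[OF I g(2) a] sub[OF AB(2)] B by auto
        then show "a \<in> P X"
          using bicoproduct_decomposition[OF AB(1) Tideal_mem[OF I X a]] Tideal_add[OF P X] by metis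
      qed
    qed
  qed
qed

lemma Tprod_mem_left_right:
  assumes I: "Tideal G T I" and J: "Tideal G T J" and "fin_gset G X" "x \<in> Tprod G T I J X"
  shows "x \<in> I X" "x \<in> J X"
proof -
  obtain A p a b where x: "gmap G A X p" "a \<in> I A" "b \<in> J A" "x = Ttr T A X p (a \<otimes>\<^bsub>R A\<^esub> b)"
    using assms(3,4) by (auto simp: Tprod_def)
  note A = gmap_source[OF x(1)]
  interpret cring "R A" using A by (rule cring_R)
  have "a \<otimes>\<^bsub>R A\<^esub> b = b \<otimes>\<^bsub>R A\<^esub> a"
    using Tideal_mem[OF I A x(2)] Tideal_mem[OF J A x(3)] by (simp add: m_comm R_simps(1))
  then show "x \<in> I X" "x \<in> J X"
    using Tideal_tr[OF I x(1) Tideal_mult[OF I A x(2) Tideal_mem[OF J A x(3)]]]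
      Tideal_tr[OF J x(1) Tideal_mult[OF J A x(3) Tideal_mem[OF I A x(2)]]] x(4) by auto
qed

text \<open>If both containments failed, witnesses \<open>a\<close> and \<open>b\<close> could be
  taken over orbits. The product of the ideals they generate lies in both \<open>I\<close> and
  \<open>J\<close>, hence in \<open>P\<close>, against primality.\<close>

lemma Tprime_Int:
  assumes P: "Tprime G T P" and I: "Tideal G T I" and J: "Tideal G T J"
    and sub: "subfamily G (\<lambda>X\<in>{X. fin_gset G X}. I X \<inter> J X) P"
  shows "subfamily G I P \<or> subfamily G J P"
proof (rule ccontr)
  assume neg: "\<not> (subfamily G I P \<or> subfamily G J P)"
  have PI: "Tideal G T P" using P by (simp add: Tprime_def)
  obtain X a where a: "transitive_gset G X" "a \<in> I X" "a \<notin> P X"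
    using neg subfamily_transitiveI[OF I PI] by blast
  obtain Y b where b: "transitive_gset G Y" "b \<in> J Y" "b \<notin> P Y"
    using neg subfamily_transitiveI[OF J PI] by blast
  note X = fin_gset_transitive[OF a(1)] and Y = fin_gset_transitive[OF b(1)]
  note aT = Tideal_mem[OF I X a(2)] and bT = Tideal_mem[OF J Y b(2)]
  have "subfamily G (Tprod G T (principal G T X a) (principal G T Y b)) P"
    unfolding subfamily_def
  proof (intro allI impI subsetI)
    fix Z x assume Z: "fin_gset G Z" and x: "x \<in> Tprod G T (principal G T X a) (principal G T Y b) Z"
    note m = Tprod_mem_left_right[OF Tideal_principal[OF X aT] Tideal_principal[OF Y bT] Z x]
    have "x \<in> I Z \<inter> J Z"
      using principal_least[OF I a(2) Z m(1)] principal_least[OF J b(2) Z m(2)] by simp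
    then show "x \<in> P Z" using sub Z by (auto simp: subfamily_def)
  qed
  then show False
    using P a b aT bT by (auto simp: Tprime_def)
qed

section \<open>The topology of the spectrum\<close>

lemma openin_spec_topology:
  "openin (spec_topology G T) U \<longleftrightarrow> (\<exists>I. Tideal G T I \<and> U = Spec G T - Vset G T I)"
proof -
  let ?L = "\<lambda>U. \<exists>I. Tideal G T I \<and> U = Spec G T - Vset G T I"
  have "istopology ?L"
    unfolding istopology_def
  proof (intro conjI allI impI)
    fix U U' assume "?L U" "?L U'"
    then obtain I J where I: "Tideal G T I" "U = Spec G T - Vset G T I"
      and J: "Tideal G T J" "U' = Spec G T - Vset G T J" by blast
    let ?K = "\<lambda>X\<in>{X. fin_gset G X}. I X \<inter> J X"
    have "Tideal G T (\<lambda>X\<in>{X. fin_gset G X}. \<Inter>I\<in>{I, J}. I X)"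
      by (rule Tideal_INT) (use I J in auto)
    then have "Tideal G T ?K" by simp
    moreover have "P \<in> Vset G T ?K \<longleftrightarrow> P \<in> Vset G T I \<or> P \<in> Vset G T J" if "P \<in> Spec G T" for P
      using that Tprime_Int[of P I J] I J unfolding Vset_def Spec_def
      by (auto simp: subfamily_def)
    ultimately show "?L (U \<inter> U')"
      by (intro exI[of _ ?K]) (auto simp: I J)
  next
    fix \<U> assume \<U>: "\<forall>U\<in>\<U>. ?L U"
    \<comment> \<open>Collecting every ideal whose open set occurs in \<U> avoids choosing one ideal
      for each member.\<close>
    define \<I> where "\<I> = {I. Tideal G T I \<and> Spec G T - Vset G T I \<in> \<U>}"
    \<comment> \<open>The union of the open sets belongs to the sum of the ideals, obtained here as
      the least ideal containing all of \<I>. The whole functor is such an ideal, so the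
      intersection \<open>?J\<close> is one as well.\<close>
    define \<K> where "\<K> = {K. Tideal G T K \<and> (\<forall>I\<in>\<I>. subfamily G I K)}"
    let ?J = "\<lambda>X\<in>{X. fin_gset G X}. \<Inter>K\<in>\<K>. K X"
    have "(\<lambda>X\<in>{X. fin_gset G X}. Tval T X) \<in> \<K>"
      using Tideal_whole Tideal_mem by (auto simp: \<K>_def \<I>_def subfamily_def)
    then have "Tideal G T ?J"
      by (intro Tideal_INT) (auto simp: \<K>_def)
    moreover have "P \<in> Vset G T ?J \<longleftrightarrow> (\<forall>I\<in>\<I>. P \<in> Vset G T I)" if P: "P \<in> Spec G T" for P
    proof
      assume "P \<in> Vset G T ?J"
      then have "?J X \<subseteq> P X" if "fin_gset G X" for X
        using that by (simp add: Vset_def subfamily_def)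
      moreover have "I X \<subseteq> ?J X" if "I \<in> \<I>" "fin_gset G X" for I X
        using that by (auto simp: \<K>_def subfamily_def)
      ultimately show "\<forall>I\<in>\<I>. P \<in> Vset G T I"
        using P unfolding Vset_def subfamily_def by blast
    next
      assume "\<forall>I\<in>\<I>. P \<in> Vset G T I"
      then have "P \<in> \<K>" using P by (auto simp: Vset_def \<K>_def Spec_def Tprime_def)
      then have "?J X \<subseteq> P X" if "fin_gset G X" for X
        using that by auto
      then show "P \<in> Vset G T ?J" using P unfolding Vset_def subfamily_def by blast
    qed
    moreover have "\<Union>\<U> = (\<Union>I\<in>\<I>. Spec G T - Vset G T I)"
    proof (intro equalityI subsetI)
      fix P assume "P \<in> \<Union>\<U>"
      then obtain U where U: "U \<in> \<U>" "P \<in> U" by blast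
      then obtain I where "Tideal G T I" "U = Spec G T - Vset G T I" using \<U> by blast
      with U show "P \<in> (\<Union>I\<in>\<I>. Spec G T - Vset G T I)" by (auto simp: \<I>_def)
    qed (auto simp: \<I>_def)
    ultimately show "?L (\<Union>\<U>)"
      by (intro exI[of _ ?J]) auto
  qed
  then show ?thesis by (simp add: spec_topology_def topology_inverse')
qed

lemma topspace_spec_topology: "topspace (spec_topology G T) = Spec G T"
proof
  show "topspace (spec_topology G T) \<subseteq> Spec G T"
    unfolding topspace_def by (auto simp: openin_spec_topology)
  let ?W = "\<lambda>X\<in>{X. fin_gset G X}. Tval T X"
  \<comment> \<open>Prime ideals are proper, so V of the whole functor is empty and the full
    spectrum is open.\<close>
  have "P \<notin> Vset G T ?W" for P
  proof
    assume "P \<in> Vset G T ?W"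
    then have P: "Tprime G T P" and sub: "subfamily G ?W P" by (auto simp: Vset_def Spec_def)
    then obtain X where X: "fin_gset G X" "P X \<noteq> Tval T X" by (auto simp: Tprime_def)
    moreover have "P X \<subseteq> Tval T X" using P Tideal_mem[of P X] X by (auto simp: Tprime_def)
    ultimately show False using sub by (auto simp: subfamily_def)
  qed
  then have "Spec G T = Spec G T - Vset G T ?W" by blast
  then have "openin (spec_topology G T) (Spec G T)"
    using Tideal_whole openin_spec_topology by blast
  then show "Spec G T \<subseteq> topspace (spec_topology G T)" by (rule openin_subset)
qed

end


section \<open>Morphisms\<close>

locale tambara_hom = T: tambara G T + S: tambara G S
  for G :: "('g, 'm) monoid_scheme" (structure)
    and T :: "('g, 'u::infinite, 't) tambara" and S :: "('g, 'u, 's) tambara" +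
  fixes \<phi> :: "('g, 'u) gset \<Rightarrow> 't \<Rightarrow> 's"
  assumes morphism: "tambara_morphism G T S \<phi>"
begin

section \<open>The morphism as a family of ring homomorphisms\<close>

lemma ring_hom_cring_\<phi>: "fin_gset G X \<Longrightarrow> ring_hom_cring (T.R X) (S.R X) (\<phi> X)"
  using morphism T.cring_R S.cring_R
  by (simp add: tambara_morphism_def ring_hom_cring_def ring_hom_cring_axioms_def)

lemma
  assumes "fin_gset G X"
  shows \<phi>_closed: "a \<in> Tval T X \<Longrightarrow> \<phi> X a \<in> Tval S X"
    and \<phi>_mult: "a \<in> Tval T X \<Longrightarrow> b \<in> Tval T X \<Longrightarrow> \<phi> X (a \<otimes>\<^bsub>T.R X\<^esub> b) = \<phi> X a \<otimes>\<^bsub>S.R X\<^esub> \<phi> X b"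
    and \<phi>_add: "a \<in> Tval T X \<Longrightarrow> b \<in> Tval T X \<Longrightarrow> \<phi> X (a \<oplus>\<^bsub>T.R X\<^esub> b) = \<phi> X a \<oplus>\<^bsub>S.R X\<^esub> \<phi> X b"
    and \<phi>_diff: "a \<in> Tval T X \<Longrightarrow> b \<in> Tval T X \<Longrightarrow> \<phi> X (a \<ominus>\<^bsub>T.R X\<^esub> b) = \<phi> X a \<ominus>\<^bsub>S.R X\<^esub> \<phi> X b"
    and \<phi>_zero: "\<phi> X \<zero>\<^bsub>T.R X\<^esub> = \<zero>\<^bsub>S.R X\<^esub>"
    and \<phi>_one: "\<phi> X \<one>\<^bsub>T.R X\<^esub> = \<one>\<^bsub>S.R X\<^esub>"
proof -
  interpret ring_hom_cring "T.R X" "S.R X" "\<phi> X" using assms by (rule ring_hom_cring_\<phi>)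
  show "a \<in> Tval T X \<Longrightarrow> \<phi> X a \<in> Tval S X" using hom_closed by (simp add: T.R_simps(1) S.R_simps(1))
  show "a \<in> Tval T X \<Longrightarrow> b \<in> Tval T X \<Longrightarrow> \<phi> X (a \<otimes>\<^bsub>T.R X\<^esub> b) = \<phi> X a \<otimes>\<^bsub>S.R X\<^esub> \<phi> X b"
    by (simp add: T.R_simps(1))
  show "a \<in> Tval T X \<Longrightarrow> b \<in> Tval T X \<Longrightarrow> \<phi> X (a \<oplus>\<^bsub>T.R X\<^esub> b) = \<phi> X a \<oplus>\<^bsub>S.R X\<^esub> \<phi> X b"
    by (simp add: T.R_simps(1))
  show "a \<in> Tval T X \<Longrightarrow> b \<in> Tval T X \<Longrightarrow> \<phi> X (a \<ominus>\<^bsub>T.R X\<^esub> b) = \<phi> X a \<ominus>\<^bsub>S.R X\<^esub> \<phi> X b"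
  proof -
    assume "a \<in> Tval T X" "b \<in> Tval T X"
    then have "a \<in> carrier (T.R X)" "b \<in> carrier (T.R X)" by (simp_all add: T.R_simps)
    then show ?thesis by (simp add: a_minus_def)
  qed
  show "\<phi> X \<zero>\<^bsub>T.R X\<^esub> = \<zero>\<^bsub>S.R X\<^esub>" "\<phi> X \<one>\<^bsub>T.R X\<^esub> = \<one>\<^bsub>S.R X\<^esub>" by simp_all
qed

lemma
  assumes "gmap G X Y f"
  shows \<phi>_res: "c \<in> Tval T Y \<Longrightarrow> \<phi> X (Tres T X Y f c) = Tres S X Y f (\<phi> Y c)"
    and \<phi>_tr: "a \<in> Tval T X \<Longrightarrow> \<phi> Y (Ttr T X Y f a) = Ttr S X Y f (\<phi> X a)"
    and \<phi>_nm: "a \<in> Tval T X \<Longrightarrow> \<phi> Y (Tnm T X Y f a) = Tnm S X Y f (\<phi> X a)"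
  using morphism assms by (simp_all add: tambara_morphism_def)

section \<open>Inverse images and images of ideals\<close>

lemma mem_Tpreimage_iff:
  "fin_gset G X \<Longrightarrow> c \<in> Tpreimage G T \<phi> J X \<longleftrightarrow> c \<in> Tval T X \<and> \<phi> X c \<in> J X"
  by (simp add: Tpreimage_def)

text \<open>Only norms need an argument. The difference \<open>i\<close> of the norms of
  \<open>a\<close> and of zero is formed in \<open>T\<close>, and cancellation in \<open>S\<close>
  identifies its image with the correction term \<open>j\<close> that \<open>J\<close>
  provides.\<close>

lemma Tideal_Tpreimage:
  assumes J: "Tideal G S J"
  shows "Tideal G T (Tpreimage G T \<phi> J)"
proof (rule T.TidealI)
  fix X Y :: "('g, 'u) gset" and f a
  assume f: "gmap G X Y f" and "a \<in> Tpreimage G T \<phi> J X"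
  note X = gmap_source[OF f] and Y = gmap_target[OF f]
  have a: "a \<in> Tval T X" "\<phi> X a \<in> J X"
    using \<open>a \<in> Tpreimage G T \<phi> J X\<close> by (simp_all add: mem_Tpreimage_iff X)
  note nT = T.nm_closed[OF f a(1)] T.nm_closed[OF f T.zero_closed[OF X]]
  obtain j where j: "j \<in> J Y" "Tnm S X Y f (\<phi> X a) = Tnm S X Y f \<zero>\<^bsub>S.R X\<^esub> \<oplus>\<^bsub>S.R Y\<^esub> j"
    using S.Tideal_nm[OF J f a(2)] by blast
  define i where "i = Tnm T X Y f a \<ominus>\<^bsub>T.R Y\<^esub> Tnm T X Y f \<zero>\<^bsub>T.R X\<^esub>"
  have iT: "i \<in> Tval T Y" using nT by (simp add: i_def T.diff_closed Y)
  have eq: "Tnm T X Y f a = Tnm T X Y f \<zero>\<^bsub>T.R X\<^esub> \<oplus>\<^bsub>T.R Y\<^esub> i"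
    using nT by (simp add: i_def T.add_diff Y)
  have "\<phi> Y i = j"
  proof (rule S.cancel_left[OF Y])
    show "Tnm S X Y f \<zero>\<^bsub>S.R X\<^esub> \<oplus>\<^bsub>S.R Y\<^esub> \<phi> Y i = Tnm S X Y f \<zero>\<^bsub>S.R X\<^esub> \<oplus>\<^bsub>S.R Y\<^esub> j"
      using arg_cong[OF eq, of "\<phi> Y"] nT iT
      by (simp add: \<phi>_add Y \<phi>_nm[OF f] a T.zero_closed X \<phi>_zero j)
  qed (use nT iT j in \<open>auto simp: S.nm_closed[OF f] S.zero_closed X \<phi>_closed Y S.Tideal_mem[OF J Y]\<close>)
  with j iT eq show "\<exists>i\<in>Tpreimage G T \<phi> J Y.
      Tnm T X Y f a = Tnm T X Y f \<zero>\<^bsub>T.R X\<^esub> \<oplus>\<^bsub>T.R Y\<^esub> i"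
    by (intro bexI[of _ i]) (auto simp: mem_Tpreimage_iff Y)
next
  show "Tpreimage G T \<phi> J \<in> extensional {X. fin_gset G X}" by (simp add: Tpreimage_def)
next
  fix X Y :: "('g, 'u) gset" and f a
  assume f: "gmap G X Y f"
  note X = gmap_source[OF f] and Y = gmap_target[OF f]
  show "a \<in> Tpreimage G T \<phi> J Y \<Longrightarrow> Tres T X Y f a \<in> Tpreimage G T \<phi> J X"
    by (simp add: mem_Tpreimage_iff X Y T.res_closed[OF f] \<phi>_res[OF f] S.Tideal_res[OF J f])
  show "a \<in> Tpreimage G T \<phi> J X \<Longrightarrow> Ttr T X Y f a \<in> Tpreimage G T \<phi> J Y"
    by (simp add: mem_Tpreimage_iff X Y T.tr_closed[OF f] \<phi>_tr[OF f] S.Tideal_tr[OF J f])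
qed (auto simp: mem_Tpreimage_iff T.zero_closed T.add_closed T.mult_closed \<phi>_zero \<phi>_add \<phi>_mult
    S.Tideal_zero[OF J] S.Tideal_add[OF J] S.Tideal_mult[OF J] \<phi>_closed)

lemma mem_Timage_iff: "fin_gset G X \<Longrightarrow> x \<in> Timage G \<phi> I X \<longleftrightarrow> (\<exists>a\<in>I X. x = \<phi> X a)"
  by (auto simp: Timage_def)

text \<open>Surjectivity enters through closure under multiplication by arbitrary elements of
  \<open>S\<close>; the other conditions are carried over by \<phi>.\<close>

lemma Tideal_Timage:
  assumes surj: "surjective_morphism G T S \<phi>" and I: "Tideal G T I"
  shows "Tideal G S (Timage G \<phi> I)"
proof (rule S.TidealI)
  show "Timage G \<phi> I \<in> extensional {X. fin_gset G X}" by (simp add: Timage_def)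
  fix X :: "('g, 'u) gset" and x y
  assume X: "fin_gset G X"
  note I_simps = mem_Timage_iff[OF X] T.Tideal_mem[OF I X]
  show "\<zero>\<^bsub>S.R X\<^esub> \<in> Timage G \<phi> I X"
    using T.Tideal_zero[OF I X] \<phi>_zero[OF X] unfolding mem_Timage_iff[OF X] by metis
  assume x: "x \<in> Timage G \<phi> I X"
  then obtain a where a: "a \<in> I X" "x = \<phi> X a" by (auto simp: I_simps)
  show "x \<in> Tval S X" using a by (simp add: \<phi>_closed X I_simps)
  show "x \<oplus>\<^bsub>S.R X\<^esub> y \<in> Timage G \<phi> I X" if "y \<in> Timage G \<phi> I X"
  proof -
    obtain b where b: "b \<in> I X" "y = \<phi> X b" using \<open>y \<in> Timage G \<phi> I X\<close> by (auto simp: I_simps)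
    show ?thesis
      unfolding mem_Timage_iff[OF X] using a b
      by (intro bexI[of _ "a \<oplus>\<^bsub>T.R X\<^esub> b"]) (simp_all add: \<phi>_add X I_simps T.Tideal_add[OF I X])
  qed
  show "y \<otimes>\<^bsub>S.R X\<^esub> x \<in> Timage G \<phi> I X" if "y \<in> Tval S X"
  proof -
    obtain b where b: "b \<in> Tval T X" "y = \<phi> X b"
      using \<open>y \<in> Tval S X\<close> surj X by (auto simp: surjective_morphism_def)
    show ?thesis
      unfolding mem_Timage_iff[OF X] using a b
      by (intro bexI[of _ "b \<otimes>\<^bsub>T.R X\<^esub> a"]) (simp_all add: \<phi>_mult X I_simps T.Tideal_mult[OF I X])
  qed
next
  fix X Y :: "('g, 'u) gset" and f x
  assume f: "gmap G X Y f"
  note X = gmap_source[OF f] and Y = gmap_target[OF f]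
  show "Tres S X Y f x \<in> Timage G \<phi> I X" if "x \<in> Timage G \<phi> I Y"
  proof -
    obtain a where a: "a \<in> I Y" "x = \<phi> Y a"
      using \<open>x \<in> Timage G \<phi> I Y\<close> by (auto simp: mem_Timage_iff[OF Y])
    show ?thesis
      using \<phi>_res[OF f T.Tideal_mem[OF I Y a(1)]] T.Tideal_res[OF I f a(1)]
      unfolding mem_Timage_iff[OF X] a(2) by metis
  qed
  assume "x \<in> Timage G \<phi> I X"
  then obtain a where a: "a \<in> I X" "x = \<phi> X a" by (auto simp: mem_Timage_iff[OF X])
  note aT = T.Tideal_mem[OF I X a(1)]
  show "Ttr S X Y f x \<in> Timage G \<phi> I Y"
    using \<phi>_tr[OF f aT] T.Tideal_tr[OF I f a(1)] unfolding mem_Timage_iff[OF Y] a(2) by metis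
  obtain i where i: "i \<in> I Y" "Tnm T X Y f a = Tnm T X Y f \<zero>\<^bsub>T.R X\<^esub> \<oplus>\<^bsub>T.R Y\<^esub> i"
    using T.Tideal_nm[OF I f a(1)] by blast
  have "Tnm S X Y f x = Tnm S X Y f \<zero>\<^bsub>S.R X\<^esub> \<oplus>\<^bsub>S.R Y\<^esub> \<phi> Y i"
    using arg_cong[OF i(2), of "\<phi> Y"] T.Tideal_mem[OF I Y i(1)]
    by (simp add: \<phi>_add Y \<phi>_nm[OF f] aT T.zero_closed X \<phi>_zero a(2) T.nm_closed[OF f])
  with i(1) show "\<exists>i\<in>Timage G \<phi> I Y. Tnm S X Y f x = Tnm S X Y f \<zero>\<^bsub>S.R X\<^esub> \<oplus>\<^bsub>S.R Y\<^esub> i"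
    by (intro bexI[of _ "\<phi> Y i"]) (auto simp: mem_Timage_iff[OF Y])
qed

section \<open>Extension of ideals along \<phi>\<close>

definition Textension :: "(('g, 'u) gset \<Rightarrow> 't set) \<Rightarrow> ('g, 'u) gset \<Rightarrow> 's set" where
  "Textension I = (\<lambda>X\<in>{X. fin_gset G X}.
     {Ttr S C X u (c \<otimes>\<^bsub>S.R C\<^esub> \<phi> C a) | C u c a. gmap G C X u \<and> c \<in> Tval S C \<and> a \<in> I C})"

lemma TextensionI:
  "gmap G C X u \<Longrightarrow> c \<in> Tval S C \<Longrightarrow> a \<in> I C \<Longrightarrow> x = Ttr S C X u (c \<otimes>\<^bsub>S.R C\<^esub> \<phi> C a) \<Longrightarrow> x \<in> Textension I X"
  unfolding Textension_def using gmap_target[of G C X u] by auto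

lemma TextensionE:
  assumes "fin_gset G X" "x \<in> Textension I X"
  obtains C u c a where "gmap G C X u" "c \<in> Tval S C" "a \<in> I C"
    "x = Ttr S C X u (c \<otimes>\<^bsub>S.R C\<^esub> \<phi> C a)"
  using assms by (auto simp: Textension_def)

text \<open>Single transfers suffice in the definition of the extension because two terms merge over
  the coproduct \<open>Z\<close> of their sources. The coefficients glue to \<open>e\<close>, the
  ideal elements to \<open>k\<close>, and \<open>k\<close> lies in \<open>I\<close> as the sum of
  the transfers of \<open>a\<close> and \<open>b\<close>.\<close>

lemma Textension_add:
  assumes I: "Tideal G T I" and X: "fin_gset G X" and x: "x \<in> Textension I X" and y: "y \<in> Textension I X"
  shows "x \<oplus>\<^bsub>S.R X\<^esub> y \<in> Textension I X"
proof -
  obtain C u c a where x: "gmap G C X u" "c \<in> Tval S C" "a \<in> I C"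
    "x = Ttr S C X u (c \<otimes>\<^bsub>S.R C\<^esub> \<phi> C a)" using TextensionE[OF X x] .
  obtain D v d b where y: "gmap G D X v" "d \<in> Tval S D" "b \<in> I D"
    "y = Ttr S D X v (d \<otimes>\<^bsub>S.R D\<^esub> \<phi> D b)" using TextensionE[OF X y] .
  note C = gmap_source[OF x(1)] and D = gmap_source[OF y(1)]
  note aT = T.Tideal_mem[OF I C x(3)] and bT = T.Tideal_mem[OF I D y(3)]
  obtain Z :: "('g, 'u) gset" and i j where Z: "bicoproduct G C D Z i j"
    using ex_bicoproduct[OF C D] .
  note g = bicoproduct_gmap[OF Z] and ZZ = gmap_target[OF bicoproduct_gmap(1)[OF Z]]
  obtain h where h: "gmap G Z X h" "compose (pts C) h i = u" "compose (pts D) h j = v"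
    using bicoproduct_copair[OF Z x(1) y(1)] by metis
  obtain e where e: "e \<in> Tval S Z" "Tres S C Z i e = c" "Tres S D Z j e = d"
    using S.mul.up_bicoproduct_ex1[OF Z x(2) y(2)] by blast
  obtain k where k: "k \<in> Tval T Z" "Tres T C Z i k = a" "Tres T D Z j k = b"
    using T.mul.up_bicoproduct_ex1[OF Z aT bT] by blast
  have kI: "k \<in> I Z"
    using T.bicoproduct_decomposition[OF Z k(1)] T.Tideal_add[OF I ZZ]
      T.Tideal_tr[OF I g(1) x(3)] T.Tideal_tr[OF I g(2) y(3)] by (simp add: k)
  note \<phi>k = \<phi>_closed[OF ZZ k(1)]
  have "Ttr S Z X h (e \<otimes>\<^bsub>S.R Z\<^esub> \<phi> Z k) = x \<oplus>\<^bsub>S.R X\<^esub> y"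
    using S.add.dn_bicoproduct[OF Z h(1) S.mult_closed[OF ZZ e(1) \<phi>k]]
    by (simp add: h S.res_mult[OF g(1) e(1) \<phi>k] S.res_mult[OF g(2) e(1) \<phi>k] e x(4) y(4)
        \<phi>_res[OF g(1) k(1), symmetric] \<phi>_res[OF g(2) k(1), symmetric] k S.R_simps(3))
  then show ?thesis using TextensionI[where I = I, OF h(1) e(1) kI] by simp
qed

text \<open>By Frobenius reciprocity the factor \<open>d\<close> moves under the transfer as its
  restriction, where the coefficient \<open>c\<close> absorbs it.\<close>

lemma Textension_mult:
  assumes I: "Tideal G T I" and X: "fin_gset G X" and x: "x \<in> Textension I X" and d: "d \<in> Tval S X"
  shows "d \<otimes>\<^bsub>S.R X\<^esub> x \<in> Textension I X"
proof -
  obtain C u c a where x: "gmap G C X u" "c \<in> Tval S C" "a \<in> I C"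
    "x = Ttr S C X u (c \<otimes>\<^bsub>S.R C\<^esub> \<phi> C a)" using TextensionE[OF X x] .
  note C = gmap_source[OF x(1)]
  interpret C: cring "S.R C" using C by (rule S.cring_R)
  interpret X: cring "S.R X" using X by (rule S.cring_R)
  have aS: "\<phi> C a \<in> Tval S C" using \<phi>_closed[OF C T.Tideal_mem[OF I C x(3)]] .
  note cl = S.mult_closed[OF C x(2) aS] S.res_closed[OF x(1) d]
  have "d \<otimes>\<^bsub>S.R X\<^esub> x = x \<otimes>\<^bsub>S.R X\<^esub> d"
    using d S.tr_closed[OF x(1) cl(1)] by (simp add: X.m_comm S.R_simps(1) x(4))
  also have "\<dots> = Ttr S C X u ((c \<otimes>\<^bsub>S.R C\<^esub> \<phi> C a) \<otimes>\<^bsub>S.R C\<^esub> Tres S C X u d)"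
    using S.frobenius[OF x(1) cl(1) d] by (simp add: x(4))
  also have "(c \<otimes>\<^bsub>S.R C\<^esub> \<phi> C a) \<otimes>\<^bsub>S.R C\<^esub> Tres S C X u d = (Tres S C X u d \<otimes>\<^bsub>S.R C\<^esub> c) \<otimes>\<^bsub>S.R C\<^esub> \<phi> C a"
    using cl aS x(2) by (simp add: C.m_ac S.R_simps(1))
  finally show ?thesis
    using TextensionI[where I = I, OF x(1) S.mult_closed[OF C cl(2) x(2)] x(3)] by simp
qed

text \<open>Base change replaces \<open>u\<close> by its pull-back along \<open>f\<close>;
  coefficient and ideal element are restricted to the new source.\<close>

lemma Textension_res:
  assumes I: "Tideal G T I" and f: "gmap G X Y f" and x: "x \<in> Textension I Y"
  shows "Tres S X Y f x \<in> Textension I X"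
proof -
  obtain C u c a where x: "gmap G C Y u" "c \<in> Tval S C" "a \<in> I C"
    "x = Ttr S C Y u (c \<otimes>\<^bsub>S.R C\<^esub> \<phi> C a)" using TextensionE[OF gmap_target[OF f] x] .
  note C = gmap_source[OF x(1)]
  note aT = T.Tideal_mem[OF I C x(3)]
  note aS = \<phi>_closed[OF C aT]
  obtain C' :: "('g, 'u) gset" and \<xi> u' where pb: "is_pullback G C' C X Y \<xi> u' u f"
    using ex_pullback[OF x(1) f] .
  note g = is_pullback_gmap[OF pb]
  have "Tres S X Y f x = Ttr S C' X u' (Tres S C' C \<xi> c \<otimes>\<^bsub>S.R C'\<^esub> \<phi> C' (Tres T C' C \<xi> a))"
    using S.add.base_change[OF pb S.mult_closed[OF C x(2) aS]]
    by (simp add: x(4) S.res_mult[OF g(3) x(2) aS] \<phi>_res[OF g(3) aT])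
  then show ?thesis
    using TextensionI[where I = I, OF g(4) S.res_closed[OF g(3) x(2)] T.Tideal_res[OF I g(3) x(3)]] by simp
qed

lemma Textension_tr:
  assumes I: "Tideal G T I" and f: "gmap G X Y f" and x: "x \<in> Textension I X"
  shows "Ttr S X Y f x \<in> Textension I Y"
proof -
  obtain C u c a where x: "gmap G C X u" "c \<in> Tval S C" "a \<in> I C"
    "x = Ttr S C X u (c \<otimes>\<^bsub>S.R C\<^esub> \<phi> C a)" using TextensionE[OF gmap_source[OF f] x] .
  note C = gmap_source[OF x(1)]
  note aS = \<phi>_closed[OF C T.Tideal_mem[OF I C x(3)]]
  show ?thesis
    using S.add.dn_comp[OF x(1) f S.mult_closed[OF C x(2) aS]]
    by (intro TextensionI[where I = I, OF gmap_compose[OF x(1) f] x(2,3)]) (simp add: x(4))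
qed

lemma Textension_nm:
  assumes I: "Tideal G T I" and f: "gmap G X Y f" and x: "x \<in> Textension I X"
  shows "\<exists>i\<in>Textension I Y. Tnm S X Y f x = Tnm S X Y f \<zero>\<^bsub>S.R X\<^esub> \<oplus>\<^bsub>S.R Y\<^esub> i"
proof -
  note X = gmap_source[OF f] and Y = gmap_target[OF f]
  obtain C u c a where x: "gmap G C X u" "c \<in> Tval S C" "a \<in> I C"
    "x = Ttr S C X u (c \<otimes>\<^bsub>S.R C\<^esub> \<phi> C a)" using TextensionE[OF X x] .
  note C = gmap_source[OF x(1)]
  note aT = T.Tideal_mem[OF I C x(3)]
  note aS = \<phi>_closed[OF C aT]
  obtain P Z :: "('g, 'u) gset" and \<pi> \<rho> l where ex: "is_exponential G C X Y P Z u f \<pi> \<rho> l"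
    using ex_exponential[OF x(1) f] .
  then have \<pi>: "gmap G P Y \<pi>" and \<rho>: "gmap G Z P \<rho>" and l: "gmap G Z C l"
    by (auto simp: is_exponential_def)
  note P = gmap_source[OF \<pi>] and Z = gmap_source[OF \<rho>]
  interpret P: cring "S.R P" using P by (rule S.cring_R)
  interpret Z: cring "S.R Z" using Z by (rule S.cring_R)
  let ?c = "Tnm S Z P \<rho> (Tres S Z C l c)"
  let ?z = "Tnm T Z P \<rho> \<zero>\<^bsub>T.R Z\<^esub>"
  note lc = S.res_closed[OF l x(2)] and la = T.res_closed[OF l aT]
  have c: "?c \<in> Tval S P" using S.nm_closed[OF \<rho> lc] .
  have z: "?z \<in> Tval T P" using T.nm_closed[OF \<rho> T.zero_closed[OF Z]] .
  obtain b where b: "b \<in> I P" "Tnm T Z P \<rho> (Tres T Z C l a) = ?z \<oplus>\<^bsub>T.R P\<^esub> b"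
    using T.Tideal_nm[OF I \<rho> T.Tideal_res[OF I l x(3)]] by blast
  note bT = T.Tideal_mem[OF I P b(1)]
  have \<phi>z: "\<phi> P ?z = Tnm S Z P \<rho> \<zero>\<^bsub>S.R Z\<^esub>"
    by (simp add: \<phi>_nm[OF \<rho>] T.zero_closed Z \<phi>_zero)
  have "Tnm S X Y f x = Ttr S P Y \<pi> (Tnm S Z P \<rho> (Tres S Z C l (c \<otimes>\<^bsub>S.R C\<^esub> \<phi> C a)))"
    unfolding x(4) using ex S.mult_closed[OF C x(2) aS] by (rule S.Tnm_Ttr)
  also have "Tres S Z C l (c \<otimes>\<^bsub>S.R C\<^esub> \<phi> C a) = Tres S Z C l c \<otimes>\<^bsub>S.R Z\<^esub> \<phi> Z (Tres T Z C l a)"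
    by (simp add: S.res_mult[OF l x(2) aS] \<phi>_res[OF l aT])
  also have "Tnm S Z P \<rho> \<dots> = ?c \<otimes>\<^bsub>S.R P\<^esub> \<phi> P (?z \<oplus>\<^bsub>T.R P\<^esub> b)"
    by (simp add: S.nm_mult[OF \<rho> lc \<phi>_closed[OF Z la]] \<phi>_nm[OF \<rho> la, symmetric] b(2))
  also have "\<dots> = ?c \<otimes>\<^bsub>S.R P\<^esub> Tnm S Z P \<rho> \<zero>\<^bsub>S.R Z\<^esub> \<oplus>\<^bsub>S.R P\<^esub> ?c \<otimes>\<^bsub>S.R P\<^esub> \<phi> P b"
    using c \<phi>_closed[OF P z] \<phi>_closed[OF P bT]
    by (simp add: \<phi>_add P z bT \<phi>z P.r_distr S.R_simps(1))
  \<comment> \<open>The product of norms is the norm of the product, and the latter has a factor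
    zero. Thus the coefficient disappears from the constant term.\<close>
  also have "?c \<otimes>\<^bsub>S.R P\<^esub> Tnm S Z P \<rho> \<zero>\<^bsub>S.R Z\<^esub> = Tnm S Z P \<rho> \<zero>\<^bsub>S.R Z\<^esub>"
    using S.nm_mult[OF \<rho> lc S.zero_closed[OF Z]] Z.r_null[of "Tres S Z C l c"] lc
    by (simp add: S.R_simps(1))
  also have "Ttr S P Y \<pi> (Tnm S Z P \<rho> \<zero>\<^bsub>S.R Z\<^esub> \<oplus>\<^bsub>S.R P\<^esub> ?c \<otimes>\<^bsub>S.R P\<^esub> \<phi> P b) =
      Ttr S P Y \<pi> (Tnm S Z P \<rho> \<zero>\<^bsub>S.R Z\<^esub>) \<oplus>\<^bsub>S.R Y\<^esub> Ttr S P Y \<pi> (?c \<otimes>\<^bsub>S.R P\<^esub> \<phi> P b)"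
    by (rule S.tr_add[OF \<pi> S.nm_closed[OF \<rho> S.zero_closed[OF Z]] S.mult_closed[OF P c \<phi>_closed[OF P bT]]])
  \<comment> \<open>The exponential law, now read for the element zero over \<open>C\<close>,
    recognises the remaining constant as the norm of zero along \<open>f\<close>.\<close>
  also have "Ttr S P Y \<pi> (Tnm S Z P \<rho> \<zero>\<^bsub>S.R Z\<^esub>) = Tnm S X Y f \<zero>\<^bsub>S.R X\<^esub>"
    using S.Tnm_Ttr[OF ex S.zero_closed[OF C]] by (simp add: S.res_zero[OF l] S.tr_zero[OF x(1)])
  finally show ?thesis
    using TextensionI[where I = I, OF \<pi> c b(1) refl] by blast
qed

lemma Textension_memI:
  assumes I: "Tideal G T I" and X: "fin_gset G X" and a: "a \<in> I X"
  shows "\<phi> X a \<in> Textension I X"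
proof (rule TextensionI[where I = I, OF gmap_id[OF X] S.one_closed[OF X] a])
  note aS = \<phi>_closed[OF X T.Tideal_mem[OF I X a]]
  show "\<phi> X a = Ttr S X X (\<lambda>x\<in>pts X. x) (\<one>\<^bsub>S.R X\<^esub> \<otimes>\<^bsub>S.R X\<^esub> \<phi> X a)"
    by (simp add: S.one_mult[OF X aS] S.add.dn_id[OF X aS])
qed

lemma Tideal_Textension:
  assumes I: "Tideal G T I"
  shows "Tideal G S (Textension I)"
proof (rule S.TidealI)
  show "Textension I \<in> extensional {X. fin_gset G X}" by (simp add: Textension_def)
  fix X :: "('g, 'u) gset" and x
  assume X: "fin_gset G X"
  show "\<zero>\<^bsub>S.R X\<^esub> \<in> Textension I X"
    using Textension_memI[OF I X T.Tideal_zero[OF I X]] by (simp add: \<phi>_zero X)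
  assume x: "x \<in> Textension I X"
  obtain C u c a where x: "gmap G C X u" "c \<in> Tval S C" "a \<in> I C"
    "x = Ttr S C X u (c \<otimes>\<^bsub>S.R C\<^esub> \<phi> C a)" using TextensionE[OF X x] .
  note C = gmap_source[OF x(1)]
  show "x \<in> Tval S X"
    unfolding x(4)
    using S.tr_closed[OF x(1) S.mult_closed[OF C x(2) \<phi>_closed[OF C T.Tideal_mem[OF I C x(3)]]]] .
qed (use I Textension_add Textension_mult Textension_res Textension_tr Textension_nm in auto)

text \<open>With \<open>Textension_memI\<close> this makes the extension the smallest ideal of
  \<open>S\<close> containing the image of \<open>I\<close>, which is the form used for
  continuity.\<close>

lemma Textension_least:
  assumes I: "Tideal G T I" and J: "Tideal G S J" and X: "fin_gset G X"
    and sub: "\<And>X a. fin_gset G X \<Longrightarrow> a \<in> I X \<Longrightarrow> \<phi> X a \<in> J X" and x: "x \<in> Textension I X"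
  shows "x \<in> J X"
proof -
  obtain C u c a where x: "gmap G C X u" "c \<in> Tval S C" "a \<in> I C"
    "x = Ttr S C X u (c \<otimes>\<^bsub>S.R C\<^esub> \<phi> C a)" using TextensionE[OF X x] .
  note C = gmap_source[OF x(1)]
  show ?thesis
    unfolding x(4) using S.Tideal_tr[OF J x(1) S.Tideal_mult[OF J C sub[OF C x(3)] x(2)]] .
qed

text \<open>Frobenius reciprocity is applied twice, once for each factor. Products of transfers
  become transfers of multiples of \<phi> applied to a product of elements of \<open>I\<close> and
  \<open>K\<close> over a common G-set, which \<open>sub\<close> places in \<open>Q\<close>.\<close>

lemma Textension_mult_Textension:
  assumes I: "Tideal G T I" and K: "Tideal G T K" and Q: "Tideal G S Q"
    and sub: "\<And>X a b. fin_gset G X \<Longrightarrow> a \<in> I X \<Longrightarrow> b \<in> K X \<Longrightarrow> \<phi> X (a \<otimes>\<^bsub>T.R X\<^esub> b) \<in> Q X"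
    and X: "fin_gset G X" and x: "x \<in> Textension I X" and y: "y \<in> Textension K X"
  shows "x \<otimes>\<^bsub>S.R X\<^esub> y \<in> Q X"
proof -
  \<comment> \<open>The case where the first factor is \<phi> of an element of \<open>I\<close>,
    over arbitrary \<open>X\<close>: it is needed later over the source \<open>C\<close> of the
    transfer defining \<open>x\<close>.\<close>
  have 1: "\<phi> X a \<otimes>\<^bsub>S.R X\<^esub> y \<in> Q X" if X: "fin_gset G X" and a: "a \<in> I X" and y: "y \<in> Textension K X" for X a y
  proof -
    obtain D v d b where y: "gmap G D X v" "d \<in> Tval S D" "b \<in> K D"
      "y = Ttr S D X v (d \<otimes>\<^bsub>S.R D\<^esub> \<phi> D b)" using TextensionE[OF X y] .
    note D = gmap_source[OF y(1)]
    interpret D: cring "S.R D" using D by (rule S.cring_R)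
    interpret X: cring "S.R X" using X by (rule S.cring_R)
    note aT = T.Tideal_mem[OF I X a] and bT = T.Tideal_mem[OF K D y(3)]
    note va = T.Tideal_res[OF I y(1) a]
    note vT = T.Tideal_mem[OF I D va]
    note aS = \<phi>_closed[OF X aT] and bS = \<phi>_closed[OF D bT] and vS = \<phi>_closed[OF D vT]
    note db = S.mult_closed[OF D y(2) bS]
    have "\<phi> X a \<otimes>\<^bsub>S.R X\<^esub> y = y \<otimes>\<^bsub>S.R X\<^esub> \<phi> X a"
      using aS S.tr_closed[OF y(1) db] by (simp add: X.m_comm S.R_simps(1) y(4))
    also have "\<dots> = Ttr S D X v ((d \<otimes>\<^bsub>S.R D\<^esub> \<phi> D b) \<otimes>\<^bsub>S.R D\<^esub> \<phi> D (Tres T D X v a))"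
      using S.frobenius[OF y(1) db aS] by (simp add: y(4) \<phi>_res[OF y(1) aT])
    also have "(d \<otimes>\<^bsub>S.R D\<^esub> \<phi> D b) \<otimes>\<^bsub>S.R D\<^esub> \<phi> D (Tres T D X v a) =
        d \<otimes>\<^bsub>S.R D\<^esub> \<phi> D (Tres T D X v a \<otimes>\<^bsub>T.R D\<^esub> b)"
      using y(2) bS vS by (simp add: \<phi>_mult[OF D vT bT] D.m_ac S.R_simps(1))
    finally show ?thesis
      using S.Tideal_tr[OF Q y(1) S.Tideal_mult[OF Q D sub[OF D va y(3)] y(2)]] by simp
  qed
  obtain C u c a where x: "gmap G C X u" "c \<in> Tval S C" "a \<in> I C"
    "x = Ttr S C X u (c \<otimes>\<^bsub>S.R C\<^esub> \<phi> C a)" using TextensionE[OF X x] .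
  note C = gmap_source[OF x(1)]
  interpret C: cring "S.R C" using C by (rule S.cring_R)
  note aS = \<phi>_closed[OF C T.Tideal_mem[OF I C x(3)]]
  note yS = S.Tideal_mem[OF Tideal_Textension[OF K] X y]
  note ry = Textension_res[OF K x(1) y]
  have "x \<otimes>\<^bsub>S.R X\<^esub> y = Ttr S C X u ((c \<otimes>\<^bsub>S.R C\<^esub> \<phi> C a) \<otimes>\<^bsub>S.R C\<^esub> Tres S C X u y)"
    using S.frobenius[OF x(1) S.mult_closed[OF C x(2) aS] yS] by (simp add: x(4))
  also have "(c \<otimes>\<^bsub>S.R C\<^esub> \<phi> C a) \<otimes>\<^bsub>S.R C\<^esub> Tres S C X u y = c \<otimes>\<^bsub>S.R C\<^esub> (\<phi> C a \<otimes>\<^bsub>S.R C\<^esub> Tres S C X u y)"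
    using x(2) aS S.res_closed[OF x(1) yS] by (simp add: C.m_assoc S.R_simps(1))
  finally show ?thesis
    using S.Tideal_tr[OF Q x(1) S.Tideal_mult[OF Q C 1[OF C x(3) ry] x(2)]] by simp
qed

section \<open>Inverse images of prime ideals\<close>

lemma Tprime_Tpreimage:
  assumes Q: "Tprime G S Q"
  shows "Tprime G T (Tpreimage G T \<phi> Q)"
  unfolding Tprime_def
proof (intro conjI allI impI ballI)
  have QI: "Tideal G S Q" using Q by (simp add: Tprime_def)
  show PI: "Tideal G T (Tpreimage G T \<phi> Q)" using QI by (rule Tideal_Tpreimage)
  obtain X where X: "fin_gset G X" "Q X \<noteq> Tval S X" using Q by (auto simp: Tprime_def)
  \<comment> \<open>Properness is carried by the unit: \<phi> maps one to one, and an ideal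
    containing one is everything at that G-set.\<close>
  then have "\<one>\<^bsub>T.R X\<^esub> \<notin> Tpreimage G T \<phi> Q X"
    using S.Tideal_one[OF QI X(1)] by (auto simp: mem_Tpreimage_iff \<phi>_one)
  then show "\<exists>X. fin_gset G X \<and> Tpreimage G T \<phi> Q X \<noteq> Tval T X"
    using X T.one_closed by metis
  fix X Y a b
  assume tr: "transitive_gset G X" "transitive_gset G Y" and aT: "a \<in> Tval T X" and bT: "b \<in> Tval T Y"
    and sub: "subfamily G (Tprod G T (principal G T X a) (principal G T Y b)) (Tpreimage G T \<phi> Q)"
  note X = fin_gset_transitive[OF tr(1)] and Y = fin_gset_transitive[OF tr(2)]
  let ?I = "principal G T X a" and ?K = "principal G T Y b"
  note I = T.Tideal_principal[OF X aT] and K = T.Tideal_principal[OF Y bT]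
  have prod: "\<phi> Z (x \<otimes>\<^bsub>T.R Z\<^esub> y) \<in> Q Z" if Z: "fin_gset G Z" and x: "x \<in> ?I Z" and y: "y \<in> ?K Z" for Z x y
  proof -
    \<comment> \<open>The transfer along the identity exhibits a plain product as an element of the
      product ideal.\<close>
    have "Ttr T Z Z (\<lambda>x\<in>pts Z. x) (x \<otimes>\<^bsub>T.R Z\<^esub> y) \<in> Tprod G T ?I ?K Z"
      using Z gmap_id[OF Z] x y by (auto simp: Tprod_def)
    then have "Ttr T Z Z (\<lambda>x\<in>pts Z. x) (x \<otimes>\<^bsub>T.R Z\<^esub> y) \<in> Tpreimage G T \<phi> Q Z"
      using sub Z by (auto simp: subfamily_def)
    then show ?thesis
      using T.mult_closed[OF Z T.Tideal_mem[OF I Z x] T.Tideal_mem[OF K Z y]]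
      by (simp add: T.add.dn_id Z mem_Tpreimage_iff)
  qed
  have "subfamily G (Tprod G S (principal G S X (\<phi> X a)) (principal G S Y (\<phi> Y b))) Q"
    unfolding subfamily_def
  proof (intro allI impI subsetI)
    fix Z z assume Z: "fin_gset G Z"
      and "z \<in> Tprod G S (principal G S X (\<phi> X a)) (principal G S Y (\<phi> Y b)) Z"
    then obtain A p x y where z: "gmap G A Z p" "x \<in> principal G S X (\<phi> X a) A"
      "y \<in> principal G S Y (\<phi> Y b) A" "z = Ttr S A Z p (x \<otimes>\<^bsub>S.R A\<^esub> y)"
      by (auto simp: Tprod_def)
    note A = gmap_source[OF z(1)]
    \<comment> \<open>The generated ideals in \<open>S\<close> are known only by minimality; the
      extensions contain them and have elements of explicit shape.\<close>
    have "x \<in> Textension ?I A" "y \<in> Textension ?K A"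
      using S.principal_least[OF Tideal_Textension[OF I] Textension_memI[OF I X T.principal_self[OF X]] A z(2)]
        S.principal_least[OF Tideal_Textension[OF K] Textension_memI[OF K Y T.principal_self[OF Y]] A z(3)] .
    then show "z \<in> Q Z"
      unfolding z(4)
      by (intro S.Tideal_tr[OF QI z(1)] Textension_mult_Textension[OF I K QI prod A])
  qed
  then have "\<phi> X a \<in> Q X \<or> \<phi> Y b \<in> Q Y"
    using Q tr \<phi>_closed[OF X aT] \<phi>_closed[OF Y bT] by (auto simp: Tprime_def)
  then show "a \<in> Tpreimage G T \<phi> Q X \<or> b \<in> Tpreimage G T \<phi> Q Y"
    using aT bT by (simp add: mem_Tpreimage_iff X Y)
qed

text \<open>The inverse image of \<open>Q\<close> contains \<open>I\<close> exactly when
  \<open>Q\<close> contains the extension of \<open>I\<close>. Hence the closed set V(I) pulls back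
  to the closed set of the extension.\<close>

lemma continuous_map_Tpreimage:
  "continuous_map (spec_topology G S) (spec_topology G T) (Tpreimage G T \<phi>)"
  unfolding continuous_map_def T.topspace_spec_topology S.topspace_spec_topology
proof (intro conjI allI impI)
  show *: "Tpreimage G T \<phi> \<in> Spec G S \<rightarrow> Spec G T"
    by (auto simp: Spec_def Tprime_Tpreimage)
  fix U assume "openin (spec_topology G T) U"
  then obtain I where I: "Tideal G T I" "U = Spec G T - Vset G T I"
    by (auto simp: T.openin_spec_topology)
  have "subfamily G I (Tpreimage G T \<phi> Q) \<longleftrightarrow> subfamily G (Textension I) Q" if Q: "Q \<in> Spec G S" for Q
  proof -
    have QI: "Tideal G S Q" using Q by (simp add: Spec_def Tprime_def)
    have "subfamily G I (Tpreimage G T \<phi> Q) \<longleftrightarrow> (\<forall>X a. fin_gset G X \<longrightarrow> a \<in> I X \<longrightarrow> \<phi> X a \<in> Q X)"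
      using T.Tideal_mem[OF I(1)] by (auto simp: subfamily_def mem_Tpreimage_iff subset_iff)
    also have "\<dots> \<longleftrightarrow> subfamily G (Textension I) Q"
      using Textension_memI[OF I(1)] Textension_least[OF I(1) QI] unfolding subfamily_def subset_iff by metis
    finally show ?thesis .
  qed
  then have "{Q \<in> Spec G S. Tpreimage G T \<phi> Q \<in> U} = Spec G S - Vset G S (Textension I)"
    using * by (auto simp: I(2) Vset_def)
  then show "openin (spec_topology G S) {Q \<in> Spec G S. Tpreimage G T \<phi> Q \<in> U}"
    using Tideal_Textension[OF I(1)] by (auto simp: S.openin_spec_topology)
qed

section \<open>Images of prime ideals containing the kernel\<close>

lemma \<phi>_mem_Timage_iff:
  assumes P: "Tideal G T P" and ker: "subfamily G (Tker G T S \<phi>) P" and X: "fin_gset G X"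
    and a: "a \<in> Tval T X"
  shows "\<phi> X a \<in> Timage G \<phi> P X \<longleftrightarrow> a \<in> P X"
proof
  assume "\<phi> X a \<in> Timage G \<phi> P X"
  then obtain b where b: "b \<in> P X" "\<phi> X a = \<phi> X b" by (auto simp: mem_Timage_iff X)
  note bT = T.Tideal_mem[OF P X b(1)]
  interpret S: cring "S.R X" using X by (rule S.cring_R)
  have "\<phi> X b \<in> carrier (S.R X)" using \<phi>_closed[OF X bT] by (simp add: S.R_simps)
  \<comment> \<open>Two elements with the same image differ by an element of the kernel, which lies
    in \<open>P\<close>. So \<open>P\<close> is a union of fibres of \<phi>.\<close>
  then have "\<phi> X b \<ominus>\<^bsub>S.R X\<^esub> \<phi> X b = \<zero>\<^bsub>S.R X\<^esub>" by (simp add: a_minus_def S.r_neg)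
  then have "\<phi> X (a \<ominus>\<^bsub>T.R X\<^esub> b) = \<zero>\<^bsub>S.R X\<^esub>" by (simp add: \<phi>_diff X a bT b(2))
  then have "a \<ominus>\<^bsub>T.R X\<^esub> b \<in> Tker G T S \<phi> X"
    using X a bT by (simp add: Tker_def a_kernel_def' T.diff_closed T.R_simps(1))
  then have "a \<ominus>\<^bsub>T.R X\<^esub> b \<in> P X"
    using ker X by (auto simp: subfamily_def)
  then show "a \<in> P X"
    using T.Tideal_add[OF P X b(1)] T.add_diff[OF X bT a] by metis
qed (auto simp: mem_Timage_iff X)

lemma Tprime_Timage:
  assumes surj: "surjective_morphism G T S \<phi>" and P: "Tprime G T P"
    and ker: "subfamily G (Tker G T S \<phi>) P"
  shows "Tprime G S (Timage G \<phi> P)"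
  unfolding Tprime_def
proof (intro conjI allI impI ballI)
  have PI: "Tideal G T P" using P by (simp add: Tprime_def)
  show "Tideal G S (Timage G \<phi> P)" using surj PI by (rule Tideal_Timage)
  obtain X where X: "fin_gset G X" "P X \<noteq> Tval T X" using P by (auto simp: Tprime_def)
  then obtain a where "a \<in> Tval T X" "a \<notin> P X" using T.Tideal_mem[OF PI X(1)] by blast
  \<comment> \<open>An element outside \<open>P\<close> is mapped outside the image of
    \<open>P\<close>, so properness survives.\<close>
  then show "\<exists>X. fin_gset G X \<and> Timage G \<phi> P X \<noteq> Tval S X"
    using X(1) \<phi>_mem_Timage_iff[OF PI ker X(1)] \<phi>_closed[OF X(1)] by metis
  fix X Y x y
  assume tr: "transitive_gset G X" "transitive_gset G Y" and xS: "x \<in> Tval S X" and yS: "y \<in> Tval S Y"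
    and sub: "subfamily G (Tprod G S (principal G S X x) (principal G S Y y)) (Timage G \<phi> P)"
  note X = fin_gset_transitive[OF tr(1)] and Y = fin_gset_transitive[OF tr(2)]
  obtain a where a: "a \<in> Tval T X" "x = \<phi> X a"
    using xS surj X by (auto simp: surjective_morphism_def)
  obtain b where b: "b \<in> Tval T Y" "y = \<phi> Y b"
    using yS surj Y by (auto simp: surjective_morphism_def)
  note I = T.Tideal_principal[OF X a(1)] and K = T.Tideal_principal[OF Y b(1)]
  \<comment> \<open>The inverse image of the ideal generated by \<open>\<phi> W d\<close> is an
    ideal containing \<open>d\<close>, hence it contains everything that \<open>d\<close>
    generates.\<close>
  have push: "\<phi> Z c \<in> principal G S W (\<phi> W d) Z"
    if W: "fin_gset G W" and d: "d \<in> Tval T W" and Z: "fin_gset G Z" and c: "c \<in> principal G T W d Z" for W d Z c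
  proof -
    have "d \<in> Tpreimage G T \<phi> (principal G S W (\<phi> W d)) W"
      using d by (simp add: mem_Tpreimage_iff W S.principal_self)
    from T.principal_least[OF Tideal_Tpreimage[OF S.Tideal_principal[OF W \<phi>_closed[OF W d]]] this Z c]
    show ?thesis by (simp add: mem_Tpreimage_iff Z)
  qed
  have "subfamily G (Tprod G T (principal G T X a) (principal G T Y b)) P"
    unfolding subfamily_def
  proof (intro allI impI subsetI)
    fix Z z assume Z: "fin_gset G Z" and "z \<in> Tprod G T (principal G T X a) (principal G T Y b) Z"
    then obtain A p c d where z: "gmap G A Z p" "c \<in> principal G T X a A" "d \<in> principal G T Y b A"
      "z = Ttr T A Z p (c \<otimes>\<^bsub>T.R A\<^esub> d)"
      by (auto simp: Tprod_def)
    note A = gmap_source[OF z(1)]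
    note cT = T.Tideal_mem[OF I A z(2)] and dT = T.Tideal_mem[OF K A z(3)]
    note cdT = T.mult_closed[OF A cT dT]
    have "\<phi> Z z = Ttr S A Z p (\<phi> A c \<otimes>\<^bsub>S.R A\<^esub> \<phi> A d)"
      by (simp add: z(4) \<phi>_tr[OF z(1) cdT] \<phi>_mult[OF A cT dT])
    then have "\<phi> Z z \<in> Tprod G S (principal G S X x) (principal G S Y y) Z"
      using Z z(1) push[OF X a(1) A z(2)] push[OF Y b(1) A z(3)] by (auto simp: Tprod_def a b)
    then have "\<phi> Z z \<in> Timage G \<phi> P Z" using sub Z by (auto simp: subfamily_def)
    then show "z \<in> P Z"
      using \<phi>_mem_Timage_iff[OF PI ker Z] T.tr_closed[OF z(1) cdT] by (simp add: z(4))
  qed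
  then have "a \<in> P X \<or> b \<in> P Y"
    using P tr a(1) b(1) by (auto simp: Tprime_def)
  then show "x \<in> Timage G \<phi> P X \<or> y \<in> Timage G \<phi> P Y"
    by (auto simp: mem_Timage_iff X Y a b)
qed

text \<open>For \<open>P\<close> above the kernel, the image of \<open>P\<close> contains
  \<open>J\<close> exactly when \<open>P\<close> contains the inverse image of \<open>J\<close>. So
  V(J) pulls back to the trace on \<open>?V\<close> of a closed set of the spectrum of
  \<open>T\<close>.\<close>

lemma continuous_map_Timage:
  assumes surj: "surjective_morphism G T S \<phi>"
  shows "continuous_map (subtopology (spec_topology G T) (Vset G T (Tker G T S \<phi>)))
    (spec_topology G S) (Timage G \<phi>)"
proof -
  let ?V = "Vset G T (Tker G T S \<phi>)"
  have V: "Spec G T \<inter> ?V = ?V" by (auto simp: Vset_def)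
  show ?thesis
    unfolding continuous_map_def topspace_subtopology T.topspace_spec_topology
      S.topspace_spec_topology V
  proof (intro conjI allI impI)
    show *: "Timage G \<phi> \<in> ?V \<rightarrow> Spec G S"
      using Tprime_Timage[OF surj] by (auto simp: Vset_def Spec_def)
    fix U assume "openin (spec_topology G S) U"
    then obtain J where J: "Tideal G S J" "U = Spec G S - Vset G S J"
      by (auto simp: S.openin_spec_topology)
    note preJ = Tideal_Tpreimage[OF J(1)]
    have "subfamily G J (Timage G \<phi> P) \<longleftrightarrow> subfamily G (Tpreimage G T \<phi> J) P" if P: "P \<in> ?V" for P
    proof -
      have PI: "Tideal G T P" and ker: "subfamily G (Tker G T S \<phi>) P"
        using P by (auto simp: Vset_def Spec_def Tprime_def)
      have "J X \<subseteq> Timage G \<phi> P X \<longleftrightarrow> Tpreimage G T \<phi> J X \<subseteq> P X" if X: "fin_gset G X" for X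
      proof -
        \<comment> \<open>Surjectivity makes \<open>J\<close> the image of its inverse image, so
          both containments can be tested on elements of the inverse image.\<close>
        have "J X = \<phi> X ` Tpreimage G T \<phi> J X"
        proof (intro equalityI subsetI)
          fix x assume x: "x \<in> J X"
          then obtain a where "a \<in> Tval T X" "x = \<phi> X a"
            using surj X S.Tideal_mem[OF J(1) X x] by (auto simp: surjective_morphism_def)
          with x show "x \<in> \<phi> X ` Tpreimage G T \<phi> J X" by (auto simp: mem_Tpreimage_iff X)
        qed (auto simp: mem_Tpreimage_iff X)
        then have "J X \<subseteq> Timage G \<phi> P X \<longleftrightarrow> (\<forall>a\<in>Tpreimage G T \<phi> J X. \<phi> X a \<in> Timage G \<phi> P X)"
          by auto
        also have "\<dots> \<longleftrightarrow> Tpreimage G T \<phi> J X \<subseteq> P X"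
          using \<phi>_mem_Timage_iff[OF PI ker X] by (auto simp: mem_Tpreimage_iff X)
        finally show ?thesis .
      qed
      then show ?thesis by (simp add: subfamily_def)
    qed
    then have "{P \<in> ?V. Timage G \<phi> P \<in> U} = (Spec G T - Vset G T (Tpreimage G T \<phi> J)) \<inter> ?V"
      using * by (auto simp: J(2) Vset_def)
    then show "openin (subtopology (spec_topology G T) ?V) {P \<in> ?V. Timage G \<phi> P \<in> U}"
      using preJ by (auto simp: openin_subtopology T.openin_spec_topology)
  qed
qed

end

theorem theorem4p9:
  fixes G :: "('g, 'm) monoid_scheme"
    and T :: "('g, 'u::infinite, 't) tambara"
    and S :: "('g, 'u, 's) tambara"
    and \<phi> :: "('g, 'u) gset \<Rightarrow> 't \<Rightarrow> 's"
  assumes "group G" and "finite (carrier G)"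
    and "tambara_functor G T" and "nonzero_tambara G T"
    and "tambara_functor G S" and "nonzero_tambara G S"
    and "tambara_morphism G T S \<phi>"
  shows "((\<forall>\<qq>. Tprime G S \<qq> \<longrightarrow> Tprime G T (Tpreimage G T \<phi> \<qq>)) \<and>
          continuous_map (spec_topology G S) (spec_topology G T) (Tpreimage G T \<phi>)) \<and>
         (surjective_morphism G T S \<phi> \<longrightarrow>
          (\<forall>\<pp>. Tprime G T \<pp> \<and> subfamily G (Tker G T S \<phi>) \<pp> \<longrightarrow> Tprime G S (Timage G \<phi> \<pp>)) \<and>
          continuous_map (subtopology (spec_topology G T) (Vset G T (Tker G T S \<phi>)))
            (spec_topology G S) (Timage G \<phi>))"
proof -
  interpret tambara_hom G T S \<phi>
    using assms by unfold_locales
  show ?thesis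
    using Tprime_Tpreimage continuous_map_Tpreimage Tprime_Timage continuous_map_Timage by blast
qed

end
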